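(* Let $M$ and $B$ be complex manifolds, with $M$ compact and $B$ path connected, and let $\pi\colon M\to B$ be a locally trivial fibration whose fibers are positive dimensional complex submanifolds of $M$. Let $\Omega$ be a locally conformally symplectic form on $M$ taming the complex structure. If $\pi^*\colon H^1(B)\to H^1(M)$ is an isomorphism, then $\Omega$ is globally conformal to a Hermitian-symplectic form.
   Context: Manifolds are connected, and $H^1(\cdot)$ denotes first cohomology with real coefficients. Let $J$ be the complex structure of $M$. A locally conformally symplectic (LCS) form taming $J$ is a real $2$-form $\Omega$ such that there is a closed real one-form $\theta$ (the Lee form) with $d\Omega=\theta\wedge\Omega$, and such that the $(1,1)$-component $\Omega^{(1,1)}$ is positive, equivalently $\Omega(X,JX)>0$ for every non-zero real tangent vector $X$. A Hermitian-symplectic form is a real $2$-form $\Omega_0$ with $d\Omega_0=0$ and $\Omega_0^{(1,1)}$ positive. $\Omega$ is globally conformal to a Hermitian-symplectic form if there is a smooth function $f\colon M\to\mathbb R$ such that $e^{-f}\Omega$ is Hermitian-symplectic. *)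

theory Defs
  imports "HOL-Analysis.Analysis"
begin

section \<open>Finite-dimensional complex model spaces\<close>

text \<open>
  Complex manifolds are modelled on finite-dimensional complex vector spaces.  Multiplication by
  the imaginary unit is a class operation, so that dimension zero (a base that is a single point)
  is covered as well: the types \<^typ>\<open>complex^'n\<close> all have positive dimension.
\<close>

class complex_model = real_normed_vector +
  fixes i_mult :: "'a \<Rightarrow> 'a"
  assumes i_mult_add: "i_mult (x + y) = i_mult x + i_mult y"
    and i_mult_scaleR: "i_mult (r *\<^sub>R x) = r *\<^sub>R i_mult x"
    and i_mult_i_mult: "i_mult (i_mult x) = - x"
    and finite_dimensional: "\<exists>A. finite A \<and> (\<forall>x. \<exists>r. x = (\<Sum>a\<in>A. r a *\<^sub>R a))"

instantiation complex :: complex_model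
begin
definition "i_mult z = \<i> * (z::complex)"
instance
proof
  show "\<exists>A::complex set. finite A \<and> (\<forall>x. \<exists>r. x = (\<Sum>a\<in>A. r a *\<^sub>R a))"
    by (intro exI[of _ Basis] conjI allI) (simp, metis euclidean_representation)
qed (simp_all add: i_mult_complex_def algebra_simps)
end

instantiation vec :: ("{complex_model, euclidean_space}", finite) complex_model
begin
definition "i_mult (x :: 'a^'b) = (\<chi> k. i_mult (x $ k))"
instance
proof
  show "\<exists>A::('a^'b) set. finite A \<and> (\<forall>x. \<exists>r. x = (\<Sum>a\<in>A. r a *\<^sub>R a))"
    by (intro exI[of _ Basis] conjI allI) (simp, metis euclidean_representation)
qed (simp_all add: i_mult_vec_def vec_eq_iff i_mult_add i_mult_scaleR i_mult_i_mult)
end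

instantiation unit :: real_normed_vector
begin
definition "(0::unit) = ()"
definition "(x::unit) + y = ()"
definition "r *\<^sub>R (x::unit) = ()"
definition "norm (x::unit) = (0::real)"
definition "sgn (x::unit) = ()"
definition "dist (x::unit) y = (0::real)"
definition "(uniformity :: (unit \<times> unit) filter) = (INF e\<in>{0<..}. principal {(x, y). dist x y < e})"
definition "open (U :: unit set) \<longleftrightarrow> True"
instance
proof
  fix U :: "unit set"
  have "(INF e\<in>{0<..}. principal {(x::unit, y). dist x y < (e::real)}) = principal UNIV"
    by (auto simp: dist_unit_def intro!: INF_eq_const)
  then show "open U \<longleftrightarrow> (\<forall>x\<in>U. \<forall>\<^sub>F (x', y) in uniformity. x' = x \<longrightarrow> y \<in> U)"
    by (simp add: open_unit_def uniformity_unit_def eventually_principal)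
qed (simp_all add: norm_unit_def dist_unit_def uniformity_unit_def)
end

instantiation unit :: complex_model
begin
definition "i_mult (x::unit) = ()"
instance
proof
  show "\<exists>A::unit set. finite A \<and> (\<forall>x. \<exists>r. x = (\<Sum>a\<in>A. r a *\<^sub>R a))"
    by (intro exI[of _ "{}"]) auto
qed simp_all
end


section \<open>Smooth and holomorphic maps between open subsets of normed spaces\<close>

text \<open>These are meant for finite-dimensional spaces and open \<open>S\<close>, where \<open>smooth_on\<close> is \<open>C\<close>-infinity.\<close>

primrec differentiable_upto ::
    "'e::real_normed_vector set \<Rightarrow> ('e \<Rightarrow> 'f::real_normed_vector) \<Rightarrow> nat \<Rightarrow> bool" where
  "differentiable_upto S f 0 \<longleftrightarrow> continuous_on S f"
| "differentiable_upto S f (Suc n) \<longleftrightarrow>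
     (\<forall>x\<in>S. f differentiable (at x)) \<and>
     (\<forall>v. differentiable_upto S (\<lambda>x. frechet_derivative f (at x) v) n)"

definition smooth_on :: "'e::real_normed_vector set \<Rightarrow> ('e \<Rightarrow> 'f::real_normed_vector) \<Rightarrow> bool" where
  "smooth_on S f \<longleftrightarrow> (\<forall>n. differentiable_upto S f n)"

text \<open>Cauchy-Riemann equations: the derivative is complex linear.\<close>

definition holomorphic_map_on ::
    "'e::complex_model set \<Rightarrow> ('e \<Rightarrow> 'f::complex_model) \<Rightarrow> bool" where
  "holomorphic_map_on S f \<longleftrightarrow> smooth_on S f \<and>
     (\<forall>x\<in>S. \<forall>v. frechet_derivative f (at x) (i_mult v) = i_mult (frechet_derivative f (at x) v))"


section \<open>Manifolds\<close>

text \<open>A chart is a pair of its domain and its coordinate map.  An atlas need not be maximal.\<close>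

type_synonym ('a, 'e) chart = "'a set \<times> ('a \<Rightarrow> 'e)"

record ('a, 'e) mfd =
  mtop :: "'a topology"
  atlas :: "('a, 'e) chart set"

abbreviation points :: "('a, 'e) mfd \<Rightarrow> 'a set" where
  "points M \<equiv> topspace (mtop M)"

definition chart_img :: "('a, 'e) chart \<Rightarrow> 'e set" where
  "chart_img c = snd c ` fst c"

definition chart_inv :: "('a, 'e) chart \<Rightarrow> 'e \<Rightarrow> 'a" where
  "chart_inv c = inv_into (fst c) (snd c)"

definition overlap :: "('a, 'e) chart \<Rightarrow> ('a, 'e) chart \<Rightarrow> 'e set" where
  "overlap c d = snd c ` (fst c \<inter> fst d)"

definition transition :: "('a, 'e) chart \<Rightarrow> ('a, 'e) chart \<Rightarrow> 'e \<Rightarrow> 'e" where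
  "transition c d = snd d \<circ> chart_inv c"

definition is_chart :: "'a topology \<Rightarrow> ('a, 'e::real_normed_vector) chart \<Rightarrow> bool" where
  "is_chart X c \<longleftrightarrow> openin X (fst c) \<and> open (chart_img c) \<and>
     homeomorphic_map (subtopology X (fst c)) (top_of_set (chart_img c)) (snd c)"

definition smooth_manifold :: "('a, 'e::real_normed_vector) mfd \<Rightarrow> bool" where
  "smooth_manifold M \<longleftrightarrow>
     Hausdorff_space (mtop M) \<and> second_countable (mtop M) \<and>
     (\<forall>c\<in>atlas M. is_chart (mtop M) c) \<and> \<Union> (fst ` atlas M) = points M \<and>
     (\<forall>c\<in>atlas M. \<forall>d\<in>atlas M. smooth_on (overlap c d) (transition c d))"

definition complex_manifold :: "('a, 'e::complex_model) mfd \<Rightarrow> bool" where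
  "complex_manifold M \<longleftrightarrow> smooth_manifold M \<and>
     (\<forall>c\<in>atlas M. \<forall>d\<in>atlas M. holomorphic_map_on (overlap c d) (transition c d))"

definition smooth_map ::
    "('a, 'e::real_normed_vector) mfd \<Rightarrow> ('b, 'f::real_normed_vector) mfd \<Rightarrow> ('a \<Rightarrow> 'b) \<Rightarrow> bool" where
  "smooth_map M N f \<longleftrightarrow> continuous_map (mtop M) (mtop N) f \<and>
     (\<forall>c\<in>atlas M. \<forall>d\<in>atlas N.
        smooth_on (snd c ` (fst c \<inter> f -` fst d)) (snd d \<circ> f \<circ> chart_inv c))"

definition smooth_function :: "('a, 'e::real_normed_vector) mfd \<Rightarrow> ('a \<Rightarrow> real) \<Rightarrow> bool" where
  "smooth_function M f \<longleftrightarrow> (\<forall>c\<in>atlas M. smooth_on (chart_img c) (f \<circ> chart_inv c))"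

definition diffeomorphism ::
    "('a, 'e::real_normed_vector) mfd \<Rightarrow> ('b, 'f::real_normed_vector) mfd \<Rightarrow> ('a \<Rightarrow> 'b) \<Rightarrow> bool" where
  "diffeomorphism M N f \<longleftrightarrow> smooth_map M N f \<and>
     (\<exists>g. smooth_map N M g \<and> (\<forall>x\<in>points M. g (f x) = x) \<and> (\<forall>y\<in>points N. f (g y) = y))"

definition open_part :: "('a, 'e) mfd \<Rightarrow> 'a set \<Rightarrow> ('a, 'e) mfd" where
  "open_part M U = \<lparr>mtop = subtopology (mtop M) U, atlas = (\<lambda>c. (fst c \<inter> U, snd c)) ` atlas M\<rparr>"

definition product_mfd :: "('a, 'e) mfd \<Rightarrow> ('b, 'f) mfd \<Rightarrow> ('a \<times> 'b, 'e \<times> 'f) mfd" where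
  "product_mfd M N = \<lparr>mtop = prod_topology (mtop M) (mtop N),
     atlas = (\<lambda>(c, d). (fst c \<times> fst d, map_prod (snd c) (snd d))) ` (atlas M \<times> atlas N)\<rparr>"

text \<open>
  Smooth fibre bundle.  The typical fibre \<open>F\<close> is a parameter because HOL cannot quantify
  existentially over its carrier and model types; universally quantifying a hypothesis over \<open>F\<close>
  amounts to the same.
\<close>

definition locally_trivial_fibration ::
    "('a, 'e::real_normed_vector) mfd \<Rightarrow> ('b, 'n::real_normed_vector) mfd \<Rightarrow>
     ('c, 'f::real_normed_vector) mfd \<Rightarrow> ('a \<Rightarrow> 'b) \<Rightarrow> bool" where
  "locally_trivial_fibration M B F \<pi> \<longleftrightarrow> smooth_map M B \<pi> \<and>
     (\<forall>b\<in>points B. \<exists>U \<Phi>. openin (mtop B) U \<and> b \<in> U \<and>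
        diffeomorphism (open_part M {x \<in> points M. \<pi> x \<in> U}) (product_mfd (open_part B U) F) \<Phi> \<and>
        (\<forall>x\<in>points M. \<pi> x \<in> U \<longrightarrow> fst (\<Phi> x) = \<pi> x))"

text \<open>
  Embedded complex submanifold of complex dimension \<open>k\<close>: near each of its points it is a
  linear slice in some holomorphic chart of \<open>M\<close> (a chart of the maximal atlas).  Note that
  \<^const>\<open>dim\<close> is the real dimension.
\<close>

definition holomorphic_chart :: "('a, 'e::complex_model) mfd \<Rightarrow> ('a, 'e) chart \<Rightarrow> bool" where
  "holomorphic_chart M c \<longleftrightarrow> is_chart (mtop M) c \<and>
     (\<forall>d\<in>atlas M. holomorphic_map_on (overlap c d) (transition c d) \<and>
                  holomorphic_map_on (overlap d c) (transition d c))"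

definition complex_submanifold :: "('a, 'e::complex_model) mfd \<Rightarrow> 'a set \<Rightarrow> nat \<Rightarrow> bool" where
  "complex_submanifold M S k \<longleftrightarrow> S \<subseteq> points M \<and>
     (\<forall>p\<in>S. \<exists>c V. holomorphic_chart M c \<and> p \<in> fst c \<and>
        subspace V \<and> i_mult ` V \<subseteq> V \<and> dim V = 2 * k \<and>
        snd c ` (fst c \<inter> S) = chart_img c \<inter> V)"


section \<open>Differential forms of low degree\<close>

text \<open>
  A form is given by its local representatives: \<open>\<alpha> c x v\<close> is the value of \<open>\<alpha>\<close> at the point with
  coordinates \<open>x\<close> in the chart \<open>c\<close> on the tangent vector whose components in \<open>c\<close> are \<open>v\<close>.
  Only charts \<open>c\<close> of the atlas and points \<open>x\<close> of \<open>chart_img c\<close> are relevant.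
\<close>

type_synonym ('a, 'e) form1 = "('a, 'e) chart \<Rightarrow> 'e \<Rightarrow> 'e \<Rightarrow> real"
type_synonym ('a, 'e) form2 = "('a, 'e) chart \<Rightarrow> 'e \<Rightarrow> 'e \<Rightarrow> 'e \<Rightarrow> real"
type_synonym ('a, 'e) form3 = "('a, 'e) chart \<Rightarrow> 'e \<Rightarrow> 'e \<Rightarrow> 'e \<Rightarrow> 'e \<Rightarrow> real"

definition one_form :: "('a, 'e::real_normed_vector) mfd \<Rightarrow> ('a, 'e) form1 \<Rightarrow> bool" where
  "one_form M \<alpha> \<longleftrightarrow> (\<forall>c\<in>atlas M.
     (\<forall>x\<in>chart_img c. linear (\<alpha> c x)) \<and>
     (\<forall>v. smooth_on (chart_img c) (\<lambda>x. \<alpha> c x v)) \<and>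
     (\<forall>d\<in>atlas M. \<forall>x\<in>overlap c d. \<forall>v.
        \<alpha> c x v = \<alpha> d (transition c d x) (frechet_derivative (transition c d) (at x) v)))"

definition two_form :: "('a, 'e::real_normed_vector) mfd \<Rightarrow> ('a, 'e) form2 \<Rightarrow> bool" where
  "two_form M \<Omega> \<longleftrightarrow> (\<forall>c\<in>atlas M.
     (\<forall>x\<in>chart_img c. (\<forall>u. linear (\<Omega> c x u)) \<and> (\<forall>u v. \<Omega> c x u v = - \<Omega> c x v u)) \<and>
     (\<forall>u v. smooth_on (chart_img c) (\<lambda>x. \<Omega> c x u v)) \<and>
     (\<forall>d\<in>atlas M. \<forall>x\<in>overlap c d. \<forall>u v.
        \<Omega> c x u v = \<Omega> d (transition c d x) (frechet_derivative (transition c d) (at x) u)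
                                              (frechet_derivative (transition c d) (at x) v)))"

definition ext_d0 :: "('a \<Rightarrow> real) \<Rightarrow> ('a, 'e::real_normed_vector) form1" where
  "ext_d0 f c x v = frechet_derivative (f \<circ> chart_inv c) (at x) v"

definition ext_d1 :: "('a, 'e::real_normed_vector) form1 \<Rightarrow> ('a, 'e) form2" where
  "ext_d1 \<alpha> c x u v =
     frechet_derivative (\<lambda>y. \<alpha> c y v) (at x) u - frechet_derivative (\<lambda>y. \<alpha> c y u) (at x) v"

definition ext_d2 :: "('a, 'e::real_normed_vector) form2 \<Rightarrow> ('a, 'e) form3" where
  "ext_d2 \<Omega> c x u v w =
     frechet_derivative (\<lambda>y. \<Omega> c y v w) (at x) u
     - frechet_derivative (\<lambda>y. \<Omega> c y u w) (at x) v
     + frechet_derivative (\<lambda>y. \<Omega> c y u v) (at x) w"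

definition wedge12 :: "('a, 'e) form1 \<Rightarrow> ('a, 'e) form2 \<Rightarrow> ('a, 'e) form3" where
  "wedge12 \<theta> \<Omega> c x u v w =
     \<theta> c x u * \<Omega> c x v w - \<theta> c x v * \<Omega> c x u w + \<theta> c x w * \<Omega> c x u v"

definition closed_one_form :: "('a, 'e::real_normed_vector) mfd \<Rightarrow> ('a, 'e) form1 \<Rightarrow> bool" where
  "closed_one_form M \<alpha> \<longleftrightarrow> one_form M \<alpha> \<and>
     (\<forall>c\<in>atlas M. \<forall>x\<in>chart_img c. \<forall>u v. ext_d1 \<alpha> c x u v = 0)"

text \<open>
  The pullback uses an arbitrary chart of \<open>N\<close> around the image point; by the transformation law
  of one-forms its value does not depend on the choice.
\<close>

definition pullback1 ::
    "('b, 'f::real_normed_vector) mfd \<Rightarrow> ('a \<Rightarrow> 'b) \<Rightarrow> ('b, 'f) form1 \<Rightarrow>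
     ('a, 'e::real_normed_vector) form1" where
  "pullback1 N f \<alpha> c x v =
     (let p = f (chart_inv c x); d = (SOME d. d \<in> atlas N \<and> p \<in> fst d)
      in \<alpha> d (snd d p) (frechet_derivative (snd d \<circ> f \<circ> chart_inv c) (at x) v))"


section \<open>First de Rham cohomology\<close>

definition cohomologous ::
    "('a, 'e::real_normed_vector) mfd \<Rightarrow> ('a, 'e) form1 \<Rightarrow> ('a, 'e) form1 \<Rightarrow> bool" where
  "cohomologous M \<alpha> \<beta> \<longleftrightarrow> closed_one_form M \<alpha> \<and> closed_one_form M \<beta> \<and>
     (\<exists>f. smooth_function M f \<and>
        (\<forall>c\<in>atlas M. \<forall>x\<in>chart_img c. \<forall>v. \<alpha> c x v - \<beta> c x v = ext_d0 f c x v))"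

definition H1 :: "('a, 'e::real_normed_vector) mfd \<Rightarrow> ('a, 'e) form1 set set" where
  "H1 M = {\<alpha>. closed_one_form M \<alpha>} // {(\<alpha>, \<beta>). cohomologous M \<alpha> \<beta>}"

text \<open>
  The induced map sends the class of \<open>\<alpha>\<close> to the class of its pullback.  It is linear, so it is an
  isomorphism precisely when it is bijective.
\<close>

definition H1_map ::
    "('a, 'e::real_normed_vector) mfd \<Rightarrow> ('b, 'f::real_normed_vector) mfd \<Rightarrow> ('a \<Rightarrow> 'b) \<Rightarrow>
     ('b, 'f) form1 set \<Rightarrow> ('a, 'e) form1 set" where
  "H1_map M N f A = {\<beta>. \<exists>\<alpha>\<in>A. cohomologous M \<beta> (pullback1 N f \<alpha>)}"

definition H1_iso ::
    "('a, 'e::real_normed_vector) mfd \<Rightarrow> ('b, 'f::real_normed_vector) mfd \<Rightarrow> ('a \<Rightarrow> 'b) \<Rightarrow> bool" where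
  "H1_iso M N f \<longleftrightarrow> bij_betw (H1_map M N f) (H1 N) (H1 M)"


section \<open>Locally conformally symplectic and Hermitian-symplectic forms\<close>

text \<open>
  In a holomorphic chart the complex structure \<open>J\<close> acts on components by \<^const>\<open>i_mult\<close>.  The
  \<open>(1,1)\<close>-component of a real two-form is its \<open>J\<close>-invariant part.
\<close>

definition part11 :: "('a, 'e::complex_model) form2 \<Rightarrow> ('a, 'e) form2" where
  "part11 \<Omega> c x u v = (\<Omega> c x u v + \<Omega> c x (i_mult u) (i_mult v)) / 2"

definition positive11 :: "('a, 'e::complex_model) mfd \<Rightarrow> ('a, 'e) form2 \<Rightarrow> bool" where
  "positive11 M \<omega> \<longleftrightarrow> (\<forall>c\<in>atlas M. \<forall>x\<in>chart_img c. \<forall>v. v \<noteq> 0 \<longrightarrow> \<omega> c x v (i_mult v) > 0)"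

definition lcs_taming :: "('a, 'e::complex_model) mfd \<Rightarrow> ('a, 'e) form2 \<Rightarrow> bool" where
  "lcs_taming M \<Omega> \<longleftrightarrow> two_form M \<Omega> \<and> positive11 M (part11 \<Omega>) \<and>
     (\<exists>\<theta>. closed_one_form M \<theta> \<and>
        (\<forall>c\<in>atlas M. \<forall>x\<in>chart_img c. \<forall>u v w. ext_d2 \<Omega> c x u v w = wedge12 \<theta> \<Omega> c x u v w))"

definition hermitian_symplectic :: "('a, 'e::complex_model) mfd \<Rightarrow> ('a, 'e) form2 \<Rightarrow> bool" where
  "hermitian_symplectic M \<Omega> \<longleftrightarrow> two_form M \<Omega> \<and> positive11 M (part11 \<Omega>) \<and>
     (\<forall>c\<in>atlas M. \<forall>x\<in>chart_img c. \<forall>u v w. ext_d2 \<Omega> c x u v w = 0)"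

definition fun_mult2 :: "('a \<Rightarrow> real) \<Rightarrow> ('a, 'e) form2 \<Rightarrow> ('a, 'e) form2" where
  "fun_mult2 g \<Omega> c x u v = g (chart_inv c x) * \<Omega> c x u v"

definition globally_conformal_HS :: "('a, 'e::complex_model) mfd \<Rightarrow> ('a, 'e) form2 \<Rightarrow> bool" where
  "globally_conformal_HS M \<Omega> \<longleftrightarrow>
     (\<exists>f. smooth_function M f \<and> hermitian_symplectic M (fun_mult2 (\<lambda>p. exp (- f p)) \<Omega>))"

end

theory Submission
  imports Defs
begin

text \<open>
  The assumption on \<open>H\<^sup>1\<close> allows us to replace \<open>\<Omega>\<close> by a conformal multiple whose Lee form is the
  pullback of a closed form \<open>\<alpha>\<close> on the base, so that \<open>\<Omega>\<close> is closed on the fibres.  The fibres are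
  complex submanifolds, so by taming \<open>\<Omega>\<close> is nondegenerate on them and gives them a finite positive
  volume \<open>v\<close>, the integral of the density \<open>sqrt \<bar>det \<Omega>\<bar>\<close>.  Along a curve in the base with velocity \<open>w\<close>
  the restrictions \<open>\<omega>\<close> of \<open>\<Omega>\<close> to the fibres satisfy \<open>\<omega>' = \<alpha>(w) \<omega> + d\<beta>\<close>, because \<open>d\<Omega> = \<alpha> \<and> \<Omega>\<close>.  The
  exact term changes the density by a divergence, which integrates to zero, and so
  \<open>dv = (n/2) v \<alpha>\<close> with \<open>n\<close> the real dimension of the fibre.  Hence \<open>\<alpha> = d ((2/n) ln v)\<close> is exact.
\<close>

section \<open>Iterated differentiability\<close>

text \<open>Fibre integrals are finite sums of Euclidean integrals cut off by a partition of unity,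
  and the change of variables formula shows that the sum depends on the base point alone
  (\<open>total_unique\<close>). Hence \<open>vol\<close> is one function on all of B although
  trivializations are local, and the primitive of \<alpha> is global. The price of the cut-off is
  that the divergence does not integrate to zero piece by piece: integration by parts leaves the
  terms - d\<phi>_i(Z) times the density, where Z is the field dual to \<beta>. They cancel in the
  sum over i because the \<phi>_i add up to 1, provided that the local Z come from one vector field
  on the fibre; \<open>compatible_field\<close> expresses this. The factor n/2 is the degree n of
  the determinant, halved by the square root, and \<open>DIM('f)\<close> is positive. The model
  space of B is not assumed Euclidean, so B is explored along straight lines in a chart and the
  directional derivatives are assembled at the end. The partition is only known to be C1, so
  smoothness of the primitive is read off from its differential.\<close>

lemma differentiable_upto_imp_continuous_on:
  "differentiable_upto S f n \<Longrightarrow> continuous_on S f"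
  by (cases n) (auto intro!: continuous_at_imp_continuous_on differentiable_imp_continuous_within)

lemma differentiable_upto_subset:
  "differentiable_upto S f n \<Longrightarrow> T \<subseteq> S \<Longrightarrow> differentiable_upto T f n"
  by (induction n arbitrary: f) (auto intro: continuous_on_subset)

lemma differentiable_upto_Suc_imp:
  "differentiable_upto S f (Suc n) \<Longrightarrow> differentiable_upto S f n"
  by (induction n arbitrary: f)
    (auto intro!: continuous_at_imp_continuous_on differentiable_imp_continuous_within)

lemma frechet_derivative_cong_open:
  assumes "open S" "x \<in> S" "\<And>y. y \<in> S \<Longrightarrow> f y = g y"
  shows "frechet_derivative f (at x) = frechet_derivative g (at x)"
proof -
  have "(f has_derivative D) (at x) \<longleftrightarrow> (g has_derivative D) (at x)" for D
    using assms by (metis has_derivative_transform_within_open)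
  then show ?thesis
    by (simp add: frechet_derivative_def)
qed

lemma differentiable_cong_open:
  assumes "open S" "x \<in> S" "\<And>y. y \<in> S \<Longrightarrow> f y = g y"
  shows "f differentiable (at x) \<longleftrightarrow> g differentiable (at x)"
  using assms unfolding differentiable_def by (metis has_derivative_transform_within_open)

lemma differentiable_upto_cong:
  assumes "open S" "\<And>y. y \<in> S \<Longrightarrow> f y = g y"
  shows "differentiable_upto S f n \<longleftrightarrow> differentiable_upto S g n"
  using assms(2)
proof (induction n arbitrary: f g)
  case 0
  then show ?case by (auto intro: continuous_on_cong)
next
  case (Suc n)
  have "differentiable_upto S (\<lambda>x. frechet_derivative f (at x) v) n
     \<longleftrightarrow> differentiable_upto S (\<lambda>x. frechet_derivative g (at x) v) n" for v
    by (rule Suc.IH) (simp add: frechet_derivative_cong_open[OF assms(1) _ Suc.prems])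
  moreover have "f differentiable (at x) \<longleftrightarrow> g differentiable (at x)" if "x \<in> S" for x
    using differentiable_cong_open[OF assms(1) that Suc.prems] .
  ultimately show ?case by auto
qed

text \<open>Needed because coordinate expressions are available only near a point, in a chart around
  it.\<close>

lemma differentiable_upto_local:
  assumes "\<And>x. x \<in> S \<Longrightarrow> \<exists>U. open U \<and> x \<in> U \<and> differentiable_upto U f n"
  shows "differentiable_upto S f n"
  using assms
proof (induction n arbitrary: f)
  case 0
  then show ?case
    by (fastforce simp: continuous_on_eq_continuous_at intro: continuous_at_imp_continuous_on)
next
  case (Suc n)
  show ?case
    unfolding differentiable_upto.simps
  proof (intro conjI allI ballI)
    show "f differentiable (at x)" if "x \<in> S" for x
      using Suc.prems[OF that] by auto
    show "differentiable_upto S (\<lambda>x. frechet_derivative f (at x) v) n" for v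
      by (rule Suc.IH) (use Suc.prems in fastforce)
  qed
qed

text \<open>By uniqueness of derivatives on an open set, the choice-based
  \<open>frechet_derivative\<close> of the definition may be replaced by any family of derivatives.
  The closure properties below rest on this form.\<close>

lemma differentiable_upto_Suc_iff:
  assumes "open S"
  shows "differentiable_upto S f (Suc n) \<longleftrightarrow>
    (\<exists>f'. (\<forall>x\<in>S. (f has_derivative f' x) (at x)) \<and> (\<forall>v. differentiable_upto S (\<lambda>x. f' x v) n))"
proof
  assume "differentiable_upto S f (Suc n)"
  then show "\<exists>f'. (\<forall>x\<in>S. (f has_derivative f' x) (at x)) \<and> (\<forall>v. differentiable_upto S (\<lambda>x. f' x v) n)"
    by (auto intro!: exI[of _ "\<lambda>x. frechet_derivative f (at x)"] simp: frechet_derivative_works[symmetric])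
next
  assume "\<exists>f'. (\<forall>x\<in>S. (f has_derivative f' x) (at x)) \<and> (\<forall>v. differentiable_upto S (\<lambda>x. f' x v) n)"
  then obtain f' where f': "\<And>x. x \<in> S \<Longrightarrow> (f has_derivative f' x) (at x)"
    and s: "\<And>v. differentiable_upto S (\<lambda>x. f' x v) n" by blast
  have "frechet_derivative f (at x) = f' x" if "x \<in> S" for x
    using frechet_derivative_at[OF f'[OF that]] by simp
  then have "differentiable_upto S (\<lambda>x. frechet_derivative f (at x) v) n" for v
    using s[of v] by (subst differentiable_upto_cong[OF assms, where g = "\<lambda>x. f' x v"]) auto
  then show "differentiable_upto S f (Suc n)"
    using f' by (auto simp: differentiable_def)
qed

lemma differentiable_upto_SucI:
  assumes "open S" "\<And>x. x \<in> S \<Longrightarrow> (f has_derivative f' x) (at x)"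
    "\<And>v. differentiable_upto S (\<lambda>x. f' x v) n"
  shows "differentiable_upto S f (Suc n)"
  using differentiable_upto_Suc_iff[OF assms(1)] assms(2,3) by blast

lemma differentiable_upto_has_derivative:
  assumes "differentiable_upto S f (Suc n)" "x \<in> S"
  shows "(f has_derivative frechet_derivative f (at x)) (at x)"
  using assms by (simp add: frechet_derivative_works[symmetric])

lemma differentiable_upto_const: "differentiable_upto S (\<lambda>x. c) n"
  by (induction n arbitrary: c) (auto simp: continuous_on_const)

lemma differentiable_upto_bounded_linear:
  assumes "bounded_linear L" "open S" shows "differentiable_upto S L n"
proof (cases n)
  case 0
  then show ?thesis using assms by (simp add: linear_continuous_on)
next
  case (Suc m)
  then show ?thesis
    using assms by (auto intro!: differentiable_upto_SucI bounded_linear_imp_has_derivative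
        differentiable_upto_const simp del: differentiable_upto.simps)
qed

lemma differentiable_upto_linear_compose:
  assumes "bounded_linear L" "open S" "differentiable_upto S f n"
  shows "differentiable_upto S (\<lambda>x. L (f x)) n"
  using assms(3)
proof (induction n arbitrary: f)
  case 0
  then show ?case using bounded_linear.continuous_on[OF assms(1)] by auto
next
  case (Suc n)
  then have d: "differentiable_upto S (\<lambda>x. L (frechet_derivative f (at x) v)) n" for v by simp
  show ?case
    using Suc.prems by (intro differentiable_upto_SucI[OF assms(2), where f' = "\<lambda>x v. L (frechet_derivative f (at x) v)"] d bounded_linear.has_derivative[OF assms(1)]
       differentiable_upto_has_derivative)
qed

lemma differentiable_upto_add:
  assumes "open S" "differentiable_upto S f n" "differentiable_upto S g n"
  shows "differentiable_upto S (\<lambda>x. f x + g x) n"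
  using assms(2,3)
proof (induction n arbitrary: f g)
  case 0
  then show ?case by (auto intro: continuous_on_add)
next
  case (Suc n)
  then have d: "differentiable_upto S (\<lambda>x. frechet_derivative f (at x) v + frechet_derivative g (at x) v) n" for v 
    by simp
  show ?case
    using Suc.prems by (intro differentiable_upto_SucI[OF assms(1), where f' = "\<lambda>x v. frechet_derivative f (at x) v + frechet_derivative g (at x) v"] d has_derivative_add
       differentiable_upto_has_derivative)
qed

lemma differentiable_upto_sum:
  assumes "open S" "\<And>i. i \<in> I \<Longrightarrow> differentiable_upto S (f i) n"
  shows "differentiable_upto S (\<lambda>x. \<Sum>i\<in>I. f i x) n"
  using assms(2)
  by (induction I rule: infinite_finite_induct)
    (auto intro: differentiable_upto_add[OF assms(1)] differentiable_upto_const)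

lemma differentiable_upto_bilinear:
  assumes "bounded_bilinear B" "open S" "differentiable_upto S f n" "differentiable_upto S g n"
  shows "differentiable_upto S (\<lambda>x. B (f x) (g x)) n"
  using assms(3,4)
proof (induction n arbitrary: f g)
  case 0
  then show ?case using bounded_bilinear.continuous_on[OF assms(1)] by auto
next
  case (Suc n)
  have d: "differentiable_upto S (\<lambda>x. B (f x) (frechet_derivative g (at x) v) + B (frechet_derivative f (at x) v) (g x)) n" for v
    using Suc.prems differentiable_upto_Suc_imp[OF Suc.prems(1)] differentiable_upto_Suc_imp[OF Suc.prems(2)]
    by (intro differentiable_upto_add[OF assms(2)] Suc.IH) auto
  show ?case
    using Suc.prems by (intro differentiable_upto_SucI[OF assms(2), where f' = "\<lambda>x v. B (f x) (frechet_derivative g (at x) v) + B (frechet_derivative f (at x) v) (g x)"] d bounded_bilinear.FDERIV[OF assms(1)]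
       differentiable_upto_has_derivative)
qed

lemmas differentiable_upto_mult = differentiable_upto_bilinear[OF bounded_bilinear_mult]
lemmas differentiable_upto_scaleR = differentiable_upto_bilinear[OF bounded_bilinear_scaleR]

lemma differentiable_upto_prod:
  fixes f :: "'i \<Rightarrow> 'e::real_normed_vector \<Rightarrow> real"
  assumes "open S" "\<And>i. i \<in> I \<Longrightarrow> differentiable_upto S (f i) n"
  shows "differentiable_upto S (\<lambda>x. \<Prod>i\<in>I. f i x) n"
  using assms(2)
  by (induction I rule: infinite_finite_induct)
    (auto intro: differentiable_upto_mult[OF assms(1)] differentiable_upto_const)

lemma differentiable_upto_minus:
  assumes "open S" "differentiable_upto S f n"
  shows "differentiable_upto S (\<lambda>x. - f x) n"
  using differentiable_upto_linear_compose[OF _ assms, of uminus] bounded_linear_minus[OF bounded_linear_ident] by auto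

lemma differentiable_upto_diff:
  assumes "open S" "differentiable_upto S f n" "differentiable_upto S g n"
  shows "differentiable_upto S (\<lambda>x. f x - g x) n"
  using differentiable_upto_add[OF assms(1,2) differentiable_upto_minus[OF assms(1,3)]] by simp

text \<open>The derivative of \<open>g\<close> is taken in the direction Df v, which moves with x,
  whereas the induction hypothesis concerns fixed directions. Expanding Df v in \<open>Basis\<close>
  gives sums of products to which it applies; this is why the middle space is Euclidean.\<close>

lemma differentiable_upto_compose:
  fixes g :: "'m::euclidean_space \<Rightarrow> 'k::real_normed_vector"
  assumes "open S" "open T" "f ` S \<subseteq> T" "differentiable_upto S f n" "differentiable_upto T g n"
  shows "differentiable_upto S (\<lambda>x. g (f x)) n"
  using assms(4,5)
proof (induction n arbitrary: g)
  case 0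
  then show ?case using assms(3) by (auto intro: continuous_on_compose2)
next
  case (Suc n)
  let ?D = "\<lambda>v x. \<Sum>b\<in>Basis. (frechet_derivative f (at x) v \<bullet> b) *\<^sub>R frechet_derivative g (at (f x)) b"
  have df: "(f has_derivative frechet_derivative f (at x)) (at x)" if "x \<in> S" for x
    using that Suc.prems differentiable_upto_has_derivative by blast
  have dg: "(g has_derivative frechet_derivative g (at (f x))) (at (f x))" if "x \<in> S" for x
    using that Suc.prems assms(3) differentiable_upto_has_derivative by blast
  have eq: "frechet_derivative g (at (f x)) (frechet_derivative f (at x) v) = ?D v x" if "x \<in> S" for x v
  proof -
    have "linear (frechet_derivative g (at (f x)))"
      using dg[OF that] by (simp add: has_derivative_linear)
    then show ?thesis
      by (subst (1) euclidean_representation[symmetric]) (simp add: linear_sum linear_scale)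
  qed
  have "differentiable_upto S (?D v) n" for v
    using Suc.prems differentiable_upto_Suc_imp[OF Suc.prems(1)]
    by (intro differentiable_upto_sum[OF assms(1)] differentiable_upto_scaleR[OF assms(1)] Suc.IH
        differentiable_upto_linear_compose[OF bounded_linear_inner_left assms(1)])
       auto
  then have "differentiable_upto S (\<lambda>x. frechet_derivative g (at (f x)) (frechet_derivative f (at x) v)) n" for v
    by (subst differentiable_upto_cong[OF assms(1) eq])
  moreover have "((\<lambda>x. g (f x)) has_derivative (\<lambda>v. frechet_derivative g (at (f x)) (frechet_derivative f (at x) v))) (at x)" if "x \<in> S" for x
    using diff_chain_at[OF df[OF that] dg[OF that]] by (simp add: o_def)
  ultimately show ?case
    by (intro differentiable_upto_SucI[OF assms(1)])
qed

text \<open>For an affine inner map the direction \<open>L v\<close> does not move, so no basis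
  enters and all spaces may be arbitrary normed spaces. This is the version that applies to the
  model space of the base.\<close>

lemma differentiable_upto_affine:
  assumes "open S" "open T" "bounded_linear L" "(\<lambda>x. a + L x) ` S \<subseteq> T" "differentiable_upto T g n"
  shows "differentiable_upto S (\<lambda>x. g (a + L x)) n"
  using assms(5)
proof (induction n arbitrary: g)
  case 0
  have "continuous_on S (\<lambda>x. a + L x)"
    using assms(3) by (intro continuous_intros linear_continuous_on)
  then show ?case using 0 assms(4) by (auto intro: continuous_on_compose2)
next
  case (Suc n)
  have dg: "(g has_derivative frechet_derivative g (at (a + L x))) (at (a + L x))" if "x \<in> S" for x
    using that Suc.prems assms(4) differentiable_upto_has_derivative by blast
  have da: "((\<lambda>x. a + L x) has_derivative L) (at x)" for x
    using assms(3) by (auto intro!: derivative_eq_intros bounded_linear_imp_has_derivative)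
  have "((\<lambda>x. g (a + L x)) has_derivative (\<lambda>v. frechet_derivative g (at (a + L x)) (L v))) (at x)" if "x \<in> S" for x
    using diff_chain_at[OF da dg[OF that]] by (simp add: o_def)
  moreover have "differentiable_upto S (\<lambda>x. frechet_derivative g (at (a + L x)) (L v)) n" for v
    using Suc.prems by (intro Suc.IH) auto
  ultimately show ?case
    by (intro differentiable_upto_SucI[OF assms(1)])
qed

lemma differentiable_upto_inverse: "differentiable_upto {x. x \<noteq> 0} (inverse :: real \<Rightarrow> real) n"
proof (induction n)
  case 0
  then show ?case by (auto intro!: continuous_intros)
next
  case (Suc n)
  have o: "open {x::real. x \<noteq> 0}" by (simp add: open_Collect_neq)
  have "differentiable_upto {x. x \<noteq> 0} (\<lambda>x. - (inverse x * v * inverse x)) n" for v :: real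
    using Suc by (intro differentiable_upto_minus[OF o] differentiable_upto_mult[OF o] differentiable_upto_const)
  then show ?case
    by (rule differentiable_upto_SucI[OF o, rotated]) (auto intro!: has_derivative_inverse')
qed

lemma differentiable_upto_exp: "differentiable_upto UNIV (exp :: real \<Rightarrow> real) n"
proof (induction n)
  case 0
  then show ?case by (auto intro!: continuous_intros)
next
  case (Suc n)
  then have "differentiable_upto UNIV (\<lambda>x. v * exp x) n" for v :: real
    by (intro differentiable_upto_mult differentiable_upto_const) auto
  then show ?case
    by (rule differentiable_upto_SucI[OF open_UNIV, rotated]) (auto intro!: derivative_eq_intros)
qed

section \<open>Symmetry of mixed second derivatives\<close>

lemma second_difference_mean_value:
  fixes f :: "'e::real_normed_vector \<Rightarrow> real"
  assumes S: "differentiable_upto S f (Suc (Suc n))" and h: "h > 0"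
    and inS: "\<And>s t. 0 \<le> s \<Longrightarrow> s \<le> h \<Longrightarrow> 0 \<le> t \<Longrightarrow> t \<le> h \<Longrightarrow> x + s *\<^sub>R u + t *\<^sub>R v \<in> S"
  obtains s t where "0 < s" "s < h" "0 < t" "t < h"
    "f (x + h *\<^sub>R u + h *\<^sub>R v) - f (x + h *\<^sub>R u) - f (x + h *\<^sub>R v) + f x =
      h * (h * frechet_derivative (\<lambda>y. frechet_derivative f (at y) u) (at (x + s *\<^sub>R u + t *\<^sub>R v)) v)"
proof -
  let ?D = "\<lambda>y. frechet_derivative f (at y) u"
  let ?DD = "\<lambda>y. frechet_derivative ?D (at y) v"
  have df: "(f has_derivative frechet_derivative f (at y)) (at y)" if "y \<in> S" for y
    using S that by (rule differentiable_upto_has_derivative)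
  have dD: "(?D has_derivative frechet_derivative ?D (at y)) (at y)" if "y \<in> S" for y
    using S that by (intro differentiable_upto_has_derivative[where n = n and S = S]) auto
  have d1: "((\<lambda>s. f (x + s *\<^sub>R u + t *\<^sub>R v)) has_real_derivative ?D (x + s *\<^sub>R u + t *\<^sub>R v)) (at s)"
    if "0 \<le> s" "s \<le> h" "0 \<le> t" "t \<le> h" for s t
  proof -
    have a: "((\<lambda>s. x + s *\<^sub>R u + t *\<^sub>R v) has_derivative (\<lambda>r. r *\<^sub>R u)) (at s)"
      by (auto intro!: derivative_eq_intros)
    have l: "linear (frechet_derivative f (at (x + s *\<^sub>R u + t *\<^sub>R v)))"
      using df[OF inS[OF that]] by (rule has_derivative_linear)
    show ?thesis
      using diff_chain_at[OF a df[OF inS[OF that]]]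
      by (simp add: o_def has_field_derivative_def linear_scale[OF l] mult_commute_abs)
  qed
  have d2: "((\<lambda>t. ?D (x + s *\<^sub>R u + t *\<^sub>R v)) has_real_derivative ?DD (x + s *\<^sub>R u + t *\<^sub>R v)) (at t)"
    if "0 \<le> s" "s \<le> h" "0 \<le> t" "t \<le> h" for s t
  proof -
    have a: "((\<lambda>t. x + s *\<^sub>R u + t *\<^sub>R v) has_derivative (\<lambda>r. r *\<^sub>R v)) (at t)"
      by (auto intro!: derivative_eq_intros)
    have l: "linear (frechet_derivative ?D (at (x + s *\<^sub>R u + t *\<^sub>R v)))"
      using dD[OF inS[OF that]] by (rule has_derivative_linear)
    show ?thesis
      using diff_chain_at[OF a dD[OF inS[OF that]]]
      by (simp add: o_def has_field_derivative_def linear_scale[OF l] mult_commute_abs)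
  qed
  \<comment> \<open>The mean value theorem is applied to the increment in v as a function of s, and
    below to \<open>?D\<close> as a function of t. The terms scaled by 0 make both endpoints
    instances of the same function.\<close>
  have "\<exists>s>0. s < h \<and> (f (x + h *\<^sub>R u + h *\<^sub>R v) - f (x + h *\<^sub>R u + 0 *\<^sub>R v)) - (f (x + 0 *\<^sub>R u + h *\<^sub>R v) - f (x + 0 *\<^sub>R u + 0 *\<^sub>R v))
      = (h - 0) * (?D (x + s *\<^sub>R u + h *\<^sub>R v) - ?D (x + s *\<^sub>R u + 0 *\<^sub>R v))"
    using h by (intro MVT2 DERIV_diff d1) auto
  then obtain s where s: "0 < s" "s < h" "(f (x + h *\<^sub>R u + h *\<^sub>R v) - f (x + h *\<^sub>R u + 0 *\<^sub>R v)) - (f (x + 0 *\<^sub>R u + h *\<^sub>R v) - f (x + 0 *\<^sub>R u + 0 *\<^sub>R v))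
      = (h - 0) * (?D (x + s *\<^sub>R u + h *\<^sub>R v) - ?D (x + s *\<^sub>R u + 0 *\<^sub>R v))" by blast
  have "\<exists>t>0. t < h \<and> ?D (x + s *\<^sub>R u + h *\<^sub>R v) - ?D (x + s *\<^sub>R u + 0 *\<^sub>R v) = (h - 0) * ?DD (x + s *\<^sub>R u + t *\<^sub>R v)"
    using h s by (intro MVT2 d2) auto
  then obtain t where t: "0 < t" "t < h" "?D (x + s *\<^sub>R u + h *\<^sub>R v) - ?D (x + s *\<^sub>R u + 0 *\<^sub>R v) = (h - 0) * ?DD (x + s *\<^sub>R u + t *\<^sub>R v)" by blast
  show ?thesis
    using that[OF s(1,2) t(1,2)] s(3) t(3) by simp
qed

text \<open>The second difference over a small parallelogram is symmetric in u and v, and it equals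
  the square of h times either mixed derivative at some nearby point. Continuity of both mixed
  derivatives then excludes a gap between them at x.\<close>

lemma second_derivative_symmetric_real:
  fixes f :: "'e::real_normed_vector \<Rightarrow> real"
  assumes o: "open S" and S: "differentiable_upto S f (Suc (Suc n))" and x: "x \<in> S"
  shows "frechet_derivative (\<lambda>y. frechet_derivative f (at y) u) (at x) v =
         frechet_derivative (\<lambda>y. frechet_derivative f (at y) v) (at x) u"
proof (rule ccontr)
  let ?A = "\<lambda>x. frechet_derivative (\<lambda>y. frechet_derivative f (at y) u) (at x) v"
  let ?B = "\<lambda>x. frechet_derivative (\<lambda>y. frechet_derivative f (at y) v) (at x) u"
  assume "?A x \<noteq> ?B x"
  then have e: "\<bar>?A x - ?B x\<bar> / 2 > 0" by simp
  have c: "continuous_on S ?A" "continuous_on S ?B"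
    using S by (auto intro: differentiable_upto_imp_continuous_on[of _ _ n])
  obtain d1 where d1: "d1 > 0" "\<And>y. y \<in> S \<Longrightarrow> dist y x < d1 \<Longrightarrow> dist (?A y) (?A x) < \<bar>?A x - ?B x\<bar> / 2"
    using c(1) x e unfolding continuous_on_iff by metis
  obtain d2 where d2: "d2 > 0" "\<And>y. y \<in> S \<Longrightarrow> dist y x < d2 \<Longrightarrow> dist (?B y) (?B x) < \<bar>?A x - ?B x\<bar> / 2"
    using c(2) x e unfolding continuous_on_iff by metis
  obtain d3 where d3: "d3 > 0" "\<And>y. dist y x < d3 \<Longrightarrow> y \<in> S"
    using o x unfolding open_dist by blast
  define d where "d = min d1 (min d2 d3)"
  \<comment> \<open>Small enough for the whole parallelogram to stay within distance d of x; the
    summand 1 covers u = v = 0.\<close>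
  define h where "h = d / (2 * (norm u + norm v + 1))"
  have n: "norm u + norm v + 1 > 0" by (simp add: add_nonneg_pos)
  have d: "d > 0" using d1 d2 d3 by (simp add: d_def)
  then have h: "h > 0" using n by (simp add: h_def)
  have hn: "h * (norm u + norm v) < d"
  proof -
    have "h * (norm u + norm v) \<le> h * (norm u + norm v + 1)" using h by (intro mult_left_mono) auto
    also have "\<dots> = d / 2" using n unfolding h_def by (simp add: field_simps)
    also have "\<dots> < d" using d by simp
    finally show ?thesis .
  qed
  have near: "dist (x + s *\<^sub>R u + t *\<^sub>R v) x < d" if "0 \<le> s" "s \<le> h" "0 \<le> t" "t \<le> h" for s t
  proof -
    have "dist (x + s *\<^sub>R u + t *\<^sub>R v) x = norm (s *\<^sub>R u + t *\<^sub>R v)" by (simp add: dist_norm algebra_simps)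
    also have "\<dots> \<le> s * norm u + t * norm v" using that by (intro order_trans[OF norm_triangle_ineq]) simp
    also have "\<dots> \<le> h * norm u + h * norm v" using that by (intro add_mono mult_right_mono) auto
    finally show ?thesis using hn by (simp add: algebra_simps)
  qed
  have inS: "x + s *\<^sub>R u + t *\<^sub>R v \<in> S" if "0 \<le> s" "s \<le> h" "0 \<le> t" "t \<le> h" for s t
    using near[OF that] d3(2) by (simp add: d_def)
  have inS': "x + s *\<^sub>R v + t *\<^sub>R u \<in> S" if "0 \<le> s" "s \<le> h" "0 \<le> t" "t \<le> h" for s t
    using inS[of t s] that by (simp add: add_ac)
  obtain s t where st: "0 < s" "s < h" "0 < t" "t < h"
    "f (x + h *\<^sub>R u + h *\<^sub>R v) - f (x + h *\<^sub>R u) - f (x + h *\<^sub>R v) + f x = h * (h * ?A (x + s *\<^sub>R u + t *\<^sub>R v))"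
    using second_difference_mean_value[OF S h inS] by blast
  obtain s' t' where st': "0 < s'" "s' < h" "0 < t'" "t' < h"
    "f (x + h *\<^sub>R v + h *\<^sub>R u) - f (x + h *\<^sub>R v) - f (x + h *\<^sub>R u) + f x = h * (h * ?B (x + s' *\<^sub>R v + t' *\<^sub>R u))"
    using second_difference_mean_value[OF S h inS'] by blast
  have "h * (h * ?A (x + s *\<^sub>R u + t *\<^sub>R v)) = h * (h * ?B (x + s' *\<^sub>R v + t' *\<^sub>R u))"
    using st(5)[symmetric] st'(5)[symmetric] by (simp add: add.assoc add.commute[of "h *\<^sub>R u"])
  then have "?A (x + s *\<^sub>R u + t *\<^sub>R v) = ?B (x + s' *\<^sub>R v + t' *\<^sub>R u)" using h by simp
  moreover have "dist (?A (x + s *\<^sub>R u + t *\<^sub>R v)) (?A x) < \<bar>?A x - ?B x\<bar> / 2"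
    using st near[of s t] inS[of s t] by (intro d1) (auto simp: d_def)
  moreover have "dist (?B (x + s' *\<^sub>R v + t' *\<^sub>R u)) (?B x) < \<bar>?A x - ?B x\<bar> / 2"
    using st' near[of t' s'] inS'[of s' t'] by (intro d2) (auto simp: d_def add_ac)
  ultimately show False by (smt (verit) dist_real_def field_sum_of_halves)
qed

lemma second_derivative_symmetric:
  fixes f :: "'e::real_normed_vector \<Rightarrow> 'k::euclidean_space"
  assumes o: "open S" and S: "differentiable_upto S f (Suc (Suc n))" and x: "x \<in> S"
  shows "frechet_derivative (\<lambda>y. frechet_derivative f (at y) u) (at x) v =
         frechet_derivative (\<lambda>y. frechet_derivative f (at y) v) (at x) u"
proof (rule euclidean_eqI)
  fix b :: 'k
  assume "b \<in> Basis"
  have S1: "differentiable_upto S (\<lambda>x. frechet_derivative f (at x) w) (Suc n)" for w using S by simp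
  have d1: "frechet_derivative (\<lambda>x. f x \<bullet> b) (at y) w = frechet_derivative f (at y) w \<bullet> b" if "y \<in> S" for y w
    using frechet_derivative_at[OF has_derivative_inner_left[OF differentiable_upto_has_derivative[OF S that]]]
    by metis
  have d2: "frechet_derivative (\<lambda>y. frechet_derivative (\<lambda>x. f x \<bullet> b) (at y) w) (at x) z =
      frechet_derivative (\<lambda>y. frechet_derivative f (at y) w) (at x) z \<bullet> b" for w z
  proof -
    have "frechet_derivative (\<lambda>y. frechet_derivative (\<lambda>x. f x \<bullet> b) (at y) w) (at x) =
       frechet_derivative (\<lambda>y. frechet_derivative f (at y) w \<bullet> b) (at x)"
      by (intro frechet_derivative_cong_open[OF o x] d1)
    then show ?thesis
      using frechet_derivative_at[OF has_derivative_inner_left[OF differentiable_upto_has_derivative[OF S1 x]], of w b]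
      by metis
  qed
  have "differentiable_upto S (\<lambda>x. f x \<bullet> b) (Suc (Suc n))"
    by (intro differentiable_upto_linear_compose[OF bounded_linear_inner_left o] S)
  from second_derivative_symmetric_real[OF o this x, of u v]
  show "frechet_derivative (\<lambda>y. frechet_derivative f (at y) u) (at x) v \<bullet> b =
        frechet_derivative (\<lambda>y. frechet_derivative f (at y) v) (at x) u \<bullet> b"
    unfolding d2 .
qed


section \<open>Charts, plots and pullbacks of forms\<close>

lemma smooth_on_imp: "smooth_on S f \<Longrightarrow> differentiable_upto S f n"
  by (simp add: smooth_on_def)

lemma smooth_on_has_derivative:
  "smooth_on S f \<Longrightarrow> x \<in> S \<Longrightarrow> (f has_derivative frechet_derivative f (at x)) (at x)"
  unfolding smooth_on_def by (blast intro: differentiable_upto_has_derivative)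

context
  fixes X :: "'a topology" and c :: "('a, 'e::real_normed_vector) chart"
  assumes c: "is_chart X c"
begin

lemma is_chart_openin: "openin X (fst c)"
  using c by (simp add: is_chart_def)

lemma is_chart_subset: "fst c \<subseteq> topspace X"
  using is_chart_openin by (rule openin_subset)

lemma is_chart_open_img: "open (chart_img c)"
  using c by (simp add: is_chart_def)

lemma is_chart_homeo: "homeomorphic_map (subtopology X (fst c)) (top_of_set (chart_img c)) (snd c)"
  using c by (simp add: is_chart_def)

lemma is_chart_inj: "inj_on (snd c) (fst c)"
  using homeomorphic_imp_injective_map[OF is_chart_homeo] is_chart_subset
  by (simp add: Int_absorb1)

lemma is_chart_inv_left: "p \<in> fst c \<Longrightarrow> chart_inv c (snd c p) = p"
  by (simp add: chart_inv_def is_chart_inj)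

lemma is_chart_inv_right: "x \<in> chart_img c \<Longrightarrow> snd c (chart_inv c x) = x"
  by (simp add: chart_inv_def chart_img_def f_inv_into_f)

lemma is_chart_inv_in: "x \<in> chart_img c \<Longrightarrow> chart_inv c x \<in> fst c"
  by (simp add: chart_inv_def chart_img_def inv_into_into)

lemma is_chart_open_image:
  assumes "openin X V" shows "open (snd c ` (fst c \<inter> V))"
proof -
  have "openin (subtopology X (fst c)) (fst c \<inter> V)"
    using assms by (metis Int_commute openin_subtopology_Int)
  then have "openin (top_of_set (chart_img c)) (snd c ` (fst c \<inter> V))"
    using homeomorphic_imp_open_map[OF is_chart_homeo] unfolding open_map_def by blast
  then show ?thesis
    using is_chart_open_img openin_open_eq by blast
qed

lemma is_chart_continuous: "continuous_map (subtopology X (fst c)) euclidean (snd c)"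
  using homeomorphic_imp_continuous_map[OF is_chart_homeo] by (metis continuous_map_into_fulltopology)

lemma is_chart_inv_continuous: "continuous_map (top_of_set (chart_img c)) X (chart_inv c)"
proof -
  obtain g where g: "homeomorphic_maps (subtopology X (fst c)) (top_of_set (chart_img c)) (snd c) g"
    using is_chart_homeo unfolding homeomorphic_map_maps by blast
  then have cg: "continuous_map (top_of_set (chart_img c)) X g"
    unfolding homeomorphic_maps_def by (metis continuous_map_into_fulltopology)
  have "g x = chart_inv c x" if "x \<in> chart_img c" for x
    using g that is_chart_inv_left is_chart_inv_in is_chart_inv_right is_chart_subset
    unfolding homeomorphic_maps_def by (metis IntI subsetD topspace_subtopology)
  then show ?thesis
    using cg by (auto intro: continuous_map_eq)
qed

lemma is_chart_vimage_open:
  assumes "openin X V" shows "open {x \<in> chart_img c. chart_inv c x \<in> V}"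
  using openin_continuous_map_preimage[OF is_chart_inv_continuous assms] is_chart_open_img
  by (simp add: openin_open_eq)

lemma is_chart_image_eq: "snd c ` (fst c \<inter> V) = {x \<in> chart_img c. chart_inv c x \<in> V}"
  using is_chart_inv_left is_chart_inv_in is_chart_inv_right unfolding chart_img_def by force

end

lemma smooth_manifold_chart: "smooth_manifold M \<Longrightarrow> c \<in> atlas M \<Longrightarrow> is_chart (mtop M) c"
  by (simp add: smooth_manifold_def)

lemma smooth_manifold_cover:
  assumes "smooth_manifold M" "p \<in> points M" obtains c where "c \<in> atlas M" "p \<in> fst c"
  using assms unfolding smooth_manifold_def by blast

lemma smooth_manifold_transition:
  "smooth_manifold M \<Longrightarrow> c \<in> atlas M \<Longrightarrow> d \<in> atlas M \<Longrightarrow> smooth_on (overlap c d) (transition c d)"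
  by (simp add: smooth_manifold_def)

lemma overlap_mem: "p \<in> fst c \<Longrightarrow> p \<in> fst d \<Longrightarrow> snd c p \<in> overlap c d"
  by (simp add: overlap_def)

lemma overlap_subset: "overlap c d \<subseteq> chart_img c"
  by (auto simp: overlap_def chart_img_def)

lemma transition_apply:
  "is_chart X c \<Longrightarrow> p \<in> fst c \<Longrightarrow> transition c d (snd c p) = snd d p"
  by (simp add: transition_def is_chart_inv_left)

text \<open>A smooth map into M from an open set of a normed space whose dimension is unrelated to
  that of M. Parametrizations of fibres, families of these over a line in the base, and curves are
  all treated as plots, and forms are evaluated by pulling them back along plots.\<close>

definition plot :: "('a, 'e::real_normed_vector) mfd \<Rightarrow> 's::real_normed_vector set \<Rightarrow> ('s \<Rightarrow> 'a) \<Rightarrow> bool" where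
  "plot M S q \<longleftrightarrow> open S \<and> continuous_map (top_of_set S) (mtop M) q \<and>
     (\<forall>m\<in>atlas M. smooth_on (S \<inter> q -` fst m) (snd m \<circ> q))"

lemma plot_open: "plot M S q \<Longrightarrow> open S"
  by (simp add: plot_def)

lemma plot_open_preimage:
  assumes "plot M S q" "openin (mtop M) U" shows "open (S \<inter> q -` U)"
proof -
  have "openin (top_of_set S) {x \<in> S. q x \<in> U}"
    using assms openin_continuous_map_preimage unfolding plot_def by fastforce
  then show ?thesis
    using plot_open[OF assms(1)] by (simp add: openin_open_eq vimage_def Int_def)
qed

lemma plot_mem: "plot M S q \<Longrightarrow> x \<in> S \<Longrightarrow> q x \<in> points M"
  unfolding plot_def continuous_map_def by auto

lemma plot_smooth: "plot M S q \<Longrightarrow> m \<in> atlas M \<Longrightarrow> smooth_on (S \<inter> q -` fst m) (snd m \<circ> q)"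
  by (simp add: plot_def)

lemma plot_has_derivative:
  "plot M S q \<Longrightarrow> m \<in> atlas M \<Longrightarrow> x \<in> S \<Longrightarrow> q x \<in> fst m \<Longrightarrow>
    ((snd m \<circ> q) has_derivative frechet_derivative (snd m \<circ> q) (at x)) (at x)"
  by (rule smooth_on_has_derivative[OF plot_smooth]) auto

lemma plot_linear:
  "plot M S q \<Longrightarrow> m \<in> atlas M \<Longrightarrow> x \<in> S \<Longrightarrow> q x \<in> fst m \<Longrightarrow>
    linear (frechet_derivative (snd m \<circ> q) (at x))"
  by (rule has_derivative_linear[OF plot_has_derivative])

text \<open>Affine reparametrization suffices to restrict a plot to an open subset, to a slice, or
  to the part over a line of the base.\<close>

lemma plot_affine:
  assumes M: "smooth_manifold M" and q: "plot M T q" and S: "open S" and L: "bounded_linear L"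
    and ST: "(\<lambda>x. a + L x) ` S \<subseteq> T"
  shows "plot M S (\<lambda>x. q (a + L x))"
  unfolding plot_def
proof (intro conjI ballI S)
  have c: "continuous_on S (\<lambda>x. a + L x)"
    using L by (intro continuous_intros linear_continuous_on)
  then have "continuous_map (top_of_set S) (top_of_set T) (\<lambda>x. a + L x)"
    using ST by auto
  then show "continuous_map (top_of_set S) (mtop M) (\<lambda>x. q (a + L x))"
    using q continuous_map_compose[of _ _ "\<lambda>x. a + L x" _ q] unfolding plot_def o_def by blast
next
  fix m assume m: "m \<in> atlas M"
  have c: "continuous_on S (\<lambda>x. a + L x)"
    using L by (intro continuous_intros linear_continuous_on)
  have oT: "open (T \<inter> q -` fst m)"
    by (intro plot_open_preimage[OF q] is_chart_openin smooth_manifold_chart[OF M m])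
  have eq: "S \<inter> (\<lambda>x. q (a + L x)) -` fst m = S \<inter> (\<lambda>x. a + L x) -` (T \<inter> q -` fst m)"
    using ST by auto
  have oS: "open (S \<inter> (\<lambda>x. a + L x) -` (T \<inter> q -` fst m))"
    using c S oT by (rule continuous_open_preimage)
  show "smooth_on (S \<inter> (\<lambda>x. q (a + L x)) -` fst m) (snd m \<circ> (\<lambda>x. q (a + L x)))"
    unfolding smooth_on_def eq o_def
    using differentiable_upto_affine[OF oS oT L _ smooth_on_imp[OF plot_smooth[OF q m]]]
    by (auto simp: o_def)
qed

lemma plot_derivative_transition:
  assumes M: "smooth_manifold M" and q: "plot M S q" and m: "m \<in> atlas M" "m' \<in> atlas M"
    and x: "x \<in> S" "q x \<in> fst m" "q x \<in> fst m'"
  shows "frechet_derivative (snd m' \<circ> q) (at x) v =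
    frechet_derivative (transition m m') (at (snd m (q x))) (frechet_derivative (snd m \<circ> q) (at x) v)"
proof -
  have ch: "is_chart (mtop M) m" "is_chart (mtop M) m'"
    using smooth_manifold_chart[OF M] m by auto
  let ?U = "S \<inter> q -` (fst m \<inter> fst m')"
  have U: "open ?U" by (intro plot_open_preimage[OF q] openin_Int is_chart_openin ch)
  have "(transition m m' has_derivative frechet_derivative (transition m m') (at (snd m (q x)))) (at ((snd m \<circ> q) x))"
    unfolding o_apply
    by (intro smooth_on_has_derivative[OF smooth_manifold_transition[OF M m]] overlap_mem x)
  from diff_chain_at[OF plot_has_derivative[OF q m(1) x(1,2)] this]
  have d: "((transition m m' \<circ> (snd m \<circ> q)) has_derivative
    (frechet_derivative (transition m m') (at (snd m (q x))) \<circ> frechet_derivative (snd m \<circ> q) (at x))) (at x)" .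
  have "frechet_derivative (snd m' \<circ> q) (at x) = frechet_derivative (transition m m' \<circ> (snd m \<circ> q)) (at x)"
    using x by (intro frechet_derivative_cong_open[OF U]) (auto simp: transition_apply[OF ch(1)])
  then show ?thesis
    using frechet_derivative_at[OF d] by (metis o_apply)
qed

text \<open>The chart is picked by choice at each point; the transformation law makes the value
  independent of it, see \<open>pull1_chart\<close> and \<open>pull2_chart\<close>.\<close>

definition pull1 :: "('a, 'e::real_normed_vector) mfd \<Rightarrow> ('a, 'e) form1 \<Rightarrow> ('s::real_normed_vector \<Rightarrow> 'a) \<Rightarrow> 's \<Rightarrow> 's \<Rightarrow> real" where
  "pull1 M \<theta> q x u = (let m = SOME m. m \<in> atlas M \<and> q x \<in> fst m in
     \<theta> m (snd m (q x)) (frechet_derivative (snd m \<circ> q) (at x) u))"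

definition pull2 :: "('a, 'e::real_normed_vector) mfd \<Rightarrow> ('a, 'e) form2 \<Rightarrow> ('s::real_normed_vector \<Rightarrow> 'a) \<Rightarrow> 's \<Rightarrow> 's \<Rightarrow> 's \<Rightarrow> real" where
  "pull2 M \<Omega> q x u v = (let m = SOME m. m \<in> atlas M \<and> q x \<in> fst m in
     \<Omega> m (snd m (q x)) (frechet_derivative (snd m \<circ> q) (at x) u) (frechet_derivative (snd m \<circ> q) (at x) v))"

lemma pullback1_eq_pull1: "pullback1 N f \<alpha> c x v = pull1 N \<alpha> (f \<circ> chart_inv c) x v"
  by (simp add: pullback1_def pull1_def Let_def o_assoc)

lemma pull1_chart:
  assumes M: "smooth_manifold M" and \<theta>: "one_form M \<theta>" and q: "plot M S q"
    and m: "m \<in> atlas M" "x \<in> S" "q x \<in> fst m"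
  shows "pull1 M \<theta> q x u = \<theta> m (snd m (q x)) (frechet_derivative (snd m \<circ> q) (at x) u)"
proof -
  define m' where "m' = (SOME m. m \<in> atlas M \<and> q x \<in> fst m)"
  have m': "m' \<in> atlas M" "q x \<in> fst m'"
    using someI[of "\<lambda>m. m \<in> atlas M \<and> q x \<in> fst m" m] m unfolding m'_def by auto
  have "\<theta> m' (snd m' (q x)) w = \<theta> m (snd m (q x)) (frechet_derivative (transition m' m) (at (snd m' (q x))) w)" for w
    using \<theta> m m' overlap_mem[of "q x" m' m] transition_apply[OF smooth_manifold_chart[OF M m'(1)] m'(2), of m]
    unfolding one_form_def by auto
  then show ?thesis
    unfolding pull1_def m'_def[symmetric] Let_def
    by (simp add: plot_derivative_transition[OF M q m'(1) m(1,2) m'(2) m(3)])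
qed

lemma pull2_chart:
  assumes M: "smooth_manifold M" and \<Omega>: "two_form M \<Omega>" and q: "plot M S q"
    and m: "m \<in> atlas M" "x \<in> S" "q x \<in> fst m"
  shows "pull2 M \<Omega> q x u v =
    \<Omega> m (snd m (q x)) (frechet_derivative (snd m \<circ> q) (at x) u) (frechet_derivative (snd m \<circ> q) (at x) v)"
proof -
  define m' where "m' = (SOME m. m \<in> atlas M \<and> q x \<in> fst m)"
  have m': "m' \<in> atlas M" "q x \<in> fst m'"
    using someI[of "\<lambda>m. m \<in> atlas M \<and> q x \<in> fst m" m] m unfolding m'_def by auto
  have "\<Omega> m' (snd m' (q x)) w z = \<Omega> m (snd m (q x)) (frechet_derivative (transition m' m) (at (snd m' (q x))) w)
      (frechet_derivative (transition m' m) (at (snd m' (q x))) z)" for w z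
    using \<Omega> m m' overlap_mem[of "q x" m' m] transition_apply[OF smooth_manifold_chart[OF M m'(1)] m'(2), of m]
    unfolding two_form_def by auto
  then show ?thesis
    unfolding pull2_def m'_def[symmetric] Let_def
    by (simp add: plot_derivative_transition[OF M q m'(1) m(1,2) m'(2) m(3)])
qed

text \<open>The terms with second derivatives of \<open>\<psi>\<close> are the ones that cancel in the exterior derivative.\<close>

lemma bilinear_pull_has_derivative:
  fixes \<psi> :: "'s::real_normed_vector \<Rightarrow> 'e::euclidean_space"
    and b :: "'e \<Rightarrow> 'e \<Rightarrow> 'e \<Rightarrow> real"
  assumes S: "open S" and T: "open T" and \<psi>: "smooth_on S \<psi>" "\<psi> ` S \<subseteq> T"
    and lin: "\<And>y u. y \<in> T \<Longrightarrow> linear (b y u)" and anti: "\<And>y u v. y \<in> T \<Longrightarrow> b y u v = - b y v u"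
    and b: "\<And>u v. smooth_on T (\<lambda>y. b y u v)"
  defines "D \<equiv> \<lambda>x. frechet_derivative \<psi> (at x)"
    and "DD \<equiv> \<lambda>x u v. frechet_derivative (\<lambda>y. frechet_derivative \<psi> (at y) v) (at x) u"
  shows "x \<in> S \<Longrightarrow> ((\<lambda>x. b (\<psi> x) (D x v) (D x w)) has_derivative
    (\<lambda>u. frechet_derivative (\<lambda>y. b y (D x v) (D x w)) (at (\<psi> x)) (D x u)
      + b (\<psi> x) (DD x u v) (D x w) + b (\<psi> x) (D x v) (DD x u w))) (at x)"
    and "smooth_on S (\<lambda>x. b (\<psi> x) (D x v) (D x w))"
proof -
  \<comment> \<open>Expansion in \<open>Basis\<close> separates the dependence on the point y from
    that on the vectors, so that only products of scalar functions have to be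
    differentiated.\<close>
  let ?E = "\<lambda>y \<xi> \<eta>. \<Sum>i\<in>Basis. \<Sum>j\<in>Basis. (\<xi> \<bullet> i) * (\<eta> \<bullet> j) * b y i j"
  have lin': "linear (\<lambda>u. b y u v)" if "y \<in> T" for y v
    using linear_compose_neg[OF lin[OF that, of v]] by (subst anti[OF that]) 
  have E: "b y \<xi> \<eta> = ?E y \<xi> \<eta>" if "y \<in> T" for y \<xi> \<eta>
  proof -
    have "b y \<xi> \<eta> = (\<Sum>i\<in>Basis. (\<xi> \<bullet> i) * b y i \<eta>)"
      by (subst (1) euclidean_representation[of \<xi>, symmetric])
        (simp add: linear_sum[OF lin'[OF that]] linear_scale[OF lin'[OF that]])
    also have "\<dots> = (\<Sum>i\<in>Basis. (\<xi> \<bullet> i) * (\<Sum>j\<in>Basis. (\<eta> \<bullet> j) * b y i j))"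
      by (subst (1) euclidean_representation[of \<eta>, symmetric])
        (simp add: linear_sum[OF lin[OF that]] linear_scale[OF lin[OF that]])
    finally show ?thesis by (simp add: sum_distrib_left mult.assoc)
  qed
  have D: "differentiable_upto S (\<lambda>x. D x v) n" for v n
    using smooth_on_imp[OF \<psi>(1), of "Suc n"] by (simp add: D_def)
  have E': "differentiable_upto S (\<lambda>x. ?E (\<psi> x) (D x v) (D x w)) n" for n
    by (intro differentiable_upto_sum differentiable_upto_mult S D smooth_on_imp[OF \<psi>(1)]
       differentiable_upto_linear_compose[OF bounded_linear_inner_left]
       differentiable_upto_compose[OF S T \<psi>(2) _ smooth_on_imp[OF b]])
  have "differentiable_upto S (\<lambda>x. b (\<psi> x) (D x v) (D x w)) n" for n
    using \<psi>(2) by (subst differentiable_upto_cong[OF S E]) (auto intro: E')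
  then show "smooth_on S (\<lambda>x. b (\<psi> x) (D x v) (D x w))"
    unfolding smooth_on_def by blast
  assume x: "x \<in> S"
  then have xT: "\<psi> x \<in> T" using \<psi>(2) by auto
  have d1: "((\<lambda>x. D x v) has_derivative (\<lambda>u. DD x u v)) (at x)" for v
    using differentiable_upto_has_derivative[OF D x] by (simp add: D_def DD_def)
  have d2: "((\<lambda>x. b (\<psi> x) i j) has_derivative (\<lambda>u. frechet_derivative (\<lambda>y. b y i j) (at (\<psi> x)) (D x u))) (at x)" for i j
    using diff_chain_at[OF smooth_on_has_derivative[OF \<psi>(1) x] smooth_on_has_derivative[OF b xT]]
    by (simp add: o_def D_def)
  have d3: "frechet_derivative (\<lambda>y. b y \<xi> \<eta>) (at (\<psi> x)) z =
     (\<Sum>i\<in>Basis. \<Sum>j\<in>Basis. (\<xi> \<bullet> i) * (\<eta> \<bullet> j) * frechet_derivative (\<lambda>y. b y i j) (at (\<psi> x)) z)" for \<xi> \<eta> z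
  proof -
    have "((\<lambda>y. ?E y \<xi> \<eta>) has_derivative (\<lambda>z. \<Sum>i\<in>Basis. \<Sum>j\<in>Basis. (\<xi> \<bullet> i) * (\<eta> \<bullet> j) * frechet_derivative (\<lambda>y. b y i j) (at (\<psi> x)) z)) (at (\<psi> x))"
      by (intro has_derivative_sum has_derivative_mult_right smooth_on_has_derivative[OF b xT])
    then have "frechet_derivative (\<lambda>y. ?E y \<xi> \<eta>) (at (\<psi> x)) = (\<lambda>z. \<Sum>i\<in>Basis. \<Sum>j\<in>Basis. (\<xi> \<bullet> i) * (\<eta> \<bullet> j) * frechet_derivative (\<lambda>y. b y i j) (at (\<psi> x)) z)"
      by (rule frechet_derivative_at[symmetric])
    moreover have "frechet_derivative (\<lambda>y. b y \<xi> \<eta>) (at (\<psi> x)) = frechet_derivative (\<lambda>y. ?E y \<xi> \<eta>) (at (\<psi> x))"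
      by (intro frechet_derivative_cong_open[OF T xT] E)
    ultimately show ?thesis by simp
  qed
  have "((\<lambda>x. ?E (\<psi> x) (D x v) (D x w)) has_derivative
    (\<lambda>u. \<Sum>i\<in>Basis. \<Sum>j\<in>Basis. (D x v \<bullet> i) * (D x w \<bullet> j) * frechet_derivative (\<lambda>y. b y i j) (at (\<psi> x)) (D x u)
      + ((D x v \<bullet> i) * (DD x u w \<bullet> j) + (DD x u v \<bullet> i) * (D x w \<bullet> j)) * b (\<psi> x) i j)) (at x)"
    by (intro has_derivative_sum has_derivative_mult d1 d2 has_derivative_inner_left)
  then have "((\<lambda>x. b (\<psi> x) (D x v) (D x w)) has_derivative
    (\<lambda>u. \<Sum>i\<in>Basis. \<Sum>j\<in>Basis. (D x v \<bullet> i) * (D x w \<bullet> j) * frechet_derivative (\<lambda>y. b y i j) (at (\<psi> x)) (D x u)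
      + ((D x v \<bullet> i) * (DD x u w \<bullet> j) + (DD x u v \<bullet> i) * (D x w \<bullet> j)) * b (\<psi> x) i j)) (at x)"
    by (rule has_derivative_transform_within_open[OF _ S x]) (use E \<psi>(2) in auto)
  then show "((\<lambda>x. b (\<psi> x) (D x v) (D x w)) has_derivative
    (\<lambda>u. frechet_derivative (\<lambda>y. b y (D x v) (D x w)) (at (\<psi> x)) (D x u)
      + b (\<psi> x) (DD x u v) (D x w) + b (\<psi> x) (D x v) (DD x u w))) (at x)"
  proof (rule has_derivative_eq_rhs, intro ext)
    fix u
    show "(\<Sum>i\<in>Basis. \<Sum>j\<in>Basis. (D x v \<bullet> i) * (D x w \<bullet> j) * frechet_derivative (\<lambda>y. b y i j) (at (\<psi> x)) (D x u)
      + ((D x v \<bullet> i) * (DD x u w \<bullet> j) + (DD x u v \<bullet> i) * (D x w \<bullet> j)) * b (\<psi> x) i j) =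
      frechet_derivative (\<lambda>y. b y (D x v) (D x w)) (at (\<psi> x)) (D x u)
      + b (\<psi> x) (DD x u v) (D x w) + b (\<psi> x) (D x v) (DD x u w)"
      unfolding d3[of "D x v" "D x w" "D x u"] E[OF xT, of "DD x u v" "D x w"] E[OF xT, of "D x v" "DD x u w"] sum.distrib[symmetric]
      by (intro sum.cong refl) (simp add: algebra_simps)
  qed
qed

text \<open>The six terms with second derivatives of \<open>\<psi>\<close> cancel in pairs, by the
  symmetry of \<open>DD\<close> and the antisymmetry of \<open>b\<close>. What remains says that d
  commutes with pullback.\<close>

lemma ext_d2_bilinear_pull:
  fixes \<psi> :: "'s::real_normed_vector \<Rightarrow> 'e::euclidean_space"
    and b :: "'e \<Rightarrow> 'e \<Rightarrow> 'e \<Rightarrow> real"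
  assumes S: "open S" and T: "open T" and \<psi>: "smooth_on S \<psi>" "\<psi> ` S \<subseteq> T"
    and lin: "\<And>y u. y \<in> T \<Longrightarrow> linear (b y u)" and anti: "\<And>y u v. y \<in> T \<Longrightarrow> b y u v = - b y v u"
    and b: "\<And>u v. smooth_on T (\<lambda>y. b y u v)" and x: "x \<in> S"
  defines "D \<equiv> \<lambda>x. frechet_derivative \<psi> (at x)"
  defines "W \<equiv> \<lambda>v w x. b (\<psi> x) (D x v) (D x w)"
  shows "frechet_derivative (W v w) (at x) u - frechet_derivative (W u w) (at x) v + frechet_derivative (W u v) (at x) w =
    frechet_derivative (\<lambda>y. b y (D x v) (D x w)) (at (\<psi> x)) (D x u)
    - frechet_derivative (\<lambda>y. b y (D x u) (D x w)) (at (\<psi> x)) (D x v)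
    + frechet_derivative (\<lambda>y. b y (D x u) (D x v)) (at (\<psi> x)) (D x w)"
proof -
  define DD where "DD = (\<lambda>u v. frechet_derivative (\<lambda>y. frechet_derivative \<psi> (at y) v) (at x) u)"
  have sym: "DD u v = DD v u" for u v
    unfolding DD_def by (rule second_derivative_symmetric[OF S smooth_on_imp[OF \<psi>(1)] x])
  have xT: "\<psi> x \<in> T" using x \<psi>(2) by auto
  have d: "frechet_derivative (W v w) (at x) u = frechet_derivative (\<lambda>y. b y (D x v) (D x w)) (at (\<psi> x)) (D x u)
      + b (\<psi> x) (DD u v) (D x w) + b (\<psi> x) (D x v) (DD u w)" for u v w
  proof -
    have "(W v w has_derivative (\<lambda>u. frechet_derivative (\<lambda>y. b y (D x v) (D x w)) (at (\<psi> x)) (D x u)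
      + b (\<psi> x) (DD u v) (D x w) + b (\<psi> x) (D x v) (DD u w))) (at x)"
      unfolding W_def D_def DD_def by (rule bilinear_pull_has_derivative(1)[OF S T \<psi> lin anti b x])
    from fun_cong[OF frechet_derivative_at[OF this], of u] show ?thesis by simp
  qed
  show ?thesis
    using anti[OF xT, of "D x v" "DD u w"] unfolding d sym[of v u] sym[of w u] sym[of w v] by simp
qed


section \<open>Conformal changes and finite-dimensional coordinates\<close>

lemma smooth_on_openI:
  assumes "\<And>x. x \<in> S \<Longrightarrow> \<exists>U g. open U \<and> x \<in> U \<and> smooth_on U g \<and> (\<forall>y\<in>U. f y = g y)"
  shows "smooth_on S f"
  unfolding smooth_on_def
proof (intro allI differentiable_upto_local)
  fix n x assume "x \<in> S"
  from assms[OF this] obtain U g where U: "open U" "x \<in> U" "smooth_on U g" "\<forall>y\<in>U. f y = g y"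
    by blast
  have "differentiable_upto U f n"
    using smooth_on_imp[OF U(3)] U(4) by (subst differentiable_upto_cong[OF U(1), where g = g]) auto
  with U show "\<exists>U. open U \<and> x \<in> U \<and> differentiable_upto U f n" by blast
qed

section \<open>Pullbacks of two-forms along plots\<close>

context
  fixes M :: "('a, 'e::euclidean_space) mfd" and \<Omega> :: "('a, 'e) form2"
    and S :: "'s::real_normed_vector set" and q :: "'s \<Rightarrow> 'a"
  assumes M: "smooth_manifold M" and \<Omega>: "two_form M \<Omega>" and q: "plot M S q"
begin

lemma two_form_coordinates:
  assumes "m \<in> atlas M"
  shows "y \<in> chart_img m \<Longrightarrow> linear (\<Omega> m y u)"
    and "y \<in> chart_img m \<Longrightarrow> \<Omega> m y u v = - \<Omega> m y v u"
    and "smooth_on (chart_img m) (\<lambda>y. \<Omega> m y u v)"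
  using \<Omega> assms unfolding two_form_def by blast+

lemma plot_coordinates:
  assumes m: "m \<in> atlas M"
  shows "open (S \<inter> q -` fst m)" "(snd m \<circ> q) ` (S \<inter> q -` fst m) \<subseteq> chart_img m"
    "open (chart_img m)"
  using plot_open_preimage[OF q is_chart_openin[OF smooth_manifold_chart[OF M m]]]
    is_chart_open_img[OF smooth_manifold_chart[OF M m]] by (auto simp: chart_img_def)

lemma plot_chart_cover:
  assumes "x \<in> S" obtains m where "m \<in> atlas M" "q x \<in> fst m"
  using smooth_manifold_cover[OF M plot_mem[OF q assms]] by blast

lemma pull2_linear: "x \<in> S \<Longrightarrow> linear (pull2 M \<Omega> q x u)"
proof -
  assume x: "x \<in> S"
  obtain m where m: "m \<in> atlas M" "q x \<in> fst m" using plot_chart_cover[OF x] .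
  have "snd m (q x) \<in> chart_img m" using m by (simp add: chart_img_def)
  from linear_compose[OF plot_linear[OF q m(1) x m(2)] two_form_coordinates(1)[OF m(1) this]]
  have "linear (\<lambda>v. \<Omega> m (snd m (q x)) (frechet_derivative (snd m \<circ> q) (at x) u) (frechet_derivative (snd m \<circ> q) (at x) v))"
    by (simp add: o_def)
  moreover have "pull2 M \<Omega> q x u = (\<lambda>v. \<Omega> m (snd m (q x)) (frechet_derivative (snd m \<circ> q) (at x) u) (frechet_derivative (snd m \<circ> q) (at x) v))"
    by (intro ext pull2_chart[OF M \<Omega> q m(1) x m(2)])
  ultimately show ?thesis by simp
qed

lemma pull2_antisym: "x \<in> S \<Longrightarrow> pull2 M \<Omega> q x u v = - pull2 M \<Omega> q x v u"
proof -
  assume x: "x \<in> S"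
  obtain m where m: "m \<in> atlas M" "q x \<in> fst m" using plot_chart_cover[OF x] .
  have "snd m (q x) \<in> chart_img m" using m by (simp add: chart_img_def)
  from two_form_coordinates(2)[OF m(1) this] show ?thesis
    unfolding pull2_chart[OF M \<Omega> q m(1) x m(2)] .
qed

lemma pull2_smooth: "smooth_on S (\<lambda>x. pull2 M \<Omega> q x u v)"
proof (rule smooth_on_openI)
  fix x assume x: "x \<in> S"
  obtain m where m: "m \<in> atlas M" "q x \<in> fst m" using plot_chart_cover[OF x] .
  let ?g = "\<lambda>x. \<Omega> m ((snd m \<circ> q) x) (frechet_derivative (snd m \<circ> q) (at x) u) (frechet_derivative (snd m \<circ> q) (at x) v)"
  have "smooth_on (S \<inter> q -` fst m) ?g"
    by (intro bilinear_pull_has_derivative(2)[OF plot_coordinates(1)[OF m(1)] plot_coordinates(3)[OF m(1)]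
        plot_smooth[OF q m(1)] plot_coordinates(2)[OF m(1)] two_form_coordinates[OF m(1)]])
  moreover have "\<forall>y\<in>S \<inter> q -` fst m. pull2 M \<Omega> q y u v = ?g y"
    using pull2_chart[OF M \<Omega> q m(1)] by auto
  ultimately show "\<exists>U g. open U \<and> x \<in> U \<and> smooth_on U g \<and> (\<forall>y\<in>U. pull2 M \<Omega> q y u v = g y)"
    using plot_coordinates(1)[OF m(1)] x m(2) by blast
qed

text \<open>The left side is the exterior derivative of the pulled back form, written out because
  the domain of the plot is a subset of a normed space and carries no atlas.\<close>

lemma pull2_ext_d2:
  assumes x: "x \<in> S" and m: "m \<in> atlas M" "q x \<in> fst m"
  defines "D \<equiv> frechet_derivative (snd m \<circ> q) (at x)"
  shows "frechet_derivative (\<lambda>y. pull2 M \<Omega> q y v w) (at x) u - frechet_derivative (\<lambda>y. pull2 M \<Omega> q y u w) (at x) v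
    + frechet_derivative (\<lambda>y. pull2 M \<Omega> q y u v) (at x) w = ext_d2 \<Omega> m (snd m (q x)) (D u) (D v) (D w)"
proof -
  have eq: "frechet_derivative (\<lambda>y. pull2 M \<Omega> q y v w) (at x) = 
    frechet_derivative (\<lambda>x. \<Omega> m ((snd m \<circ> q) x) (frechet_derivative (snd m \<circ> q) (at x) v) (frechet_derivative (snd m \<circ> q) (at x) w)) (at x)" for v w
    using x m pull2_chart[OF M \<Omega> q m(1)]
    by (intro frechet_derivative_cong_open[OF plot_coordinates(1)[OF m(1)]]) auto
  have x': "x \<in> S \<inter> q -` fst m" using x m by auto
  show ?thesis
    unfolding eq D_def ext_d2_def
    using ext_d2_bilinear_pull[OF plot_coordinates(1)[OF m(1)] plot_coordinates(3)[OF m(1)]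
        plot_smooth[OF q m(1)] plot_coordinates(2)[OF m(1)] two_form_coordinates[OF m(1)] x', of v w u]
    by (simp only: o_apply)
qed

end

lemma frechet_derivative_affine:
  assumes "(f has_derivative f') (at (a + L x))" "bounded_linear L"
  shows "((\<lambda>x. f (a + L x)) has_derivative (\<lambda>u. f' (L u))) (at x)"
proof -
  have "((\<lambda>x. a + L x) has_derivative L) (at x)"
    using assms(2) by (auto intro!: derivative_eq_intros bounded_linear_imp_has_derivative)
  from diff_chain_at[OF this assms(1)] show ?thesis by (simp add: o_def)
qed

text \<open>The Lee equation by itself, so that it can be carried through conformal changes; with
  the zero one-form it says that \<open>\<Omega>\<close> is closed.\<close>

definition lee_form :: "('a, 'e::real_normed_vector) mfd \<Rightarrow> ('a, 'e) form2 \<Rightarrow> ('a, 'e) form1 \<Rightarrow> bool" where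
  "lee_form M \<Omega> \<theta> \<longleftrightarrow>
     (\<forall>c\<in>atlas M. \<forall>x\<in>chart_img c. \<forall>u v w. ext_d2 \<Omega> c x u v w = wedge12 \<theta> \<Omega> c x u v w)"

context
  fixes M :: "('a, 'e::complex_model) mfd" and \<Omega> :: "('a, 'e) form2" and f :: "'a \<Rightarrow> real"
  assumes M: "smooth_manifold M" and \<Omega>: "two_form M \<Omega>" and f: "smooth_function M f"
begin

lemma conformal_factor_smooth:
  assumes "c \<in> atlas M" shows "smooth_on (chart_img c) (\<lambda>x. exp (- f (chart_inv c x)))"
  unfolding smooth_on_def
proof
  fix n
  have o: "open (chart_img c)" by (rule is_chart_open_img[OF smooth_manifold_chart[OF M assms]])
  have "differentiable_upto (chart_img c) (f \<circ> chart_inv c) n"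
    using f assms unfolding smooth_function_def by (simp add: smooth_on_imp)
  from differentiable_upto_compose[OF o open_UNIV _ differentiable_upto_minus[OF o this] differentiable_upto_exp]
  show "differentiable_upto (chart_img c) (\<lambda>x. exp (- f (chart_inv c x))) n" by simp
qed

lemma conformal_two_form: "two_form M (fun_mult2 (\<lambda>p. exp (- f p)) \<Omega>)"
  unfolding two_form_def
proof (intro ballI conjI allI)
  fix c assume c: "c \<in> atlas M"
  have ch: "is_chart (mtop M) c" by (rule smooth_manifold_chart[OF M c])
  note o = is_chart_open_img[OF ch]
  { fix x u v assume x: "x \<in> chart_img c"
    have l: "linear (\<Omega> c x u)" and a: "\<Omega> c x u v = - \<Omega> c x v u"
      using \<Omega> c x unfolding two_form_def by blast+
    show "linear (fun_mult2 (\<lambda>p. exp (- f p)) \<Omega> c x u)"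
      using linear_compose_scale_right[OF l, of "exp (- f (chart_inv c x))"]
      by (simp add: fun_mult2_def[abs_def])
    show "fun_mult2 (\<lambda>p. exp (- f p)) \<Omega> c x u v = - fun_mult2 (\<lambda>p. exp (- f p)) \<Omega> c x v u"
      unfolding fun_mult2_def by (subst a) simp }
  { fix u v
    have "smooth_on (chart_img c) (\<lambda>x. \<Omega> c x u v)" using \<Omega> c unfolding two_form_def by blast
    then show "smooth_on (chart_img c) (\<lambda>x. fun_mult2 (\<lambda>p. exp (- f p)) \<Omega> c x u v)"
      using conformal_factor_smooth[OF c] unfolding smooth_on_def fun_mult2_def
      by (auto intro: differentiable_upto_mult[OF o]) }
  fix d x u v assume d: "d \<in> atlas M" and x: "x \<in> overlap c d"
  then obtain p where p: "p \<in> fst c" "p \<in> fst d" "x = snd c p" by (auto simp: overlap_def)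
  then have "chart_inv d (transition c d x) = chart_inv c x"
    using transition_apply[OF ch p(1)] is_chart_inv_left[OF ch] is_chart_inv_left[OF smooth_manifold_chart[OF M d]]
    by simp
  then show "fun_mult2 (\<lambda>p. exp (- f p)) \<Omega> c x u v =
    fun_mult2 (\<lambda>p. exp (- f p)) \<Omega> d (transition c d x) (frechet_derivative (transition c d) (at x) u)
       (frechet_derivative (transition c d) (at x) v)"
    using \<Omega> c d x unfolding two_form_def fun_mult2_def by auto
qed

lemma conformal_positive:
  assumes "positive11 M (part11 \<Omega>)" shows "positive11 M (part11 (fun_mult2 (\<lambda>p. exp (- f p)) \<Omega>))"
proof -
  have "part11 (fun_mult2 (\<lambda>p. exp (- f p)) \<Omega>) c x u v = exp (- f (chart_inv c x)) * part11 \<Omega> c x u v" for c x u v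
    by (simp add: part11_def fun_mult2_def algebra_simps)
  then show ?thesis using assms unfolding positive11_def by simp
qed

text \<open>Multiplication by exp(-f) turns d\<Omega> into exp(-f) (d\<Omega> - df \<and> \<Omega>),
  so df is subtracted from the Lee form.\<close>

lemma conformal_lee_form:
  assumes "lee_form M \<Omega> \<theta>"
  shows "lee_form M (fun_mult2 (\<lambda>p. exp (- f p)) \<Omega>) (\<lambda>c x v. \<theta> c x v - ext_d0 f c x v)"
  unfolding lee_form_def
proof (intro ballI allI)
  fix c x u v w assume c: "c \<in> atlas M" and x: "x \<in> chart_img c"
  let ?g = "exp (- f (chart_inv c x))"
  have df: "((\<lambda>x. f (chart_inv c x)) has_derivative ext_d0 f c x) (at x)"
    using smooth_on_has_derivative[of "chart_img c" "f \<circ> chart_inv c" x] f c x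
    unfolding smooth_function_def ext_d0_def[abs_def] by (simp add: o_def)
  have d\<Omega>: "((\<lambda>x. \<Omega> c x v w) has_derivative frechet_derivative (\<lambda>y. \<Omega> c y v w) (at x)) (at x)" for v w
    using \<Omega> c x unfolding two_form_def by (blast intro: smooth_on_has_derivative)
  have d: "frechet_derivative (\<lambda>y. fun_mult2 (\<lambda>p. exp (- f p)) \<Omega> c y v w) (at x) u =
     ?g * frechet_derivative (\<lambda>y. \<Omega> c y v w) (at x) u - ?g * ext_d0 f c x u * \<Omega> c x v w" for u v w
  proof -
    have "((\<lambda>y. exp (- f (chart_inv c y)) * \<Omega> c y v w) has_derivative (\<lambda>u. ?g * frechet_derivative (\<lambda>y. \<Omega> c y v w) (at x) u - ?g * ext_d0 f c x u * \<Omega> c x v w)) (at x)"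
      by (rule derivative_eq_intros df d\<Omega> refl)+ (auto simp: algebra_simps)
    from fun_cong[OF frechet_derivative_at[OF this], of u] show ?thesis
      unfolding fun_mult2_def by simp
  qed
  have "ext_d2 \<Omega> c x u v w = wedge12 \<theta> \<Omega> c x u v w" using assms c x unfolding lee_form_def by blast
  then have "?g * ext_d2 \<Omega> c x u v w = ?g * wedge12 \<theta> \<Omega> c x u v w" by simp
  then show "ext_d2 (fun_mult2 (\<lambda>p. exp (- f p)) \<Omega>) c x u v w =
    wedge12 (\<lambda>c x v. \<theta> c x v - ext_d0 f c x v) (fun_mult2 (\<lambda>p. exp (- f p)) \<Omega>) c x u v w"
    unfolding ext_d2_def d wedge12_def by (simp add: fun_mult2_def algebra_simps)
qed

end

text \<open>By induction the norm controls coordinates with respect to A, so the coordinates of a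
  convergent sequence in span A are Cauchy and span A is closed. Hence the new vector b has a
  positive distance \<delta> from span A, and this distance bounds its coefficient.\<close>

lemma finite_dimensional_coordinates_bound:
  fixes A :: "'n::real_normed_vector set"
  assumes "finite A" "independent A"
  shows "\<exists>C>0. \<forall>r. (\<Sum>a\<in>A. \<bar>r a\<bar>) \<le> C * norm (\<Sum>a\<in>A. r a *\<^sub>R a)"
  using assms
proof (induction A)
  case empty
  then show ?case by (auto intro!: exI[of _ 1])
next
  case (insert b A)
  then obtain C where C: "C > 0" "\<And>r. (\<Sum>a\<in>A. \<bar>r a\<bar>) \<le> C * norm (\<Sum>a\<in>A. r a *\<^sub>R a)"
    by (metis independent_insert)
  have b: "b \<notin> span A" using insert by (simp add: independent_insert)
  have span: "\<exists>r. x = (\<Sum>a\<in>A. r a *\<^sub>R a)" if "x \<in> span A" for x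
    using that span_finite[OF insert(1)] by auto
  have "\<exists>\<delta>>0. \<forall>x\<in>span A. \<delta> \<le> norm (b - x)"
  proof (rule ccontr)
    assume "\<not> ?thesis"
    then have "\<forall>n. \<exists>x\<in>span A. norm (b - x) < inverse (real (Suc n))"
      by (metis inverse_positive_iff_positive not_le of_nat_0_less_iff zero_less_Suc)
    then obtain s where s: "\<And>n. s n \<in> span A" "\<And>n. norm (b - s n) < inverse (real (Suc n))" by metis
    obtain r where r: "\<And>n. s n = (\<Sum>a\<in>A. r n a *\<^sub>R a)" using span[OF s(1)] by metis
    have lim: "s \<longlonglongrightarrow> b"
    proof (rule LIMSEQ_norm_0[THEN Lim_transform2[OF tendsto_const]])
      fix n show "norm (b - s n) < 1 / real (Suc n)" using s(2)[of n] by (simp add: inverse_eq_divide)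
    qed
    have "Cauchy (\<lambda>n. r n a)" if a: "a \<in> A" for a
    proof (rule metric_CauchyI)
      fix e :: real assume e: "e > 0"
      obtain N where N: "\<And>m n. m \<ge> N \<Longrightarrow> n \<ge> N \<Longrightarrow> dist (s m) (s n) < e / C"
        using LIMSEQ_imp_Cauchy[OF lim] C(1) e by (metis metric_CauchyD divide_pos_pos)
      have "dist (r m a) (r n a) < e" if "m \<ge> N" "n \<ge> N" for m n
      proof -
        have "\<bar>r m a - r n a\<bar> \<le> (\<Sum>a\<in>A. \<bar>r m a - r n a\<bar>)"
          using insert(1) a by (intro member_le_sum) auto
        also have "\<dots> \<le> C * norm (\<Sum>a\<in>A. (r m a - r n a) *\<^sub>R a)" by (rule C(2))
        also have "(\<Sum>a\<in>A. (r m a - r n a) *\<^sub>R a) = s m - s n"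
          by (simp add: r scaleR_left_diff_distrib sum_subtractf)
        also have "C * norm (s m - s n) < e"
          using N[OF that] C(1) by (simp add: dist_norm field_simps)
        finally show ?thesis by (simp add: dist_real_def)
      qed
      then show "\<exists>N. \<forall>m\<ge>N. \<forall>n\<ge>N. dist (r m a) (r n a) < e" by blast
    qed
    then obtain l where l: "\<And>a. a \<in> A \<Longrightarrow> (\<lambda>n. r n a) \<longlonglongrightarrow> l a"
      unfolding Cauchy_convergent_iff convergent_def by metis
    have "s \<longlonglongrightarrow> (\<Sum>a\<in>A. l a *\<^sub>R a)"
      unfolding r[abs_def] using l by (intro tendsto_sum tendsto_scaleR tendsto_const) auto
    then have "b = (\<Sum>a\<in>A. l a *\<^sub>R a)" using lim LIMSEQ_unique by blast
    moreover have "(\<Sum>a\<in>A. l a *\<^sub>R a) \<in> span A"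
      by (intro span_sum span_scale span_base)
    ultimately show False using b by simp
  qed
  then obtain \<delta> where \<delta>: "\<delta> > 0" "\<And>x. x \<in> span A \<Longrightarrow> \<delta> \<le> norm (b - x)" by blast
  \<comment> \<open>\<open>1 / \<delta>\<close> accounts for the coefficient of b. The factor
    \<open>1 + norm b / \<delta>\<close> bounds the norm of the remaining part x by that of y, and C
    converts this into a bound on the coordinates of x.\<close>
  define K where "K = 1 / \<delta> + C * (1 + norm b / \<delta>)"
  have "K > 0" using \<delta>(1) C(1) unfolding K_def by (intro add_pos_nonneg) auto
  moreover have "(\<Sum>a\<in>insert b A. \<bar>r a\<bar>) \<le> K * norm (\<Sum>a\<in>insert b A. r a *\<^sub>R a)" for r
  proof -
    define x where "x = (\<Sum>a\<in>A. r a *\<^sub>R a)"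
    define y where "y = r b *\<^sub>R b + x"
    have xs: "x \<in> span A" unfolding x_def by (intro span_sum span_scale span_base)
    have rb: "\<bar>r b\<bar> \<le> norm y / \<delta>"
    proof (cases "r b = 0")
      case False
      have "\<delta> \<le> norm (b - (- (1 / r b)) *\<^sub>R x)" by (intro \<delta>(2) span_scale xs)
      also have "b - (- (1 / r b)) *\<^sub>R x = (1 / r b) *\<^sub>R y"
        using False by (simp add: y_def scaleR_add_right)
      finally have "\<delta> \<le> norm y / \<bar>r b\<bar>" by simp
      then show ?thesis using False \<delta>(1) by (simp add: field_simps)
    qed (use \<delta> in auto)
    have "norm x \<le> norm y + \<bar>r b\<bar> * norm b"
      using norm_triangle_ineq4[of y "r b *\<^sub>R b"] by (simp add: y_def)
    also have "\<dots> \<le> norm y + norm y / \<delta> * norm b" by (intro add_left_mono mult_right_mono rb) auto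
    finally have nx: "norm x \<le> norm y * (1 + norm b / \<delta>)" by (simp add: algebra_simps)
    have "(\<Sum>a\<in>insert b A. \<bar>r a\<bar>) = \<bar>r b\<bar> + (\<Sum>a\<in>A. \<bar>r a\<bar>)" using insert by simp
    also have "\<dots> \<le> norm y / \<delta> + C * norm x" using rb C(2)[of r] by (simp add: x_def)
    also have "\<dots> \<le> norm y / \<delta> + C * (norm y * (1 + norm b / \<delta>))"
      using nx C(1) by (intro add_left_mono mult_left_mono) auto
    also have "\<dots> = K * norm y" by (simp add: K_def algebra_simps)
    also have "y = (\<Sum>a\<in>insert b A. r a *\<^sub>R a)" using insert by (simp add: y_def x_def)
    finally show ?thesis .
  qed
  ultimately show ?case by blast
qed

lemma complex_model_coordinates:
  obtains A :: "'n::complex_model set" and \<kappa> C where "finite A" "C > 0" "\<And>x. x = (\<Sum>a\<in>A. \<kappa> x a *\<^sub>R a)"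
    "\<And>x. (\<Sum>a\<in>A. \<bar>\<kappa> x a\<bar>) \<le> C * norm x"
proof -
  obtain S :: "'n set" where S: "finite S" "\<And>x. \<exists>r. x = (\<Sum>a\<in>S. r a *\<^sub>R a)" using finite_dimensional by metis
  then have "span S = UNIV" by (auto simp: span_finite[OF S(1)])
  moreover obtain A where A: "A \<subseteq> S" "independent A" "S \<subseteq> span A"
    using maximal_independent_subset[of S] by blast
  ultimately have spA: "span A = UNIV"
    by (metis span_mono span_span top.extremum_unique)
  have fA: "finite A" using A S finite_subset by blast
  obtain C where C: "C > 0" "\<And>r. (\<Sum>a\<in>A. \<bar>r a\<bar>) \<le> C * norm (\<Sum>a\<in>A. r a *\<^sub>R a)"
    using finite_dimensional_coordinates_bound[OF fA A(2)] by blast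
  have "\<exists>r. x = (\<Sum>a\<in>A. r a *\<^sub>R a)" for x
  proof -
    have "x \<in> range (\<lambda>r. \<Sum>a\<in>A. r a *\<^sub>R a)" using spA unfolding span_finite[OF fA] by simp
    then show ?thesis by blast
  qed
  then have "\<forall>x. \<exists>r. x = (\<Sum>a\<in>A. r a *\<^sub>R a)" by blast
  from choice[OF this] obtain \<kappa> where \<kappa>: "\<And>x. x = (\<Sum>a\<in>A. \<kappa> x a *\<^sub>R a)" by blast
  have "(\<Sum>a\<in>A. \<bar>\<kappa> x a\<bar>) \<le> C * norm x" for x
    using C(2)[of "\<kappa> x"] \<kappa>[of x] by simp
  then show ?thesis using that[OF fA C(1) \<kappa>] by blast
qed

text \<open>As \<open>'n\<close> is not of class \<^class>\<open>euclidean_space\<close>, the bound on coordinates proved above replaces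
  the continuity of linear maps.\<close>

lemma directional_imp_has_derivative:
  fixes h :: "'n::complex_model \<Rightarrow> real" and a :: "'n \<Rightarrow> 'n \<Rightarrow> real"
  assumes T: "open T" and lin: "\<And>y. y \<in> T \<Longrightarrow> linear (a y)" and cont: "\<And>w. continuous_on T (\<lambda>y. a y w)"
    and d: "\<And>y w. y \<in> T \<Longrightarrow> ((\<lambda>s. h (y + s *\<^sub>R w)) has_real_derivative a y w) (at 0)"
    and y: "y \<in> T"
  shows "(h has_derivative a y) (at y)"
proof -
  obtain A :: "'n set" and C \<kappa> where A: "finite A" "C > 0" "\<And>x. x = (\<Sum>a\<in>A. \<kappa> x a *\<^sub>R a)"
    "\<And>x. (\<Sum>a\<in>A. \<bar>\<kappa> x a\<bar>) \<le> C * norm x"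
    by (rule complex_model_coordinates, rule that)
  have expand: "a z w = (\<Sum>b\<in>A. \<kappa> w b * a z b)" if "z \<in> T" for z w
    by (subst A(3)[of w]) (simp add: linear_sum[OF lin[OF that]] linear_scale[OF lin[OF that]])
  have bl: "bounded_linear (a y)"
  proof (rule bounded_linear_intro)
    show "a y (u + v) = a y u + a y v" for u v using lin[OF y] by (rule linear_add)
    show "a y (r *\<^sub>R u) = r *\<^sub>R a y u" for r u using lin[OF y] by (rule linear_scale)
    show "norm (a y w) \<le> norm w * (C * (\<Sum>b\<in>A. \<bar>a y b\<bar>))" for w
    proof -
      have "\<bar>a y w\<bar> \<le> (\<Sum>b\<in>A. \<bar>\<kappa> w b\<bar> * (\<Sum>b\<in>A. \<bar>a y b\<bar>))"
        unfolding expand[OF y, of w]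
        by (intro order_trans[OF sum_abs] sum_mono) (auto simp: abs_mult A(1) intro!: mult_left_mono member_le_sum)
      also have "\<dots> = (\<Sum>b\<in>A. \<bar>\<kappa> w b\<bar>) * (\<Sum>b\<in>A. \<bar>a y b\<bar>)" by (simp add: sum_distrib_right)
      also have "\<dots> \<le> (C * norm w) * (\<Sum>b\<in>A. \<bar>a y b\<bar>)" by (intro mult_right_mono A(4) sum_nonneg) auto
      finally show ?thesis by (simp add: mult_ac)
    qed
  qed
  have lim: "\<exists>\<delta>>0. \<forall>w. norm w < \<delta> \<longrightarrow> norm (h (y + w) - h y - a y w) \<le> e * norm w" if e: "e > 0" for e
  proof -
    have "\<exists>\<delta>>0. \<forall>z\<in>T. dist z y < \<delta> \<longrightarrow> \<bar>a z b - a y b\<bar> < e / C" for b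
      using cont[of b] y e A(2) unfolding continuous_on_iff dist_real_def by (metis divide_pos_pos)
    then obtain \<delta>' where \<delta>': "\<And>b. \<delta>' b > 0" "\<And>b z. z \<in> T \<Longrightarrow> dist z y < \<delta>' b \<Longrightarrow> \<bar>a z b - a y b\<bar> < e / C"
      by metis
    obtain \<delta>0 where \<delta>0: "\<delta>0 > 0" "\<And>z. dist z y < \<delta>0 \<Longrightarrow> z \<in> T" using T y unfolding open_dist by blast
    \<comment> \<open>Continuity of \<open>a\<close> is used only in the finitely many directions of
      A; the minimum makes one radius serve all of them.\<close>
    define \<delta> where "\<delta> = Min (insert \<delta>0 (\<delta>' ` A))"
    have \<delta>: "\<delta> > 0" "\<delta> \<le> \<delta>0" "\<And>b. b \<in> A \<Longrightarrow> \<delta> \<le> \<delta>' b"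
      using \<delta>'(1) \<delta>0(1) A(1) unfolding \<delta>_def by auto
    have "norm (h (y + w) - h y - a y w) \<le> e * norm w" if w: "norm w < \<delta>" for w
    proof -
      have near: "dist (y + s *\<^sub>R w) y < \<delta>" if "0 \<le> s" "s \<le> 1" for s
        using w mult_left_le_one_le[of "norm w" s] that by (simp add: dist_norm)
      have inT: "y + s *\<^sub>R w \<in> T" if "0 \<le> s" "s \<le> 1" for s
        using near[OF that] \<delta> \<delta>0(2) by force
      have ds: "((\<lambda>s. h (y + s *\<^sub>R w)) has_real_derivative a (y + s *\<^sub>R w) w) (at s)" if "0 \<le> s" "s \<le> 1" for s
      proof -
        have "((\<lambda>t. h ((y + s *\<^sub>R w) + (t - s) *\<^sub>R w)) has_real_derivative a (y + s *\<^sub>R w) w * 1) (at s)"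
          by (rule DERIV_chain2[where f = "\<lambda>s'. h ((y + s *\<^sub>R w) + s' *\<^sub>R w)" and g = "\<lambda>t. t - s"])
             (auto intro!: derivative_eq_intros d inT that)
        moreover have "(y + s *\<^sub>R w) + (t - s) *\<^sub>R w = y + t *\<^sub>R w" for t by (simp add: algebra_simps)
        ultimately show ?thesis by simp
      qed
      \<comment> \<open>On the segment from y to y + w the increment of h is the directional
        derivative at an intermediate point, which is then compared with \<open>a y w\<close> in
        coordinates.\<close>
      have "\<exists>s>0. s < 1 \<and> h (y + 1 *\<^sub>R w) - h (y + 0 *\<^sub>R w) = (1 - 0) * a (y + s *\<^sub>R w) w"
        by (intro MVT2 ds) auto
      then obtain s where s: "0 < s" "s < 1" "h (y + w) - h y = a (y + s *\<^sub>R w) w" by auto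
      have "h (y + w) - h y - a y w = (\<Sum>b\<in>A. \<kappa> w b * (a (y + s *\<^sub>R w) b - a y b))"
        using expand[OF inT[of s], of w] expand[OF y, of w] s by (simp add: algebra_simps sum_subtractf)
      also have "norm \<dots> \<le> (\<Sum>b\<in>A. \<bar>\<kappa> w b\<bar> * (e / C))"
      proof -
        have "\<bar>a (y + s *\<^sub>R w) b - a y b\<bar> \<le> e / C" if "b \<in> A" for b
          using \<delta>'(2)[OF inT[of s], of b] near[of s] \<delta>(3)[OF that] s by force
        then show ?thesis
          unfolding real_norm_def
          by (intro order_trans[OF sum_abs] sum_mono) (simp add: abs_mult mult_left_mono del: times_divide_eq_right)
      qed
      also have "\<dots> = (\<Sum>b\<in>A. \<bar>\<kappa> w b\<bar>) * (e / C)" by (rule sum_distrib_right[symmetric])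
      also have "\<dots> \<le> (C * norm w) * (e / C)" using e A(2) by (intro mult_right_mono A(4)) auto
      finally show ?thesis using A(2) by (simp add: mult.commute)
    qed
    then show ?thesis using \<delta>(1) by blast
  qed
  show ?thesis
    unfolding has_derivative_at_alt
  proof (intro conjI bl allI impI)
    fix e :: real assume "e > 0"
    then obtain \<delta> where \<delta>: "\<delta> > 0" "\<And>w. norm w < \<delta> \<Longrightarrow> norm (h (y + w) - h y - a y w) \<le> e * norm w"
      using lim by blast
    have "norm (h z - h y - a y (z - y)) \<le> e * norm (z - y)" if "norm (z - y) < \<delta>" for z
      using \<delta>(2)[OF that] by simp
    then show "\<exists>d>0. \<forall>z. norm (z - y) < d \<longrightarrow> norm (h z - h y - a y (z - y)) \<le> e * norm (z - y)"
      using \<delta>(1) by blast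
  qed
qed


section \<open>Change of variables in Euclidean spaces; derivative of the determinant\<close>

text \<open>The library states the change of variables formula for \<open>real^'n\<close> with \<open>'n\<close> a finite well-order.
  The type of basis vectors serves as such an index type for an arbitrary Euclidean space.\<close>

typedef (overloaded) ('f::euclidean_space) bidx = "Basis :: 'f set"
  morphisms bvec Abs_bidx
  using nonempty_Basis by blast

lemma bvec_in_Basis [simp]: "bvec i \<in> Basis"
  by (rule bvec)

lemma bvec_inject [simp]: "bvec i = bvec j \<longleftrightarrow> i = j"
  by (rule bvec_inject)

lemma bvec_inner: "bvec i \<bullet> bvec j = (if i = j then 1 else 0)"
  by (simp add: inner_Basis)

lemma range_bvec: "range bvec = Basis"
  by (metis type_definition.Rep_range type_definition_bidx)

lemma bij_betw_bvec: "bij_betw bvec UNIV Basis"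
  by (auto simp: bij_betw_def inj_on_def range_bvec)

lemma sum_bvec: "(\<Sum>i\<in>UNIV. g (bvec i)) = (\<Sum>b\<in>Basis. g b)"
  by (rule sum.reindex_bij_betw[OF bij_betw_bvec])

lemma prod_bvec: "(\<Prod>i\<in>UNIV. g (bvec i)) = (\<Prod>b\<in>Basis. g b)"
  by (rule prod.reindex_bij_betw[OF bij_betw_bvec])

instance bidx :: (euclidean_space) finite
proof
  show "finite (UNIV :: 'a bidx set)"
    using bij_betw_finite[OF bij_betw_bvec] by auto
qed

lemma card_bidx: "CARD('f::euclidean_space bidx) = DIM('f)"
  using bij_betw_same_card[OF bij_betw_bvec] .

instantiation bidx :: (euclidean_space) wellorder
begin

definition bidx_nat :: "'a bidx \<Rightarrow> nat" where "bidx_nat = (SOME f. inj f)"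

definition "i \<le> j \<longleftrightarrow> bidx_nat i \<le> bidx_nat j"
definition "i < j \<longleftrightarrow> bidx_nat i < bidx_nat j"

lemma inj_bidx_nat: "inj bidx_nat"
proof -
  have "\<exists>f::'a bidx \<Rightarrow> nat. inj f"
    using finite_imp_inj_to_nat_seg[OF finite] by blast
  then show ?thesis unfolding bidx_nat_def by (rule someI_ex)
qed

instance
proof
  fix P :: "'a bidx \<Rightarrow> bool" and a :: "'a bidx"
  assume step: "\<And>x. (\<And>y. y < x \<Longrightarrow> P y) \<Longrightarrow> P x"
  show "P a"
    by (induction a rule: measure_induct_rule[of bidx_nat]) (auto intro: step simp: less_bidx_def)
next
  fix i j :: "'a bidx"
  show "i \<le> j \<Longrightarrow> j \<le> i \<Longrightarrow> i = j"
    using inj_bidx_nat by (auto simp: less_eq_bidx_def dest: injD)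
qed (auto simp: less_eq_bidx_def less_bidx_def)

end

definition of_vec :: "real^('f::euclidean_space bidx) \<Rightarrow> 'f" where
  "of_vec v = (\<Sum>i\<in>UNIV. (v $ i) *\<^sub>R bvec i)"

definition to_vec :: "'f::euclidean_space \<Rightarrow> real^('f bidx)" where
  "to_vec x = (\<chi> i. x \<bullet> bvec i)"

lemma of_vec_inner_bvec [simp]: "of_vec v \<bullet> bvec i = v $ i"
  by (simp add: of_vec_def inner_sum_left bvec_inner if_distrib cong: if_cong)

lemma to_vec_of_vec [simp]: "to_vec (of_vec v) = v"
  by (simp add: to_vec_def vec_eq_iff)

lemma bvec_expand: "(\<Sum>i\<in>UNIV. (x \<bullet> bvec i) *\<^sub>R bvec i) = x"
  using sum_bvec[of "\<lambda>b. (x \<bullet> b) *\<^sub>R b"] by (simp add: euclidean_representation)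

lemma of_vec_to_vec [simp]: "of_vec (to_vec x) = x"
  by (simp add: of_vec_def to_vec_def bvec_expand)

lemma linear_of_vec: "linear of_vec"
  by (rule linearI) (auto simp: of_vec_def scaleR_add_left sum.distrib scaleR_sum_right)

lemma linear_to_vec: "linear to_vec"
  by (rule linearI) (auto simp: to_vec_def vec_eq_iff inner_add_left)

lemma bounded_linear_of_vec: "bounded_linear of_vec"
  using linear_of_vec by (simp add: linear_conv_bounded_linear)

lemma bounded_linear_to_vec: "bounded_linear to_vec"
  using linear_to_vec by (simp add: linear_conv_bounded_linear)

lemma of_vec_axis: "of_vec (axis i 1) = bvec i"
  by (simp add: of_vec_def axis_def if_distrib[of "\<lambda>x. x *\<^sub>R _"] cong: if_cong)

lemma mem_cbox_to_vec: "to_vec x \<in> cbox (to_vec a) (to_vec b) \<longleftrightarrow> x \<in> cbox a b"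
proof -
  have "(\<forall>i. P (bvec i)) \<longleftrightarrow> (\<forall>b\<in>Basis. P b)" for P
    using range_bvec by (metis UNIV_I image_iff bvec_in_Basis)
  from this[of "\<lambda>i. a \<bullet> i \<le> x \<bullet> i \<and> x \<bullet> i \<le> b \<bullet> i"] show ?thesis
    by (simp add: mem_box_cart mem_box to_vec_def)
qed

lemma to_vec_image_cbox: "to_vec ` cbox a b = cbox (to_vec a) (to_vec b)"
proof -
  have "y \<in> to_vec ` cbox a b" if "y \<in> cbox (to_vec a) (to_vec b)" for y
    using that mem_cbox_to_vec[of "of_vec y" a b] by (metis image_eqI to_vec_of_vec)
  then show ?thesis using mem_cbox_to_vec by auto
qed

lemma of_vec_image_cbox: "of_vec ` cbox u v = cbox (of_vec u) (of_vec v)"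
proof -
  have "of_vec ` to_vec ` cbox (of_vec u) (of_vec v) = cbox (of_vec u) (of_vec v)"
    by (simp only: image_image of_vec_to_vec image_ident)
  then show ?thesis unfolding to_vec_image_cbox to_vec_of_vec .
qed

lemma content_of_vec: "measure lborel (cbox (of_vec u) (of_vec v)) = measure lborel (cbox u v)"
proof (cases "cbox u v = {}")
  case False
  then have "cbox (of_vec u) (of_vec v) \<noteq> {}" by (simp add: of_vec_image_cbox[symmetric])
  then show ?thesis
    using False prod_bvec[of "\<lambda>b. of_vec v \<bullet> b - of_vec u \<bullet> b"]
    by (simp add: of_vec_image_cbox content_cbox' content_cbox_if_cart)
qed (simp add: of_vec_image_cbox[symmetric])

lemma norm_to_vec: "norm (to_vec x) = norm x"
proof -
  have "(norm (to_vec x))\<^sup>2 = (\<Sum>i\<in>UNIV. (x \<bullet> bvec i)\<^sup>2)"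
    by (simp add: norm_vec_def L2_set_def to_vec_def sum_nonneg)
  also have "\<dots> = (norm x)\<^sup>2"
    unfolding power2_norm_eq_inner euclidean_inner[of x x]
    using sum_bvec[of "\<lambda>b. (x \<bullet> b)\<^sup>2"] by (simp add: power2_eq_square)
  finally show ?thesis by simp
qed

lemma has_integral_of_vec_cbox:
  fixes f :: "'f::euclidean_space \<Rightarrow> real"
  shows "(f has_integral i) (cbox a b) \<longleftrightarrow> ((\<lambda>v. f (of_vec v)) has_integral i) (cbox (to_vec a) (to_vec b))"
proof
  assume "(f has_integral i) (cbox a b)"
  \<comment> \<open>The factor \<open>1 / 1\<close> is the inverse ratio of contents:
    \<open>of_vec\<close> preserves the content of boxes.\<close>
  then have "((\<lambda>v. f (of_vec v)) has_integral (1 / 1) *\<^sub>R i) (to_vec ` cbox a b)"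
    by (intro has_integral_twiddle)
      (auto simp: content_of_vec to_vec_image_cbox of_vec_image_cbox intro!: linear_continuous_at bounded_linear_of_vec)
  then show "((\<lambda>v. f (of_vec v)) has_integral i) (cbox (to_vec a) (to_vec b))" by (simp add: to_vec_image_cbox)
next
  have c: "measure lborel (cbox (to_vec u) (to_vec v)) = measure lborel (cbox u v)" for u v :: 'f
    using content_of_vec[of "to_vec u" "to_vec v"] by (simp add: to_vec_image_cbox of_vec_image_cbox)
  assume "((\<lambda>v. f (of_vec v)) has_integral i) (cbox (to_vec a) (to_vec b))"
  then have "((\<lambda>x. f (of_vec (to_vec x))) has_integral (1 / 1) *\<^sub>R i) (of_vec ` cbox (to_vec a) (to_vec b))"
    by (intro has_integral_twiddle)
      (auto simp: c to_vec_image_cbox of_vec_image_cbox intro!: linear_continuous_at bounded_linear_to_vec)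
  then show "(f has_integral i) (cbox a b)" by (simp add: of_vec_image_cbox)
qed

text \<open>The characterization \<open>has_integral_alt'\<close> speaks only of integrals over
  boxes and of balls around 0. Both correspond under the isometry \<open>to_vec\<close>, which maps
  boxes onto boxes of equal content.\<close>

lemma has_integral_of_vec:
  fixes f :: "'f::euclidean_space \<Rightarrow> real"
  shows "(f has_integral i) S \<longleftrightarrow> ((\<lambda>v. f (of_vec v)) has_integral i) (of_vec -` S)"
proof -
  let ?f = "\<lambda>x. if x \<in> S then f x else 0"
  let ?g = "\<lambda>v. if v \<in> of_vec -` S then f (of_vec v) else 0"
  have fg: "?g = (\<lambda>v. ?f (of_vec v))" by auto
  have int: "integral (cbox a b) ?f = integral (cbox (to_vec a) (to_vec b)) ?g" for a b
    unfolding integral_def integrable_on_def fg has_integral_of_vec_cbox[of ?f _ a b] ..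
  have itb: "?f integrable_on cbox a b \<longleftrightarrow> ?g integrable_on cbox (to_vec a) (to_vec b)" for a b
    unfolding integrable_on_def fg has_integral_of_vec_cbox[of ?f _ a b] ..
  have all: "(\<forall>a b. P (to_vec a) (to_vec b)) \<longleftrightarrow> (\<forall>u v. P u v)" for P :: "real^('f bidx) \<Rightarrow> real^('f bidx) \<Rightarrow> bool"
    by (metis to_vec_of_vec)
  have ball: "ball 0 B \<subseteq> cbox a b \<longleftrightarrow> ball 0 B \<subseteq> cbox (to_vec a) (to_vec b)" for B and a b :: 'f
  proof -
    have "(\<forall>x. norm x < B \<longrightarrow> x \<in> cbox a b) \<longleftrightarrow> (\<forall>x. norm (to_vec x) < B \<longrightarrow> to_vec x \<in> cbox (to_vec a) (to_vec b))"
      by (simp add: norm_to_vec mem_cbox_to_vec)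
    also have "\<dots> \<longleftrightarrow> (\<forall>y. norm y < B \<longrightarrow> y \<in> cbox (to_vec a) (to_vec b))"
      by (metis to_vec_of_vec)
    finally show ?thesis by (auto simp: subset_iff)
  qed
  show ?thesis
    unfolding has_integral_alt'[of f] has_integral_alt'[of "\<lambda>v. f (of_vec v)"] int itb ball
    unfolding all[of "\<lambda>u v. ?g integrable_on cbox u v"]
      all[of "\<lambda>u v. ball 0 B \<subseteq> cbox u v \<longrightarrow> norm (integral (cbox u v) ?g - i) < e" for B e] ..
qed

lemma integral_of_vec:
  fixes f :: "'f::euclidean_space \<Rightarrow> real"
  shows "integral (of_vec -` S) (\<lambda>v. f (of_vec v)) = integral S f"
  unfolding integral_def integrable_on_def has_integral_of_vec[of f _ S] ..

lemma absolutely_integrable_of_vec: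
  fixes f :: "'f::euclidean_space \<Rightarrow> real"
  shows "(\<lambda>v. f (of_vec v)) absolutely_integrable_on (of_vec -` S) \<longleftrightarrow> f absolutely_integrable_on S"
  unfolding absolutely_integrable_on_def integrable_on_def has_integral_of_vec[of f _ S]
    has_integral_of_vec[of "\<lambda>x. norm (f x)" _ S] ..

definition lin_matrix :: "('f::euclidean_space \<Rightarrow> 'f) \<Rightarrow> real^('f bidx)^('f bidx)" where
  "lin_matrix T = (\<chi> i j. T (bvec j) \<bullet> bvec i)"

text \<open>Conjugating \<open>\<tau>\<close> with \<open>to_vec\<close> and \<open>of_vec\<close>
  gives a map between spaces of coordinate vectors, and the matrix of its derivative is
  \<open>lin_matrix\<close>.\<close>

lemma euclidean_change_of_variables:
  fixes h :: "'f::euclidean_space \<Rightarrow> real"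
  assumes S: "open S" and d: "\<And>x. x \<in> S \<Longrightarrow> (\<tau> has_derivative \<tau>' x) (at x)" and inj: "inj_on \<tau> S"
  shows "(\<lambda>x. \<bar>det (lin_matrix (\<tau>' x))\<bar> * h (\<tau> x)) absolutely_integrable_on S \<and>
      integral S (\<lambda>x. \<bar>det (lin_matrix (\<tau>' x))\<bar> * h (\<tau> x)) = b
    \<longleftrightarrow> h absolutely_integrable_on (\<tau> ` S) \<and> integral (\<tau> ` S) h = b"
proof -
  let ?S = "of_vec -` S"
  let ?g = "\<lambda>v. to_vec (\<tau> (of_vec v))"
  let ?g' = "\<lambda>v u. to_vec (\<tau>' (of_vec v) (of_vec u))"
  have oS: "open ?S"
    using continuous_open_vimage[OF S, of of_vec] linear_continuous_at[OF bounded_linear_of_vec]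
    by (metis S continuous_open_vimage)
  have dg: "(?g has_derivative ?g' v) (at v within ?S)" if "v \<in> ?S" for v
  proof -
    have "(\<tau> has_derivative \<tau>' (of_vec v)) (at (of_vec v))" using that d by auto
    from diff_chain_at[OF bounded_linear_imp_has_derivative[OF bounded_linear_of_vec] this]
    have "((\<lambda>v. \<tau> (of_vec v)) has_derivative (\<lambda>u. \<tau>' (of_vec v) (of_vec u))) (at v)" by (simp add: o_def)
    from bounded_linear.has_derivative[OF bounded_linear_to_vec this] show ?thesis
      by (rule has_derivative_at_withinI)
  qed
  have inj': "inj_on ?g ?S"
    using inj unfolding inj_on_def by (metis of_vec_to_vec to_vec_of_vec vimageE)
  have img: "?g ` ?S = of_vec -` (\<tau> ` S)"
  proof -
    have "y \<in> ?g ` ?S" if y: "of_vec y \<in> \<tau> ` S" for y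
    proof -
      obtain x where "x \<in> S" "of_vec y = \<tau> x" using y by auto
      then have "y = ?g (to_vec x)" "to_vec x \<in> ?S" by (metis of_vec_to_vec to_vec_of_vec, simp)
      then show ?thesis by blast
    qed
    then show ?thesis by auto
  qed
  have m: "matrix (?g' v) = lin_matrix (\<tau>' (of_vec v))" for v
    by (simp add: matrix_def lin_matrix_def vec_eq_iff of_vec_axis to_vec_def)
  have "?S \<in> sets lebesgue" using oS by simp
  \<comment> \<open>The formula concerns vector-valued integrands, so \<open>h\<close> is regarded
    as having values in \<open>real^1\<close>.\<close>
  from has_absolute_integral_change_of_variables[OF this dg inj', of "\<lambda>v. vec (h (of_vec v)) :: real^1" "vec b"]
  have "(\<lambda>v. \<bar>det (lin_matrix (\<tau>' (of_vec v)))\<bar> * h (\<tau> (of_vec v))) absolutely_integrable_on ?S \<and>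
      integral ?S (\<lambda>v. \<bar>det (lin_matrix (\<tau>' (of_vec v)))\<bar> * h (\<tau> (of_vec v))) = b
    \<longleftrightarrow> (\<lambda>v. h (of_vec v)) absolutely_integrable_on (of_vec -` \<tau> ` S) \<and> integral (of_vec -` \<tau> ` S) (\<lambda>v. h (of_vec v)) = b"
    by (simp add: img m absolutely_integrable_on_1_iff integral_on_1_eq vec_eq_iff)
  then show ?thesis
    unfolding absolutely_integrable_of_vec[where f = "\<lambda>x. \<bar>det (lin_matrix (\<tau>' x))\<bar> * h (\<tau> x)" and S = S]
      integral_of_vec[where f = "\<lambda>x. \<bar>det (lin_matrix (\<tau>' x))\<bar> * h (\<tau> x)" and S = S] absolutely_integrable_of_vec integral_of_vec .
qed

section \<open>The determinant and its derivative\<close>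

lemma det_differentiable_upto:
  fixes A :: "'s::real_normed_vector \<Rightarrow> real^'n^'n"
  assumes "open S" "\<And>i j. differentiable_upto S (\<lambda>x. A x $ i $ j) n"
  shows "differentiable_upto S (\<lambda>x. det (A x)) n"
  unfolding det_def
  by (intro differentiable_upto_sum differentiable_upto_mult differentiable_upto_prod differentiable_upto_const assms)

text \<open>The derivative of the determinant at A in direction B, in the form given by
  multilinearity in the rows; unlike the formula with the inverse matrix it makes sense for singular
  A as well.\<close>

definition det_deriv :: "real^'n^'n \<Rightarrow> real^'n^'n \<Rightarrow> real" where
  "det_deriv A B = (\<Sum>i\<in>UNIV. det (\<chi> j. if j = i then B $ i else A $ j))"

text \<open>Product rule for each permutation in the Leibniz formula. Interchanging the two sums
  collects, for each row i, the determinant in which that row is differentiated.\<close>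

lemma has_derivative_det:
  fixes A :: "'s::real_normed_vector \<Rightarrow> real^'n^'n"
  assumes A: "\<And>i j. ((\<lambda>x. A x $ i $ j) has_derivative (\<lambda>u. A' u $ i $ j)) (at x)"
  shows "((\<lambda>x. det (A x)) has_derivative (\<lambda>u. det_deriv (A x) (A' u))) (at x)"
proof -
  let ?P = "{p. p permutes (UNIV::'n set)}"
  have "((\<lambda>x. \<Sum>p\<in>?P. of_int (sign p) * (\<Prod>i\<in>UNIV. A x $ i $ p i)) has_derivative
    (\<lambda>u. \<Sum>p\<in>?P. of_int (sign p) * (\<Sum>i\<in>UNIV. A' u $ i $ p i * (\<Prod>j\<in>UNIV - {i}. A x $ j $ p j)))) (at x)"
    by (intro has_derivative_sum has_derivative_mult_right has_derivative_prod A)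
  moreover have "(\<Sum>p\<in>?P. of_int (sign p) * (\<Sum>i\<in>UNIV. A' u $ i $ p i * (\<Prod>j\<in>UNIV - {i}. A x $ j $ p j)))
    = det_deriv (A x) (A' u)" for u
  proof -
    have "A' u $ i $ p i * (\<Prod>j\<in>UNIV - {i}. A x $ j $ p j) =
        (\<Prod>j\<in>UNIV. (\<chi> j. if j = i then A' u $ i else A x $ j) $ j $ p j)" for i and p :: "'n \<Rightarrow> 'n"
      by (subst prod.remove[of UNIV i]) (auto intro!: prod.cong)
    then have "det_deriv (A x) (A' u) = (\<Sum>i\<in>UNIV. \<Sum>p\<in>?P. of_int (sign p) * (A' u $ i $ p i * (\<Prod>j\<in>UNIV - {i}. A x $ j $ p j)))"
      by (simp add: det_deriv_def det_def)
    then show ?thesis by (subst (asm) sum.swap) (simp add: sum_distrib_left)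
  qed
  ultimately show ?thesis by (simp add: det_def)
qed

text \<open>Linearity is inherited from \<open>det_deriv A\<close> being the derivative of
  \<open>det\<close> at A.\<close>

lemma det_deriv_add: "det_deriv A (B + C) = det_deriv A B + det_deriv A C"
  and det_deriv_scaleR: "det_deriv A (r *\<^sub>R B) = r * det_deriv A B"
proof -
  have "((\<lambda>X. X $ i $ j) has_derivative (\<lambda>U. U $ i $ j)) (at A)" for i j
    by (intro bounded_linear_imp_has_derivative bounded_linear_compose[OF bounded_linear_vec_nth] bounded_linear_vec_nth)
  then have "((\<lambda>X. det X) has_derivative (\<lambda>U. det_deriv A U)) (at A)" by (rule has_derivative_det)
  then have "linear (det_deriv A)" by (rule has_derivative_linear)
  then show "det_deriv A (B + C) = det_deriv A B + det_deriv A C" "det_deriv A (r *\<^sub>R B) = r * det_deriv A B"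
    by (simp_all add: linear_add linear_scale)
qed

text \<open>\<open>det\<close> is unchanged by transposition, and derivatives are unique.\<close>

lemma det_deriv_transpose: "det_deriv (transpose A) (transpose B) = det_deriv A B"
proof -
  have 1: "((\<lambda>X. X $ i $ j) has_derivative (\<lambda>U. U $ i $ j)) (at A)" for i j
    by (intro bounded_linear_imp_has_derivative bounded_linear_compose[OF bounded_linear_vec_nth] bounded_linear_vec_nth)
  have "((\<lambda>X. det X) has_derivative (\<lambda>U. det_deriv A U)) (at A)"
    by (rule has_derivative_det[OF 1])
  moreover have "((\<lambda>X. det (transpose X)) has_derivative (\<lambda>U. det_deriv (transpose A) (transpose U))) (at A)"
    by (rule has_derivative_det) (simp add: transpose_def 1)
  ultimately show ?thesis
    using has_derivative_unique[of det "det_deriv A" A] by (simp add: det_transpose fun_eq_iff)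
qed

text \<open>Euler's relation for the homogeneous polynomial \<open>det\<close>; this is where the
  dimension enters the variation formula.\<close>

lemma det_deriv_self: "det_deriv A A = real CARD('n) * det (A :: real^'n^'n)"
proof -
  have "(\<chi> j. if j = i then A $ i else A $ j) = A" for i by (simp add: vec_eq_iff)
  then show ?thesis by (simp add: det_deriv_def)
qed

text \<open>Row i of the product is a combination of rows of A. In the i-th determinant every row
  other than the i-th produces a repeated row, so only the diagonal entry of N survives, and the sum
  is the trace.\<close>

lemma det_deriv_mult_left: "det_deriv A (N ** A) = (\<Sum>i\<in>UNIV. N $ i $ i) * det (A :: real^'n^'n)"
proof -
  have "det (\<chi> j. if j = i then (N ** A) $ i else A $ j) = N $ i $ i * det A" for i
  proof -
    have "(N ** A) $ i = (\<Sum>l\<in>UNIV. N $ i $ l *s A $ l)"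
      by (simp add: matrix_matrix_mult_def vec_eq_iff)
    then have "det (\<chi> j. if j = i then (N ** A) $ i else A $ j) =
        det (\<chi> j. if j = i then sum ((\<lambda>j l. N $ i $ l *s A $ l) j) UNIV else A $ j)" by (simp cong: if_cong)
    also have "\<dots> = (\<Sum>l\<in>UNIV. det (\<chi> j. if j = i then (\<lambda>j l. N $ i $ l *s A $ l) j l else A $ j))"
      by (rule det_linear_row_sum[OF finite])
    also have "\<dots> = (\<Sum>l\<in>UNIV. N $ i $ l * det (\<chi> j. if j = i then A $ l else A $ j))"
      using det_row_mul[of i _ "\<lambda>j. A $ l" for l] by simp
    also have "\<dots> = (\<Sum>l\<in>UNIV. if l = i then N $ i $ i * det A else 0)"
    proof (intro sum.cong refl)
      fix l
      show "N $ i $ l * det (\<chi> j. if j = i then A $ l else A $ j) = (if l = i then N $ i $ i * det A else 0)"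
      proof (cases "l = i")
        case True
        have "(\<chi> j. if j = i then A $ i else A $ j) = A" by (simp add: vec_eq_iff)
        then show ?thesis unfolding True by simp
      next
        case False
        then have "det (\<chi> j. if j = i then A $ l else A $ j) = 0"
          by (intro det_identical_rows[of l i]) (auto simp: row_def vec_eq_iff)
        with False show ?thesis by simp
      qed
    qed
    finally show ?thesis by simp
  qed
  then show ?thesis by (simp add: det_deriv_def sum_distrib_right)
qed

lemma det_deriv_mult_right: "det_deriv A (A ** transpose N) = (\<Sum>i\<in>UNIV. N $ i $ i) * det (A :: real^'n^'n)"
  using det_deriv_transpose[of A "A ** transpose N"] det_deriv_mult_left[of "transpose A" N]
  by (simp add: matrix_transpose_mul)


section \<open>Densities of two-forms\<close>

definition form_matrix :: "('f::euclidean_space \<Rightarrow> 'f \<Rightarrow> real) \<Rightarrow> real^('f bidx)^('f bidx)" where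
  "form_matrix \<omega> = (\<chi> i j. \<omega> (bvec i) (bvec j))"

lemma form_matrix_nth [simp]: "form_matrix \<omega> $ i $ j = \<omega> (bvec i) (bvec j)"
  by (simp add: form_matrix_def)

lemma det_eq_0_ker: "det (A :: real^'n^'n) = 0 \<longleftrightarrow> (\<exists>x. x \<noteq> 0 \<and> A *v x = 0)"
  using invertible_det_nz[of A] matrix_left_invertible_ker[of A] invertible_left_inverse[of A] by blast

text \<open>For antisymmetric \<open>\<omega>\<close> this is the absolute value of the Pfaffian,
  that is, the top power of \<open>\<omega>\<close> up to sign and a constant. Dropping the sign
  makes it a density, which can be integrated without an orientation.\<close>

definition vol_density :: "('f::euclidean_space \<Rightarrow> 'f \<Rightarrow> real) \<Rightarrow> real" where
  "vol_density \<omega> = sqrt \<bar>det (form_matrix \<omega>)\<bar>"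

lemma bilinear_expand:
  fixes \<omega> :: "'f::euclidean_space \<Rightarrow> 'f \<Rightarrow> real"
  assumes "bilinear \<omega>"
  shows "\<omega> u v = (\<Sum>k\<in>UNIV. \<Sum>l\<in>UNIV. (u \<bullet> bvec k) * (v \<bullet> bvec l) * \<omega> (bvec k) (bvec l))"
proof -
  have l1: "linear (\<lambda>u. \<omega> u v)" and l2: "linear (\<omega> u)" for u v
    using assms unfolding bilinear_def by auto
  have "\<omega> u v = (\<Sum>k\<in>UNIV. (u \<bullet> bvec k) * \<omega> (bvec k) v)"
    by (subst (1) bvec_expand[of u, symmetric]) (simp add: linear_sum[OF l1] linear_scale[OF l1])
  also have "\<dots> = (\<Sum>k\<in>UNIV. (u \<bullet> bvec k) * (\<Sum>l\<in>UNIV. (v \<bullet> bvec l) * \<omega> (bvec k) (bvec l)))"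
    by (subst (1) bvec_expand[of v, symmetric]) (simp add: linear_sum[OF l2] linear_scale[OF l2])
  finally show ?thesis by (simp add: sum_distrib_left mult.assoc)
qed

text \<open>The matrix changes by congruence, so its determinant gains the square of that of T; the
  square root leaves the factor by which densities transform.\<close>

lemma density_pull:
  fixes \<omega> :: "'f::euclidean_space \<Rightarrow> 'f \<Rightarrow> real"
  assumes "bilinear \<omega>"
  shows "vol_density (\<lambda>u v. \<omega> (T u) (T v)) = \<bar>det (lin_matrix T)\<bar> * vol_density \<omega>"
proof -
  have "form_matrix (\<lambda>u v. \<omega> (T u) (T v)) = transpose (lin_matrix T) ** form_matrix \<omega> ** lin_matrix T"
  proof -
    have "\<omega> (T (bvec i)) (T (bvec j)) = (\<Sum>l\<in>UNIV. (\<Sum>k\<in>UNIV. (T (bvec i) \<bullet> bvec k) * \<omega> (bvec k) (bvec l)) * (T (bvec j) \<bullet> bvec l))" for i j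
      unfolding bilinear_expand[OF assms, of "T (bvec i)" "T (bvec j)"]
      by (subst sum.swap) (simp add: sum_distrib_right sum_distrib_left mult_ac)
    then show ?thesis
      by (simp add: form_matrix_def lin_matrix_def matrix_matrix_mult_def transpose_def vec_eq_iff)
  qed
  then have "det (form_matrix (\<lambda>u v. \<omega> (T u) (T v))) = (det (lin_matrix T))\<^sup>2 * det (form_matrix \<omega>)"
    by (simp add: det_mul power2_eq_square)
  then show ?thesis by (simp add: vol_density_def abs_mult real_sqrt_mult)
qed

text \<open>A kernel vector of the transposed matrix would pair to zero with every vector.\<close>

lemma nondegenerate_det:
  fixes \<omega> :: "'f::euclidean_space \<Rightarrow> 'f \<Rightarrow> real"
  assumes b: "bilinear \<omega>" and nd: "\<And>u. u \<noteq> 0 \<Longrightarrow> \<exists>v. \<omega> u v \<noteq> 0"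
  shows "det (form_matrix \<omega>) \<noteq> 0"
proof
  assume "det (form_matrix \<omega>) = 0"
  then have "det (transpose (form_matrix \<omega>)) = 0" by simp
  then obtain v where v: "v \<noteq> 0" "transpose (form_matrix \<omega>) *v v = 0"
    using det_eq_0_ker by blast
  have "\<omega> (of_vec v) w = 0" for w
  proof -
    have "\<omega> (of_vec v) w = (\<Sum>l\<in>UNIV. (w \<bullet> bvec l) * (\<Sum>k\<in>UNIV. v $ k * \<omega> (bvec k) (bvec l)))"
      unfolding bilinear_expand[OF b, of "of_vec v" w]
      by (subst sum.swap) (simp add: sum_distrib_left mult_ac)
    also have "\<dots> = 0"
    proof (intro sum.neutral ballI)
      fix l
      have "(transpose (form_matrix \<omega>) *v v) $ l = 0" using v by simp
      then have "(\<Sum>k\<in>UNIV. v $ k * \<omega> (bvec k) (bvec l)) = 0"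
        by (simp add: matrix_vector_mult_def transpose_def form_matrix_def mult.commute)
      then show "(w \<bullet> bvec l) * (\<Sum>k\<in>UNIV. v $ k * \<omega> (bvec k) (bvec l)) = 0" by simp
    qed
    finally show ?thesis .
  qed
  moreover have "of_vec v \<noteq> 0" using v(1) by (metis to_vec_of_vec linear_0 linear_to_vec)
  ultimately show False using nd by blast
qed

text \<open>Written with \<open>inverse x\<close> the derivative has one formula for both signs, and
  it contains the function itself as a factor; this drives the induction for higher
  differentiability.\<close>

lemma has_real_derivative_sqrt_abs:
  assumes "x \<noteq> 0" shows "((\<lambda>x. sqrt \<bar>x\<bar>) has_real_derivative sqrt \<bar>x\<bar> * inverse x / 2) (at x)"
proof (cases "x > 0")
  case True
  have "(sqrt has_real_derivative sqrt \<bar>x\<bar> * inverse x / 2) (at x)"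
  proof -
    have "sqrt x * sqrt x = x" using True by simp
    then have "inverse (sqrt x) / 2 = sqrt \<bar>x\<bar> * inverse x / 2" using True by (simp add: divide_simps)
    then show ?thesis using DERIV_real_sqrt[OF True] by simp
  qed
  then show ?thesis
    by (rule has_field_derivative_transform_within_open[of _ _ _ "{0<..}"]) (use True in auto)
next
  case False
  then have neg: "x < 0" using assms by simp
  have "((\<lambda>x. sqrt (- x)) has_real_derivative (inverse (sqrt (- x)) / 2) * (-1)) (at x)"
    using neg by (intro DERIV_chain2[OF DERIV_real_sqrt]) (auto intro!: derivative_eq_intros)
  also have "(inverse (sqrt (- x)) / 2) * (-1) = sqrt \<bar>x\<bar> * inverse x / 2"
  proof -
    have "sqrt (- x) * sqrt (- x) = - x" using neg by simp
    then show ?thesis using neg by (simp add: divide_simps)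
  qed
  finally show ?thesis
    by (rule has_field_derivative_transform_within_open[of _ _ _ "{..<0}"]) (use neg in auto)
qed

lemma differentiable_upto_sqrt_abs: "differentiable_upto {x. x \<noteq> 0} (\<lambda>x::real. sqrt \<bar>x\<bar>) n"
proof (induction n)
  case 0
  then show ?case by (auto intro!: continuous_intros)
next
  case (Suc n)
  have o: "open {x::real. x \<noteq> 0}" by (simp add: open_Collect_neq)
  have d: "differentiable_upto {x. x \<noteq> 0} (\<lambda>x. sqrt \<bar>x\<bar> * inverse x * (v / 2)) n" for v :: real
    by (intro differentiable_upto_mult[OF o] differentiable_upto_const differentiable_upto_inverse Suc)
  show ?case
  proof (rule differentiable_upto_SucI[OF o, where f' = "\<lambda>x v. sqrt \<bar>x\<bar> * inverse x * (v / 2)"])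
    show "((\<lambda>x. sqrt \<bar>x\<bar>) has_derivative (\<lambda>v. sqrt \<bar>x\<bar> * inverse x * (v / 2))) (at x)" if "x \<in> {x. x \<noteq> 0}" for x
      using that
      by (intro has_derivative_eq_rhs[OF has_real_derivative_sqrt_abs[unfolded has_field_derivative_def]]) auto
  qed (rule d)
qed

lemma density_differentiable_upto:
  fixes \<omega> :: "'s::real_normed_vector \<Rightarrow> 'f::euclidean_space \<Rightarrow> 'f \<Rightarrow> real"
  assumes S: "open S" and \<omega>: "\<And>u v. differentiable_upto S (\<lambda>x. \<omega> x u v) n"
    and det: "\<And>x. x \<in> S \<Longrightarrow> det (form_matrix (\<omega> x)) \<noteq> 0"
  shows "differentiable_upto S (\<lambda>x. vol_density (\<omega> x)) n"
  unfolding vol_density_def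
  by (rule differentiable_upto_compose[OF S _ _ det_differentiable_upto[OF S] differentiable_upto_sqrt_abs])
     (auto simp: det \<omega> open_Collect_neq)

lemma density_has_derivative:
  assumes A: "\<And>u v. ((\<lambda>x. \<omega> x u v) has_derivative (\<lambda>w. \<omega>' w u v)) (at x)"
    and det: "det (form_matrix (\<omega> x)) \<noteq> 0"
  shows "((\<lambda>x. vol_density (\<omega> x)) has_derivative
    (\<lambda>w. vol_density (\<omega> x) * inverse (det (form_matrix (\<omega> x))) / 2 * det_deriv (form_matrix (\<omega> x)) (form_matrix (\<omega>' w)))) (at x)"
proof -
  have "((\<lambda>x. det (form_matrix (\<omega> x))) has_derivative (\<lambda>w. det_deriv (form_matrix (\<omega> x)) (form_matrix (\<omega>' w)))) (at x)"
    by (rule has_derivative_det) (simp add: form_matrix_def A)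
  from diff_chain_at[OF this has_real_derivative_sqrt_abs[OF det, unfolded has_field_derivative_def]]
  show ?thesis by (simp add: o_def vol_density_def)
qed

text \<open>Cramer's rule for the equation \<open>\<omega> Z v = \<beta> v\<close> in \<open>Z\<close>.\<close>

definition dual_field :: "('f::euclidean_space \<Rightarrow> 'f \<Rightarrow> real) \<Rightarrow> ('f \<Rightarrow> real) \<Rightarrow> 'f" where
  "dual_field \<omega> \<beta> = of_vec (\<chi> k. det (\<chi> i j. if j = k then \<beta> (bvec i) else \<omega> (bvec j) (bvec i)) * inverse (det (form_matrix \<omega>)))"

text \<open>In this form, on basis vectors, the defining equation of the field is an identity
  between real functions that \<open>density_variation\<close> can differentiate.\<close>

lemma dual_field_bvec:
  assumes det: "det (form_matrix \<omega>) \<noteq> 0"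
  shows "(\<Sum>k\<in>UNIV. (dual_field \<omega> \<beta> \<bullet> bvec k) * \<omega> (bvec k) (bvec j)) = \<beta> (bvec j)"
proof -
  let ?A = "transpose (form_matrix \<omega>)"
  let ?b = "\<chi> i. \<beta> (bvec i)"
  have "to_vec (dual_field \<omega> \<beta>) = (\<chi> k. det (\<chi> i j. if j = k then ?b $ i else ?A $ i $ j) / det ?A)"
    unfolding dual_field_def to_vec_of_vec det_transpose
    by (simp add: transpose_def divide_inverse cong: if_cong)
  then have "?A *v to_vec (dual_field \<omega> \<beta>) = ?b"
    using det by (subst cramer) auto
  then have "(?A *v to_vec (dual_field \<omega> \<beta>)) $ j = ?b $ j" by simp
  then show ?thesis
    by (simp add: matrix_vector_mult_def transpose_def form_matrix_def to_vec_def mult.commute)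
qed

lemma dual_field:
  assumes det: "det (form_matrix \<omega>) \<noteq> 0" and \<omega>: "bilinear \<omega>" and \<beta>: "linear \<beta>"
  shows "\<omega> (dual_field \<omega> \<beta>) v = \<beta> v"
proof -
  have "\<omega> (dual_field \<omega> \<beta>) v = (\<Sum>l\<in>UNIV. (v \<bullet> bvec l) * (\<Sum>k\<in>UNIV. (dual_field \<omega> \<beta> \<bullet> bvec k) * \<omega> (bvec k) (bvec l)))"
    unfolding bilinear_expand[OF \<omega>, of "dual_field \<omega> \<beta>" v]
    by (subst sum.swap) (simp add: sum_distrib_left mult_ac)
  also have "\<dots> = (\<Sum>l\<in>UNIV. (v \<bullet> bvec l) * \<beta> (bvec l))" unfolding dual_field_bvec[OF det] ..
  also have "\<dots> = \<beta> v"
    by (subst (2) bvec_expand[of v, symmetric]) (simp add: linear_sum[OF \<beta>] linear_scale[OF \<beta>])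
  finally show ?thesis .
qed

lemma dual_field_unique:
  assumes det: "det (form_matrix \<omega>) \<noteq> 0" and \<omega>: "bilinear \<omega>" and z: "\<And>v. \<omega> z v = \<omega> z' v"
  shows "z = z'"
proof -
  have "transpose (form_matrix \<omega>) *v to_vec (z - z') = 0"
  proof -
    have l: "linear (\<lambda>u. \<omega> u v)" for v using \<omega> unfolding bilinear_def by auto
    have "(\<Sum>k\<in>UNIV. ((z - z') \<bullet> bvec k) * \<omega> (bvec k) v) = \<omega> (z - z') v" for v
      by (subst (2) bvec_expand[of "z - z'", symmetric]) (simp add: linear_sum[OF l] linear_scale[OF l])
    then have "(\<Sum>k\<in>UNIV. ((z - z') \<bullet> bvec k) * \<omega> (bvec k) v) = 0" for v
      using z by (simp add: linear_diff[OF l])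
    then show ?thesis
      by (simp add: matrix_vector_mult_def transpose_def form_matrix_def to_vec_def mult.commute vec_eq_iff)
  qed
  then have "to_vec (z - z') = 0"
    using det det_eq_0_ker[of "transpose (form_matrix \<omega>)"] by auto
  then have "z - z' = 0" by (metis linear_0 linear_of_vec of_vec_to_vec)
  then show ?thesis by simp
qed

text \<open>By Cramer's rule each component is a polynomial in the coefficients of
  \<open>\<omega>\<close> and \<open>\<beta>\<close>, divided by a determinant without
  zeros.\<close>

lemma dual_field_differentiable_upto:
  fixes \<omega> :: "'s::real_normed_vector \<Rightarrow> 'f::euclidean_space \<Rightarrow> 'f \<Rightarrow> real"
  assumes S: "open S" and \<omega>: "\<And>u v. differentiable_upto S (\<lambda>x. \<omega> x u v) n"
    and \<beta>: "\<And>v. differentiable_upto S (\<lambda>x. \<beta> x v) n"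
    and det: "\<And>x. x \<in> S \<Longrightarrow> det (form_matrix (\<omega> x)) \<noteq> 0"
  shows "differentiable_upto S (\<lambda>x. dual_field (\<omega> x) (\<beta> x) \<bullet> bvec k) n"
proof -
  have "differentiable_upto S (\<lambda>x. det (\<chi> i j. if j = k then \<beta> x (bvec i) else \<omega> x (bvec j) (bvec i))) n"
  proof (rule det_differentiable_upto[OF S])
    show "differentiable_upto S (\<lambda>x. (\<chi> i j. if j = k then \<beta> x (bvec i) else \<omega> x (bvec j) (bvec i)) $ i $ j) n" for i j
      by (cases "j = k") (simp_all add: \<omega> \<beta>)
  qed
  moreover have "differentiable_upto S (\<lambda>x. inverse (det (form_matrix (\<omega> x)))) n"
    by (rule differentiable_upto_compose[OF S _ _ det_differentiable_upto[OF S] differentiable_upto_inverse])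
       (auto simp: det \<omega> open_Collect_neq)
  ultimately show ?thesis
    unfolding dual_field_def by (simp add: differentiable_upto_mult[OF S])
qed

text \<open>In the family of forms \<open>\<omega>\<close> on the slices \<open>{t} \<times> 'f\<close>, the Lie derivative of \<open>\<omega>\<close> along the
  field \<open>Z\<close> dual to \<open>\<beta>\<close> is \<open>d\<beta>\<close>, since \<open>\<omega>\<close> is closed on the slices; hence the density changes by
  the divergence of \<open>vol_density \<omega> * Z\<close>.\<close>

lemma density_variation:
  fixes \<omega> :: "real \<times> 'f::euclidean_space \<Rightarrow> 'f \<Rightarrow> 'f \<Rightarrow> real" and \<beta> :: "real \<times> 'f \<Rightarrow> 'f \<Rightarrow> real"
  assumes S: "open S" and z: "z \<in> S"
    and \<omega>: "\<And>u v. differentiable_upto S (\<lambda>z. \<omega> z u v) (Suc n)"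
    and \<beta>: "\<And>v. differentiable_upto S (\<lambda>z. \<beta> z v) (Suc n)"
    and anti: "\<And>z u v. z \<in> S \<Longrightarrow> \<omega> z u v = - \<omega> z v u"
    and det: "\<And>z. z \<in> S \<Longrightarrow> det (form_matrix (\<omega> z)) \<noteq> 0"
  defines "\<omega>' \<equiv> \<lambda>w u v. frechet_derivative (\<lambda>z. \<omega> z u v) (at z) w"
    and "\<beta>' \<equiv> \<lambda>w v. frechet_derivative (\<lambda>z. \<beta> z v) (at z) w"
    and "Z \<equiv> \<lambda>z. dual_field (\<omega> z) (\<beta> z)"
  assumes closed: "\<And>u v w. \<omega>' (0, u) v w - \<omega>' (0, v) u w + \<omega>' (0, w) u v = 0"
    and var: "\<And>u v. \<omega>' (1, 0) u v = a * \<omega> z u v + \<beta>' (0, u) v - \<beta>' (0, v) u"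
  shows "frechet_derivative (\<lambda>z. vol_density (\<omega> z)) (at z) (1, 0) =
    real DIM('f) / 2 * a * vol_density (\<omega> z) +
    (\<Sum>k\<in>UNIV. frechet_derivative (\<lambda>z. vol_density (\<omega> z) * (Z z \<bullet> bvec k)) (at z) (0, bvec k))"
proof -
  define A where "A = form_matrix (\<omega> z)"
  \<comment> \<open>The Jacobian matrix of Z along the slice: row i holds the derivatives in
    direction \<open>bvec i\<close>.\<close>
  define N where "N = (\<chi> i l. frechet_derivative (\<lambda>z. Z z \<bullet> bvec l) (at z) (0, bvec i))"
  have d\<omega>: "((\<lambda>z. \<omega> z u v) has_derivative (\<lambda>w. \<omega>' w u v)) (at z)" for u v
    unfolding \<omega>'_def by (rule differentiable_upto_has_derivative[OF \<omega> z])
  have dZ: "((\<lambda>z. Z z \<bullet> bvec k) has_derivative frechet_derivative (\<lambda>z. Z z \<bullet> bvec k) (at z)) (at z)" for k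
    unfolding Z_def by (rule differentiable_upto_has_derivative[OF dual_field_differentiable_upto[OF S \<omega> \<beta> det] z])
  have anti': "\<omega>' w u v = - \<omega>' w v u" for w u v
  proof -
    have "((\<lambda>z. \<omega> z u v) has_derivative (\<lambda>w. - \<omega>' w v u)) (at z)"
      by (rule has_derivative_transform_within_open[OF has_derivative_minus[OF d\<omega>] S z]) (rule anti[symmetric])
    from has_derivative_unique[OF d\<omega> this] show ?thesis by metis
  qed
  \<comment> \<open>Obtained by differentiating the equation that defines Z, not the Cramer formula
    for Z.\<close>
  have d\<beta>: "\<beta>' (0, bvec i) (bvec j) = (\<Sum>l\<in>UNIV. N $ i $ l * \<omega> z (bvec l) (bvec j) + (Z z \<bullet> bvec l) * \<omega>' (0, bvec i) (bvec l) (bvec j))" for i j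
  proof -
    have "((\<lambda>z. \<Sum>l\<in>UNIV. (Z z \<bullet> bvec l) * \<omega> z (bvec l) (bvec j)) has_derivative
      (\<lambda>w. \<Sum>l\<in>UNIV. (Z z \<bullet> bvec l) * \<omega>' w (bvec l) (bvec j) + frechet_derivative (\<lambda>z. Z z \<bullet> bvec l) (at z) w * \<omega> z (bvec l) (bvec j))) (at z)"
      by (intro has_derivative_sum has_derivative_mult dZ d\<omega>)
    then have "((\<lambda>z. \<beta> z (bvec j)) has_derivative
      (\<lambda>w. \<Sum>l\<in>UNIV. (Z z \<bullet> bvec l) * \<omega>' w (bvec l) (bvec j) + frechet_derivative (\<lambda>z. Z z \<bullet> bvec l) (at z) w * \<omega> z (bvec l) (bvec j))) (at z)"
      by (rule has_derivative_transform_within_open[OF _ S z]) (simp add: Z_def dual_field_bvec[OF det])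
    from fun_cong[OF frechet_derivative_at[OF this], of "(0, bvec i)"] show ?thesis
      unfolding \<beta>'_def N_def by (simp add: add.commute)
  qed
  \<comment> \<open>The last three summands are the Lie derivative of \<open>\<omega>\<close> along
    Z in matrix form: the derivative of the coefficients, and one Jacobian term for each of the two
    arguments.\<close>
  have "form_matrix (\<omega>' (1, 0)) = a *\<^sub>R A + form_matrix (\<lambda>u v. \<Sum>l\<in>UNIV. (Z z \<bullet> bvec l) * \<omega>' (0, bvec l) u v) + N ** A + A ** transpose N"
    (is "_ = ?R")
  proof -
    have "form_matrix (\<omega>' (1, 0)) $ i $ j = ?R $ i $ j" for i j
    proof -
      \<comment> \<open>Closedness on the slice trades the two derivatives that come from d\<beta>
        for a single derivative of \<open>\<omega>\<close> in direction l, as in Cartan's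
        formula.\<close>
      have c: "\<omega>' (0, bvec i) (bvec l) (bvec j) - \<omega>' (0, bvec j) (bvec l) (bvec i) = \<omega>' (0, bvec l) (bvec i) (bvec j)" for l
        using closed[of "bvec l" "bvec i" "bvec j"] anti'[of "(0, bvec i)" "bvec j" "bvec l"] by linarith
      have "\<omega>' (1, 0) (bvec i) (bvec j) = a * \<omega> z (bvec i) (bvec j)
         + ((\<Sum>l\<in>UNIV. N $ i $ l * \<omega> z (bvec l) (bvec j)) + (\<Sum>l\<in>UNIV. (Z z \<bullet> bvec l) * \<omega>' (0, bvec i) (bvec l) (bvec j)))
         - ((\<Sum>l\<in>UNIV. N $ j $ l * \<omega> z (bvec l) (bvec i)) + (\<Sum>l\<in>UNIV. (Z z \<bullet> bvec l) * \<omega>' (0, bvec j) (bvec l) (bvec i)))"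
        unfolding var d\<beta> sum.distrib by simp
      also have "\<dots> = a * \<omega> z (bvec i) (bvec j)
         + (\<Sum>l\<in>UNIV. (Z z \<bullet> bvec l) * (\<omega>' (0, bvec i) (bvec l) (bvec j) - \<omega>' (0, bvec j) (bvec l) (bvec i)))
         + (\<Sum>l\<in>UNIV. N $ i $ l * \<omega> z (bvec l) (bvec j)) + (\<Sum>l\<in>UNIV. - \<omega> z (bvec l) (bvec i) * N $ j $ l)"
        by (simp add: sum_subtractf right_diff_distrib sum_negf mult.commute)
      also have "(\<Sum>l\<in>UNIV. - \<omega> z (bvec l) (bvec i) * N $ j $ l) = (\<Sum>l\<in>UNIV. \<omega> z (bvec i) (bvec l) * N $ j $ l)"
      proof (intro sum.cong refl)
        show "- \<omega> z (bvec l) (bvec i) * N $ j $ l = \<omega> z (bvec i) (bvec l) * N $ j $ l" for l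
          using anti[OF z, of "bvec i" "bvec l"] by simp
      qed
      finally show ?thesis unfolding c
        by (simp add: A_def form_matrix_def matrix_matrix_mult_def transpose_def)
    qed
    then show ?thesis by (simp add: vec_eq_iff)
  qed
  moreover have "det_deriv A (form_matrix (\<lambda>u v. \<Sum>l\<in>I. r l * \<omega>' (0, bvec l) u v)) =
      (\<Sum>l\<in>I. r l * det_deriv A (form_matrix (\<omega>' (0, bvec l))))" if "finite I" for I r
    using that
  proof (induction I)
    case empty
    have "det_deriv A (0 *\<^sub>R 0) = 0" by (simp only: det_deriv_scaleR mult_zero_left)
    then show ?case by (simp add: form_matrix_def zero_vec_def[symmetric])
  next
    case (insert l I)
    have "form_matrix (\<lambda>u v. \<Sum>l\<in>insert l I. r l * \<omega>' (0, bvec l) u v) =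
      r l *\<^sub>R form_matrix (\<omega>' (0, bvec l)) + form_matrix (\<lambda>u v. \<Sum>l\<in>I. r l * \<omega>' (0, bvec l) u v)"
      using insert by (simp add: form_matrix_def vec_eq_iff)
    then show ?case using insert by (simp add: det_deriv_add det_deriv_scaleR)
  qed
  \<comment> \<open>Both Jacobian terms contribute the trace of N. The resulting factor 2 cancels
    the 1/2 of the square root, while the term with \<open>a\<close> keeps it; hence n/2 in front of
    \<open>a\<close> and a full divergence of Z.\<close>
  ultimately have dd: "det_deriv A (form_matrix (\<omega>' (1, 0))) = a * (real DIM('f) * det A)
     + (\<Sum>l\<in>UNIV. (Z z \<bullet> bvec l) * det_deriv A (form_matrix (\<omega>' (0, bvec l)))) + 2 * ((\<Sum>i\<in>UNIV. N $ i $ i) * det A)"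
    by (simp add: det_deriv_add det_deriv_scaleR det_deriv_self det_deriv_mult_left det_deriv_mult_right card_bidx)
  let ?\<rho> = "vol_density (\<omega> z)"
  note d\<rho> = density_has_derivative[of \<omega>, OF d\<omega> det[OF z]]
  have \<rho>': "frechet_derivative (\<lambda>z. vol_density (\<omega> z)) (at z) w = ?\<rho> * inverse (det A) / 2 * det_deriv A (form_matrix (\<omega>' w))" for w
    using fun_cong[OF frechet_derivative_at[OF d\<rho>], of w] by (simp add: A_def)
  have div: "frechet_derivative (\<lambda>z. vol_density (\<omega> z) * (Z z \<bullet> bvec k)) (at z) (0, bvec k) =
     ?\<rho> * N $ k $ k + ?\<rho> * inverse (det A) / 2 * det_deriv A (form_matrix (\<omega>' (0, bvec k))) * (Z z \<bullet> bvec k)" for k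
    using fun_cong[OF frechet_derivative_at[OF has_derivative_mult[OF d\<rho> dZ]], of k "(0, bvec k)"]
    by (simp add: A_def N_def)
  have "det A \<noteq> 0" using det[OF z] by (simp add: A_def)
  then have "?\<rho> * inverse (det A) / 2 * det_deriv A (form_matrix (\<omega>' (1, 0))) =
    real DIM('f) / 2 * a * ?\<rho> + ?\<rho> * (\<Sum>i\<in>UNIV. N $ i $ i)
     + ?\<rho> * inverse (det A) / 2 * (\<Sum>l\<in>UNIV. (Z z \<bullet> bvec l) * det_deriv A (form_matrix (\<omega>' (0, bvec l))))"
    unfolding dd by (simp add: field_simps)
  then show ?thesis
    unfolding \<rho>' div sum.distrib by (simp add: sum_distrib_left mult_ac)
qed


section \<open>Integration over parametrized manifolds\<close>

text \<open>S and the complement of K are open and cover the space, and the extension is continuous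
  on each.\<close>

lemma continuous_on_extend_zero:
  fixes S :: "'f::euclidean_space set" and g :: "'f \<Rightarrow> real"
  assumes "open S" "compact K" "K \<subseteq> S" "continuous_on S g" "\<And>x. x \<in> S - K \<Longrightarrow> g x = 0"
  shows "continuous_on UNIV (\<lambda>x. if x \<in> S then g x else 0)"
proof -
  have "continuous_on S (\<lambda>x. if x \<in> S then g x else 0)"
    using assms(4) by (rule continuous_on_eq) auto
  moreover have "continuous_on (- K) (\<lambda>x. if x \<in> S then g x else 0)"
    using continuous_on_const[of "- K" 0] by (rule continuous_on_eq) (use assms(5) in auto)
  ultimately have "continuous_on (S \<union> - K) (\<lambda>x. if x \<in> S then g x else 0)"
    using assms(1) compact_imp_closed[OF assms(2)] by (intro continuous_on_open_Un) (simp_all add: open_Compl)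
  moreover have "S \<union> - K = UNIV" using assms(3) by auto
  ultimately show ?thesis by simp
qed

lemma absolutely_integrable_compact_support:
  fixes g :: "'f::euclidean_space \<Rightarrow> real"
  assumes "open S" "compact K" "K \<subseteq> S" "continuous_on S g" "\<And>x. x \<in> S - K \<Longrightarrow> g x = 0"
  shows "g absolutely_integrable_on S"
proof -
  let ?g = "\<lambda>x. if x \<in> S then g x else 0"
  obtain a b where ab: "K \<subseteq> cbox a b"
    using compact_imp_bounded[OF assms(2)] bounded_subset_cbox_symmetric by metis
  have "?g absolutely_integrable_on cbox a b"
    using continuous_on_extend_zero[OF assms] by (intro absolutely_integrable_continuous) (auto intro: continuous_on_subset)
  then have "(\<lambda>x. if x \<in> cbox a b then ?g x else 0) absolutely_integrable_on UNIV"
    by (simp only: absolutely_integrable_restrict_UNIV)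
  moreover have "(\<lambda>x. if x \<in> cbox a b then ?g x else 0) = ?g" using ab assms(5) by (auto simp: fun_eq_iff)
  ultimately show ?thesis by (simp only: absolutely_integrable_restrict_UNIV)
qed

lemma integral_subset_zero:
  fixes f :: "'f::euclidean_space \<Rightarrow> real"
  assumes "S \<subseteq> T" "\<And>x. x \<in> T - S \<Longrightarrow> f x = 0"
  shows "integral S f = integral T f"
proof -
  have "integral T f = integral T (\<lambda>x. if x \<in> S then f x else 0)"
    using assms(2) by (intro integral_cong) auto
  also have "\<dots> = integral (S \<inter> T) f"
    by (rule Henstock_Kurzweil_Integration.integral_restrict_Int)
  finally show ?thesis using assms(1) by (simp add: inf.absorb1)
qed

lemma absolutely_integrable_eq:
  fixes f :: "'f::euclidean_space \<Rightarrow> real"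
  assumes "f absolutely_integrable_on S" "\<And>x. x \<in> S \<Longrightarrow> g x = f x"
  shows "g absolutely_integrable_on S"
  using assms by (intro absolutely_integrable_spike[OF assms(1) negligible_empty]) auto

text \<open>The parametrizations \<open>q\<close>, defined on \<open>S\<close>, are inverses of charts of \<open>X\<close>.\<close>

locale param_density =
  fixes P :: "('f::euclidean_space set \<times> ('f \<Rightarrow> 'a)) set" and X :: "'a set" and \<rho> :: "('f \<Rightarrow> 'a) \<Rightarrow> 'f \<Rightarrow> real"
  assumes P_open: "(S, q) \<in> P \<Longrightarrow> open S"
    and P_inj: "(S, q) \<in> P \<Longrightarrow> inj_on q S"
    and P_into: "(S, q) \<in> P \<Longrightarrow> q ` S \<subseteq> X"
    and P_density: "(S, q) \<in> P \<Longrightarrow> continuous_on S (\<rho> q)"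
    and P_transition: "(S, q) \<in> P \<Longrightarrow> (S', q') \<in> P \<Longrightarrow> open (S \<inter> q -` (q' ` S')) \<and>
      (\<exists>\<tau> \<tau>'. \<forall>x\<in>S \<inter> q -` (q' ` S'). \<tau> x \<in> S' \<and> q' (\<tau> x) = q x \<and> (\<tau> has_derivative \<tau>' x) (at x) \<and>
         \<rho> q x = \<bar>det (lin_matrix (\<tau>' x))\<bar> * \<rho> q' (\<tau> x))"
begin

text \<open>As h vanishes off both images, both integrals live on the overlap, where the change of
  variables formula and the transformation rule of \<open>\<rho>\<close> identify them.\<close>

lemma integral_change_param:
  assumes q: "(S, q) \<in> P" and q': "(S', q') \<in> P"
    and h: "\<And>p. p \<in> X \<Longrightarrow> p \<notin> q ` S \<Longrightarrow> h p = 0" "\<And>p. p \<in> X \<Longrightarrow> p \<notin> q' ` S' \<Longrightarrow> h p = 0"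
    and int: "(\<lambda>x. h (q x) * \<rho> q x) absolutely_integrable_on S"
  shows "integral S' (\<lambda>x. h (q' x) * \<rho> q' x) = integral S (\<lambda>x. h (q x) * \<rho> q x)"
proof -
  let ?R = "S \<inter> q -` (q' ` S')"
  obtain \<tau> \<tau>' where R: "open ?R" and \<tau>: "\<And>x. x \<in> ?R \<Longrightarrow> \<tau> x \<in> S'" "\<And>x. x \<in> ?R \<Longrightarrow> q' (\<tau> x) = q x"
    "\<And>x. x \<in> ?R \<Longrightarrow> (\<tau> has_derivative \<tau>' x) (at x)"
    "\<And>x. x \<in> ?R \<Longrightarrow> \<rho> q x = \<bar>det (lin_matrix (\<tau>' x))\<bar> * \<rho> q' (\<tau> x)"
    using P_transition[OF q q'] by metis
  have inj: "inj_on \<tau> ?R"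
    using \<tau>(2) P_inj[OF q] by (intro inj_onI) (metis IntD1 inj_onD)
  have img: "\<tau> ` ?R = S' \<inter> q' -` (q ` S)"
  proof
    show "\<tau> ` ?R \<subseteq> S' \<inter> q' -` (q ` S)" using \<tau>(1,2) by auto
    show "S' \<inter> q' -` (q ` S) \<subseteq> \<tau> ` ?R"
    proof
      fix y assume y: "y \<in> S' \<inter> q' -` (q ` S)"
      then obtain x where x: "x \<in> S" "q x = q' y" by auto
      then have xR: "x \<in> ?R" using y by auto
      then have "\<tau> x = y" using \<tau>(1,2)[OF xR] x y P_inj[OF q'] by (metis IntD1 inj_onD)
      then show "y \<in> \<tau> ` ?R" using xR by blast
    qed
  qed
  let ?f = "\<lambda>x. h (q x) * \<rho> q x" and ?f' = "\<lambda>x. h (q' x) * \<rho> q' x"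
  have z: "?f x = 0" if "x \<in> S - ?R" for x
    using that h(2)[of "q x"] P_into[OF q] by auto
  have z': "?f' x = 0" if "x \<in> S' - \<tau> ` ?R" for x
    using that h(1)[of "q' x"] P_into[OF q'] unfolding img by auto
  have eq: "\<bar>det (lin_matrix (\<tau>' x))\<bar> * ?f' (\<tau> x) = ?f x" if "x \<in> ?R" for x
    using \<tau>(2,4)[OF that] by (simp add: mult_ac)
  have "?f absolutely_integrable_on ?R"
    using int by (rule set_integrable_subset) (use R in auto)
  then have "(\<lambda>x. \<bar>det (lin_matrix (\<tau>' x))\<bar> * ?f' (\<tau> x)) absolutely_integrable_on ?R"
    using eq by (rule absolutely_integrable_eq)
  moreover have "integral ?R (\<lambda>x. \<bar>det (lin_matrix (\<tau>' x))\<bar> * ?f' (\<tau> x)) = integral ?R ?f"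
    by (intro integral_cong eq)
  ultimately have "integral (\<tau> ` ?R) ?f' = integral ?R ?f"
    using euclidean_change_of_variables[OF R \<tau>(3) inj, of ?f' "integral ?R ?f"] by blast
  moreover have "integral ?R ?f = integral S ?f"
    using z by (intro integral_subset_zero) auto
  moreover have "integral (\<tau> ` ?R) ?f' = integral S' ?f'"
    using \<tau>(1) z' by (intro integral_subset_zero) auto
  ultimately show ?thesis by simp
qed


section \<open>Partitions of unity and the total integral\<close>

definition cont_fun :: "('a \<Rightarrow> real) \<Rightarrow> bool" where
  "cont_fun h \<longleftrightarrow> (\<forall>(S, q)\<in>P. continuous_on S (h \<circ> q))"

text \<open>Vanishing off the image of q is what \<open>integral_change_param\<close> asks for; the
  compact set, which lives in the coordinates of q, gives integrability.\<close>

definition supported_in :: "'f set \<Rightarrow> ('f \<Rightarrow> 'a) \<Rightarrow> ('a \<Rightarrow> real) \<Rightarrow> bool" where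
  "supported_in S q h \<longleftrightarrow> (\<forall>p\<in>X. p \<notin> q ` S \<longrightarrow> h p = 0) \<and>
     (\<exists>K. compact K \<and> K \<subseteq> S \<and> (\<forall>x\<in>S - K. h (q x) = 0))"

definition partition_of_unity :: "'i set \<Rightarrow> ('i \<Rightarrow> 'f set) \<Rightarrow> ('i \<Rightarrow> 'f \<Rightarrow> 'a) \<Rightarrow> ('i \<Rightarrow> 'a \<Rightarrow> real) \<Rightarrow> bool" where
  "partition_of_unity I S q \<phi> \<longleftrightarrow> finite I \<and> (\<forall>p\<in>X. (\<Sum>i\<in>I. \<phi> i p) = 1) \<and>
     (\<forall>i\<in>I. (S i, q i) \<in> P \<and> cont_fun (\<phi> i) \<and> supported_in (S i) (q i) (\<phi> i) \<and> (\<forall>p\<in>X. \<phi> i p \<ge> 0))"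

definition total :: "'i set \<Rightarrow> ('i \<Rightarrow> 'f set) \<Rightarrow> ('i \<Rightarrow> 'f \<Rightarrow> 'a) \<Rightarrow> ('i \<Rightarrow> 'a \<Rightarrow> real) \<Rightarrow> real" where
  "total I S q \<phi> = (\<Sum>i\<in>I. integral (S i) (\<lambda>x. \<phi> i (q i x) * \<rho> (q i) x))"

lemma supported_in_mult: "supported_in S q h \<Longrightarrow> supported_in S q (\<lambda>p. h p * k p)"
  unfolding supported_in_def by (metis mult_zero_left)

lemma cont_fun_mult: "cont_fun h \<Longrightarrow> cont_fun k \<Longrightarrow> cont_fun (\<lambda>p. h p * k p)"
  unfolding cont_fun_def o_def by (auto intro!: continuous_on_mult)

lemma supported_integrable:
  assumes q: "(S, q) \<in> P" and h: "cont_fun h" "supported_in S q h"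
  shows "(\<lambda>x. h (q x) * \<rho> q x) absolutely_integrable_on S"
proof -
  obtain K where K: "compact K" "K \<subseteq> S" "\<And>x. x \<in> S - K \<Longrightarrow> h (q x) = 0"
    using h(2) unfolding supported_in_def by blast
  have "continuous_on S (h \<circ> q)" using h(1) q unfolding cont_fun_def by auto
  then have "continuous_on S (\<lambda>x. h (q x) * \<rho> q x)"
    using P_density[OF q] by (auto intro: continuous_on_mult simp: o_def)
  then show ?thesis
    using K by (intro absolutely_integrable_compact_support[OF P_open[OF q] K(1)]) auto
qed

text \<open>The sum of the \<open>\<phi> i\<close>, which is 1, is inserted under the integral. Each
  summand vanishes off both images and can therefore be integrated in the parametrization
  \<open>r i\<close> instead.\<close>

lemma integral_partition:
  assumes q: "(S, q) \<in> P" and h: "cont_fun h" "supported_in S q h" and pou: "partition_of_unity I T r \<phi>"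
  shows "integral S (\<lambda>x. h (q x) * \<rho> q x) = (\<Sum>i\<in>I. integral (T i) (\<lambda>x. \<phi> i (r i x) * h (r i x) * \<rho> (r i) x))"
proof -
  have I: "finite I" using pou by (simp add: partition_of_unity_def)
  have i: "(T i, r i) \<in> P" "cont_fun (\<phi> i)" "supported_in (T i) (r i) (\<phi> i)" if "i \<in> I" for i
    using pou that by (auto simp: partition_of_unity_def)
  have int: "(\<lambda>x. (h (q x) * \<phi> i (q x)) * \<rho> q x) absolutely_integrable_on S" if "i \<in> I" for i
    using supported_integrable[OF q cont_fun_mult[OF h(1) i(2)[OF that]] supported_in_mult[OF h(2)]] .
  have "integral S (\<lambda>x. h (q x) * \<rho> q x) = integral S (\<lambda>x. \<Sum>i\<in>I. (h (q x) * \<phi> i (q x)) * \<rho> q x)"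
  proof (intro integral_cong)
    fix x assume "x \<in> S"
    then have "(\<Sum>i\<in>I. \<phi> i (q x)) = 1" using pou P_into[OF q] by (auto simp: partition_of_unity_def)
    then show "h (q x) * \<rho> q x = (\<Sum>i\<in>I. (h (q x) * \<phi> i (q x)) * \<rho> q x)"
      by (simp add: sum_distrib_right[symmetric] sum_distrib_left[symmetric])
  qed
  also have "\<dots> = (\<Sum>i\<in>I. integral S (\<lambda>x. (h (q x) * \<phi> i (q x)) * \<rho> q x))"
    using int I by (intro integral_sum) (auto dest: set_lebesgue_integral_eq_integral(1))
  also have "\<dots> = (\<Sum>i\<in>I. integral (T i) (\<lambda>x. (h (r i x) * \<phi> i (r i x)) * \<rho> (r i) x))"
  proof (intro sum.cong refl)
    fix i assume "i \<in> I"
    note i = i[OF this] int[OF this]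
    show "integral S (\<lambda>x. (h (q x) * \<phi> i (q x)) * \<rho> q x) = integral (T i) (\<lambda>x. (h (r i x) * \<phi> i (r i x)) * \<rho> (r i) x)"
      using integral_change_param[OF q i(1), where h = "\<lambda>p. h p * \<phi> i p"] i h(2)
      unfolding supported_in_def by auto
  qed
  finally show ?thesis by (simp add: mult.commute)
qed

text \<open>Both totals equal the double sum over the products of the two partitions.\<close>

lemma total_unique:
  assumes 1: "partition_of_unity I S q \<phi>" and 2: "partition_of_unity J T r \<xi>"
  shows "total I S q \<phi> = total J T r \<xi>"
proof -
  have i: "(S i, q i) \<in> P" "cont_fun (\<phi> i)" "supported_in (S i) (q i) (\<phi> i)" if "i \<in> I" for i
    using 1 that by (auto simp: partition_of_unity_def)
  have j: "(T j, r j) \<in> P" "cont_fun (\<xi> j)" "supported_in (T j) (r j) (\<xi> j)" if "j \<in> J" for j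
    using 2 that by (auto simp: partition_of_unity_def)
  have "total I S q \<phi> = (\<Sum>i\<in>I. \<Sum>j\<in>J. integral (T j) (\<lambda>x. \<xi> j (r j x) * \<phi> i (r j x) * \<rho> (r j) x))"
    unfolding total_def by (intro sum.cong refl integral_partition[OF i 2])
  also have "\<dots> = (\<Sum>i\<in>I. \<Sum>j\<in>J. integral (S i) (\<lambda>x. \<phi> i (q i x) * \<xi> j (q i x) * \<rho> (q i) x))"
  proof (intro sum.cong refl)
    fix i j assume "i \<in> I" "j \<in> J"
    note ij = i[OF this(1)] j[OF this(2)]
    have "integral (T j) (\<lambda>x. \<phi> i (r j x) * \<xi> j (r j x) * \<rho> (r j) x) = integral (S i) (\<lambda>x. \<phi> i (q i x) * \<xi> j (q i x) * \<rho> (q i) x)"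
      using integral_change_param[OF ij(1,4), where h = "\<lambda>p. \<phi> i p * \<xi> j p"] ij
         supported_integrable[OF ij(1) cont_fun_mult[OF ij(2,5)] supported_in_mult[OF ij(3)]]
      unfolding supported_in_def by auto
    then show "integral (T j) (\<lambda>x. \<xi> j (r j x) * \<phi> i (r j x) * \<rho> (r j) x) = integral (S i) (\<lambda>x. \<phi> i (q i x) * \<xi> j (q i x) * \<rho> (q i) x)"
      by (simp add: mult.commute[of "\<xi> j _"])
  qed
  also have "\<dots> = (\<Sum>j\<in>J. \<Sum>i\<in>I. integral (S i) (\<lambda>x. \<phi> i (q i x) * \<xi> j (q i x) * \<rho> (q i) x))"
    by (rule sum.swap)
  also have "\<dots> = total J T r \<xi>"
    unfolding total_def by (intro sum.cong refl integral_partition[OF j 1, symmetric])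
  finally show ?thesis .
qed

text \<open>By the compatibility of \<open>\<zeta>\<close> introduced below the choice of the parametrization is irrelevant.\<close>

definition field_deriv :: "(('f \<Rightarrow> 'a) \<Rightarrow> 'f \<Rightarrow> 'f) \<Rightarrow> ('a \<Rightarrow> real) \<Rightarrow> 'a \<Rightarrow> real" where
  "field_deriv \<zeta> h p = (let (S, q, x) = SOME (S, q, x). (S, q) \<in> P \<and> x \<in> S \<and> q x = p
     in frechet_derivative (h \<circ> q) (at x) (\<zeta> q x))"

definition C1_fun :: "('a \<Rightarrow> real) \<Rightarrow> bool" where
  "C1_fun h \<longleftrightarrow> (\<forall>(S, q)\<in>P. differentiable_upto S (h \<circ> q) 1)"

text \<open>The \<open>\<zeta> q\<close> are the coordinate expressions of a single continuous
  vector field on X: wherever two parametrizations meet, the differential of a transition map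
  carries one expression to the other.\<close>

definition compatible_field :: "(('f \<Rightarrow> 'a) \<Rightarrow> 'f \<Rightarrow> 'f) \<Rightarrow> bool" where
  "compatible_field \<zeta> \<longleftrightarrow> (\<forall>(S, q)\<in>P. (\<forall>k. continuous_on S (\<lambda>x. \<zeta> q x \<bullet> bvec k)) \<and>
     (\<forall>(S', q')\<in>P. \<forall>x\<in>S. \<forall>y\<in>S'. q x = q' y \<longrightarrow>
       (\<exists>\<tau> \<tau>' U. open U \<and> x \<in> U \<and> U \<subseteq> S \<and> (\<forall>x\<in>U. \<tau> x \<in> S' \<and> q' (\<tau> x) = q x) \<and> (\<tau> has_derivative \<tau>') (at x) \<and>
         \<tau>' (\<zeta> q x) = \<zeta> q' y)))"

text \<open>Chain rule through the transition to the parametrization that the choice in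
  \<open>field_deriv\<close> happens to pick.\<close>

lemma field_deriv_param:
  assumes \<zeta>: "compatible_field \<zeta>" and h: "C1_fun h" and q: "(S, q) \<in> P" and x: "x \<in> S"
  shows "field_deriv \<zeta> h (q x) = frechet_derivative (h \<circ> q) (at x) (\<zeta> q x)"
proof -
  define s where "s = (SOME (S', q', x'). (S', q') \<in> P \<and> x' \<in> S' \<and> q' x' = q x)"
  obtain S' q' y where s: "s = (S', q', y)" by (cases s) auto
  have "case s of (S', q', x') \<Rightarrow> (S', q') \<in> P \<and> x' \<in> S' \<and> q' x' = q x"
    unfolding s_def by (rule someI[of _ "(S, q, x)"]) (use q x in auto)
  then have q': "(S', q') \<in> P" "y \<in> S'" "q' y = q x" using s by auto
  obtain \<tau> \<tau>' U where U: "open U" "x \<in> U" "U \<subseteq> S" "\<And>x. x \<in> U \<Longrightarrow> \<tau> x \<in> S'" "\<And>x. x \<in> U \<Longrightarrow> q' (\<tau> x) = q x"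
     and \<tau>: "(\<tau> has_derivative \<tau>') (at x)" "\<tau>' (\<zeta> q x) = \<zeta> q' y"
    using \<zeta> q q' x unfolding compatible_field_def by (smt (verit) case_prodD)
  have y: "\<tau> x = y" using U q' P_inj[OF q'(1)] by (metis inj_onD)
  have "((h \<circ> q') has_derivative frechet_derivative (h \<circ> q') (at y)) (at y)"
    using h q' unfolding C1_fun_def by (intro differentiable_upto_has_derivative[where n = 0]) auto
  from diff_chain_at[OF \<tau>(1) this[folded y]]
  have d: "((h \<circ> q' \<circ> \<tau>) has_derivative (frechet_derivative (h \<circ> q') (at y) \<circ> \<tau>')) (at x)" by (simp add: y o_def)
  have "frechet_derivative (h \<circ> q) (at x) = frechet_derivative (h \<circ> q' \<circ> \<tau>) (at x)"
    using U by (intro frechet_derivative_cong_open[OF U(1,2)]) auto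
  also have "\<dots> = frechet_derivative (h \<circ> q') (at y) \<circ> \<tau>'"
    using frechet_derivative_at[OF d] by simp
  finally show ?thesis
    unfolding field_deriv_def s_def[symmetric] s by (simp add: \<tau>(2))
qed

text \<open>Makes the derivative of a nonnegative partition function vanish wherever the function
  does, so that the derivative inherits its support.\<close>

lemma derivative_zero_at_minimum:
  assumes h: "C1_fun h" "\<And>p. p \<in> X \<Longrightarrow> h p \<ge> 0" and q: "(S, q) \<in> P" and x: "x \<in> S" "h (q x) = 0"
  shows "frechet_derivative (h \<circ> q) (at x) u = 0"
proof -
  have "((h \<circ> q) has_derivative frechet_derivative (h \<circ> q) (at x)) (at x)"
    using h q x unfolding C1_fun_def by (intro differentiable_upto_has_derivative[where n = 0]) auto
  moreover have "(h \<circ> q) x \<le> (h \<circ> q) y" if "y \<in> S" for y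
    using that h(2) P_into[OF q] x by auto
  ultimately show ?thesis
    using differential_zero_maxmin[OF x(1) P_open[OF q]] by metis
qed

text \<open>The derivative of the partition of unity along a field is the derivative of \<open>1\<close>.\<close>

lemma sum_integral_field_deriv:
  assumes pou: "partition_of_unity I S q \<phi>" and C1: "\<And>i. i \<in> I \<Longrightarrow> C1_fun (\<phi> i)" and \<zeta>: "compatible_field \<zeta>"
  shows "(\<Sum>i\<in>I. integral (S i) (\<lambda>x. frechet_derivative (\<phi> i \<circ> q i) (at x) (\<zeta> (q i) x) * \<rho> (q i) x)) = 0"
proof -
  let ?g = "\<lambda>i. field_deriv \<zeta> (\<phi> i)"
  have I: "finite I" using pou by (simp add: partition_of_unity_def)
  have i: "(S i, q i) \<in> P" "cont_fun (\<phi> i)" "supported_in (S i) (q i) (\<phi> i)" "\<And>p. p \<in> X \<Longrightarrow> \<phi> i p \<ge> 0" if "i \<in> I" for i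
    using pou that by (auto simp: partition_of_unity_def)
  have g: "?g i (r x) = frechet_derivative (\<phi> i \<circ> r) (at x) (\<zeta> r x)" if "i \<in> I" "(T, r) \<in> P" "x \<in> T" for i T r x
    using field_deriv_param[OF \<zeta> C1[OF that(1)] that(2,3)] .
  have cont: "cont_fun (?g i)" if "i \<in> I" for i
    unfolding cont_fun_def
  proof clarify
    fix T r assume r: "(T, r) \<in> P"
    have d: "differentiable_upto T (\<phi> i \<circ> r) 1" using C1[OF that] r unfolding C1_fun_def by auto
    have "continuous_on T (\<lambda>x. \<Sum>k\<in>UNIV. (\<zeta> r x \<bullet> bvec k) * frechet_derivative (\<phi> i \<circ> r) (at x) (bvec k))"
      using \<zeta> r d unfolding compatible_field_def by (intro continuous_on_sum continuous_on_mult) auto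
    moreover have "(\<Sum>k\<in>UNIV. (\<zeta> r x \<bullet> bvec k) * frechet_derivative (\<phi> i \<circ> r) (at x) (bvec k)) = (?g i \<circ> r) x" if "x \<in> T" for x
    proof -
      have l: "linear (frechet_derivative (\<phi> i \<circ> r) (at x))"
        using d that by (intro has_derivative_linear[OF differentiable_upto_has_derivative[where n = 0]]) auto
      have "frechet_derivative (\<phi> i \<circ> r) (at x) (\<zeta> r x) =
          frechet_derivative (\<phi> i \<circ> r) (at x) (\<Sum>k\<in>UNIV. (\<zeta> r x \<bullet> bvec k) *\<^sub>R bvec k)"
        by (simp only: bvec_expand)
      then show ?thesis
        using g[OF \<open>i \<in> I\<close> r that] linear_sum[OF l, of "\<lambda>k. (\<zeta> r x \<bullet> bvec k) *\<^sub>R bvec k" UNIV]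
        by (simp only: linear_scale[OF l] real_scaleR_def o_apply)
    qed
    ultimately show "continuous_on T (?g i \<circ> r)" by (rule continuous_on_eq)
  qed
  have cover: "\<exists>T r x. (T, r) \<in> P \<and> x \<in> T \<and> r x = p" if p: "p \<in> X" for p
  proof -
    have "(\<Sum>i\<in>I. \<phi> i p) \<noteq> 0" using pou p by (simp add: partition_of_unity_def)
    then obtain i where "i \<in> I" "\<phi> i p \<noteq> 0" by (meson sum.not_neutral_contains_not_neutral)
    then have "(S i, q i) \<in> P" "p \<in> q i ` S i" using i(1,3)[of i] p unfolding supported_in_def by blast+
    then show ?thesis by blast
  qed
  have z: "?g i p = 0" if "i \<in> I" "p \<in> X" "\<phi> i p = 0" for i p
  proof -
    obtain T r x where r: "(T, r) \<in> P" "x \<in> T" "r x = p" using cover[OF \<open>p \<in> X\<close>] by blast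
    then show ?thesis
      using g[OF that(1) r(1,2)] derivative_zero_at_minimum[OF C1[OF that(1)] i(4)[OF that(1)] r(1,2)] that by auto
  qed
  have supp: "supported_in (S i) (q i) (?g i)" if i0: "i \<in> I" for i
  proof -
    obtain K where K: "compact K" "K \<subseteq> S i" "\<And>x. x \<in> S i - K \<Longrightarrow> \<phi> i (q i x) = 0"
      and "\<And>p. p \<in> X \<Longrightarrow> p \<notin> q i ` S i \<Longrightarrow> \<phi> i p = 0"
      using i(3)[OF i0] unfolding supported_in_def by blast
    moreover have "q i x \<in> X" if "x \<in> S i" for x using P_into[OF i(1)[OF \<open>i \<in> I\<close>]] that by blast
    ultimately show ?thesis
      unfolding supported_in_def using z[OF i0] by (intro conjI exI[of _ K]) auto
  qed
  have sum0: "(\<Sum>i\<in>I. ?g i (q j x)) = 0" if j: "j \<in> I" and x: "x \<in> S j" for j x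
  proof -
    have d: "((\<phi> i \<circ> q j) has_derivative frechet_derivative (\<phi> i \<circ> q j) (at x)) (at x)" if "i \<in> I" for i
      using C1[OF that] i(1)[OF j] x unfolding C1_fun_def by (intro differentiable_upto_has_derivative[where n = 0]) auto
    have "((\<lambda>y. \<Sum>i\<in>I. (\<phi> i \<circ> q j) y) has_derivative (\<lambda>u. \<Sum>i\<in>I. frechet_derivative (\<phi> i \<circ> q j) (at x) u)) (at x)"
      by (intro has_derivative_sum d)
    moreover have "((\<lambda>y. \<Sum>i\<in>I. (\<phi> i \<circ> q j) y) has_derivative (\<lambda>u. 0)) (at x)"
    proof (rule has_derivative_transform_within_open[OF _ P_open[OF i(1)[OF j]] x])
      show "((\<lambda>y. 1) has_derivative (\<lambda>u. 0)) (at x)" by simp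
      show "1 = (\<Sum>i\<in>I. (\<phi> i \<circ> q j) y)" if "y \<in> S j" for y
        using pou P_into[OF i(1)[OF j]] that by (auto simp: partition_of_unity_def)
    qed
    ultimately have "(\<lambda>u. \<Sum>i\<in>I. frechet_derivative (\<phi> i \<circ> q j) (at x) u) = (\<lambda>u. 0)"
      by (rule has_derivative_unique)
    then show ?thesis using g[OF _ i(1)[OF j] x] by (simp add: fun_eq_iff)
  qed
  have "(\<Sum>i\<in>I. integral (S i) (\<lambda>x. frechet_derivative (\<phi> i \<circ> q i) (at x) (\<zeta> (q i) x) * \<rho> (q i) x)) =
    (\<Sum>i\<in>I. integral (S i) (\<lambda>x. ?g i (q i x) * \<rho> (q i) x))"
  proof (intro sum.cong integral_cong refl, goal_cases)
    case (1 i x)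
    then show ?case using g[OF 1(1) i(1)[OF 1(1)] 1(2)] by simp
  qed
  \<comment> \<open>A second copy of the partition, indexed by j, brings the derivatives of all
    \<open>\<phi> i\<close> to the same parametrization \<open>q j\<close>, where they can be added
    under one integral.\<close>
  also have "\<dots> = (\<Sum>i\<in>I. \<Sum>j\<in>I. integral (S j) (\<lambda>x. \<phi> j (q j x) * ?g i (q j x) * \<rho> (q j) x))"
    using i(1) cont supp by (intro sum.cong refl integral_partition[OF _ _ _ pou]) auto
  also have "\<dots> = (\<Sum>j\<in>I. \<Sum>i\<in>I. integral (S j) (\<lambda>x. \<phi> j (q j x) * ?g i (q j x) * \<rho> (q j) x))"
    by (rule sum.swap)
  also have "\<dots> = (\<Sum>j\<in>I. integral (S j) (\<lambda>x. \<Sum>i\<in>I. \<phi> j (q j x) * ?g i (q j x) * \<rho> (q j) x))"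
  proof (intro sum.cong refl integral_sum[symmetric] I)
    fix j i assume j: "j \<in> I" and i0: "i \<in> I"
    have "(\<lambda>x. (\<phi> j (q j x) * ?g i (q j x)) * \<rho> (q j) x) absolutely_integrable_on S j"
      by (rule supported_integrable[OF i(1)[OF j] cont_fun_mult[OF i(2)[OF j] cont[OF i0]] supported_in_mult[OF i(3)[OF j]]])
    then show "(\<lambda>x. \<phi> j (q j x) * ?g i (q j x) * \<rho> (q j) x) integrable_on S j"
      by (rule set_lebesgue_integral_eq_integral(1))
  qed
  also have "\<dots> = (\<Sum>j\<in>I. integral (S j) (\<lambda>x. 0))"
  proof (intro sum.cong refl integral_cong)
    fix j x assume "j \<in> I" "x \<in> S j"
    then have "\<phi> j (q j x) * (\<Sum>i\<in>I. ?g i (q j x)) * \<rho> (q j) x = 0" by (simp add: sum0)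
    then show "(\<Sum>i\<in>I. \<phi> j (q j x) * ?g i (q j x) * \<rho> (q j) x) = 0"
      by (simp add: sum_distrib_left sum_distrib_right)
  qed
  finally show ?thesis by simp
qed

end


section \<open>Variation of integrals of densities\<close>

lemma integral_translation_UNIV:
  fixes g :: "'f::euclidean_space \<Rightarrow> real"
  assumes "g absolutely_integrable_on UNIV"
  shows "integral UNIV (\<lambda>x. g (x + c)) = integral UNIV g"
proof -
  have "range (\<lambda>x::'f. x + c) = UNIV" by (simp add: surj_plus_right)
  moreover have "lin_matrix (\<lambda>u::'f. u) = mat 1"
    by (simp add: lin_matrix_def mat_def vec_eq_iff bvec_inner eq_commute)
  moreover have "((\<lambda>x. x + c) has_derivative (\<lambda>u. u)) (at x)" for x :: 'f
    by (auto intro!: derivative_eq_intros)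
  ultimately show ?thesis
    using euclidean_change_of_variables[of UNIV "\<lambda>x. x + c" "\<lambda>x u. u" g "integral UNIV g"] assms
    by (simp add: inj_on_def)
qed

lemma extend_zero_derivative:
  fixes g :: "'f::euclidean_space \<Rightarrow> real"
  assumes S: "open S" and K: "compact K" "K \<subseteq> S" and g: "differentiable_upto S g 1"
    and g0: "\<And>x. x \<in> S - K \<Longrightarrow> g x = 0"
  shows "((\<lambda>x. if x \<in> S then g x else 0) has_derivative
      (\<lambda>u. if x \<in> S then frechet_derivative g (at x) u else 0)) (at x)"
    and "x \<in> S - K \<Longrightarrow> frechet_derivative g (at x) u = 0"
proof -
  have oK: "open (S - K)" "open (- K)" using S K by (auto simp: open_Compl compact_imp_closed intro: open_Diff)
  have dg: "(g has_derivative frechet_derivative g (at x)) (at x)" if "x \<in> S" for x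
    using g that by (intro differentiable_upto_has_derivative[where n = 0]) auto
  show 0: "frechet_derivative g (at x) u = 0" if "x \<in> S - K" for x u
    using frechet_derivative_cong_open[OF oK(1) that g0] by simp
  show "((\<lambda>x. if x \<in> S then g x else 0) has_derivative
      (\<lambda>u. if x \<in> S then frechet_derivative g (at x) u else 0)) (at x)"
  proof (cases "x \<in> S")
    case True
    have "((\<lambda>x. if x \<in> S then g x else 0) has_derivative frechet_derivative g (at x)) (at x)"
      by (rule has_derivative_transform_within_open[OF dg[OF True] S True]) simp
    with True show ?thesis by simp
  next
    case False
    then have "x \<in> - K" using K by auto
    have "((\<lambda>x. if x \<in> S then g x else 0) has_derivative (\<lambda>u. 0)) (at x)"
      by (rule has_derivative_transform_within_open[OF has_derivative_const oK(2) \<open>x \<in> - K\<close>]) (use g0 in auto)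
    with False show ?thesis by simp
  qed
qed

text \<open>By translation invariance the integral of g(x + t b) does not depend on t.
  Differentiating under the integral at t = 0 gives the claim, without iterated integrals.\<close>

lemma integral_derivative_compact_support:
  fixes g :: "'f::euclidean_space \<Rightarrow> real"
  assumes S: "open S" and K: "compact K" "K \<subseteq> S" and g: "differentiable_upto S g 1"
    and g0: "\<And>x. x \<in> S - K \<Longrightarrow> g x = 0"
  shows "integral S (\<lambda>x. frechet_derivative g (at x) b) = 0"
proof -
  let ?g = "\<lambda>x. if x \<in> S then g x else 0"
  let ?g' = "\<lambda>x. if x \<in> S then frechet_derivative g (at x) b else 0"
  have cg: "continuous_on UNIV ?g"
    using g g0 by (intro continuous_on_extend_zero[OF S K] differentiable_upto_imp_continuous_on)
  have cg': "continuous_on UNIV ?g'"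
    using g extend_zero_derivative(2)[OF S K g g0] by (intro continuous_on_extend_zero[OF S K]) auto
  \<comment> \<open>One box is needed that contains the translates of K for all t between -1 and 1;
    over it the integral of each translate of g equals the integral over the whole space.\<close>
  have "bounded (\<Union>t\<in>{-1..1}. (\<lambda>x. x - t *\<^sub>R b) ` K)"
  proof -
    have "compact ((\<lambda>(t, x). x - t *\<^sub>R b) ` ({-1..1::real} \<times> K))"
      by (intro compact_continuous_image compact_Times K) (auto simp: split_beta intro!: continuous_intros)
    then have "bounded ((\<lambda>(t, x). x - t *\<^sub>R b) ` ({-1..1::real} \<times> K))" by (rule compact_imp_bounded)
    moreover have "(\<lambda>(t, x). x - t *\<^sub>R b) ` ({-1..1::real} \<times> K) = (\<Union>t\<in>{-1..1}. (\<lambda>x. x - t *\<^sub>R b) ` K)" by auto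
    ultimately show ?thesis by simp
  qed
  then obtain a0 where a0: "(\<Union>t\<in>{-1..1}. (\<lambda>x. x - t *\<^sub>R b) ` K) \<subseteq> cbox (- a0) a0"
    using bounded_subset_cbox_symmetric by blast
  have g0': "?g (x + t *\<^sub>R b) = 0" if "t \<in> {-1..1}" "x \<notin> cbox (- a0) a0" for x t
  proof -
    have "x + t *\<^sub>R b \<notin> K"
    proof
      assume "x + t *\<^sub>R b \<in> K"
      then have "x \<in> (\<lambda>x. x - t *\<^sub>R b) ` K" by (intro image_eqI[of _ _ "x + t *\<^sub>R b"]) auto
      then show False using that a0 by blast
    qed
    then show ?thesis using g0 by auto
  qed
  have "?g absolutely_integrable_on UNIV"
    using g g0 absolutely_integrable_restrict_UNIV
      absolutely_integrable_compact_support[OF S K differentiable_upto_imp_continuous_on[OF g] g0] by blast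
  then have UN: "integral UNIV (\<lambda>x. ?g (x + t *\<^sub>R b)) = integral UNIV ?g" for t
    by (rule integral_translation_UNIV)
  have F: "integral (cbox (- a0) a0) (\<lambda>x. ?g (x + t *\<^sub>R b)) = integral UNIV ?g" if "t \<in> {-1..1}" for t
  proof -
    have "integral (cbox (- a0) a0) (\<lambda>x. ?g (x + t *\<^sub>R b)) = integral UNIV (\<lambda>x. ?g (x + t *\<^sub>R b))"
      using g0'[OF that] by (intro integral_subset_zero) auto
    then show ?thesis using UN by simp
  qed
  have d: "((\<lambda>t. integral (cbox (- a0) a0) (\<lambda>x. ?g (x + t *\<^sub>R b))) has_vector_derivative
      integral (cbox (- a0) a0) (\<lambda>x. ?g' (x + 0 *\<^sub>R b))) (at 0 within {-1..1})"
  proof (rule leibniz_rule_vector_derivative[where fx = "\<lambda>t x. ?g' (x + t *\<^sub>R b)"])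
    fix t :: real and x :: 'f
    have "((\<lambda>t. x + t *\<^sub>R b) has_derivative (\<lambda>r. r *\<^sub>R b)) (at t)" by (auto intro!: derivative_eq_intros)
    from diff_chain_at[OF this extend_zero_derivative(1)[OF S K g g0]]
    have "((\<lambda>t. ?g (x + t *\<^sub>R b)) has_derivative
        (\<lambda>r. if x + t *\<^sub>R b \<in> S then frechet_derivative g (at (x + t *\<^sub>R b)) (r *\<^sub>R b) else 0)) (at t)"
      by (simp add: o_def)
    moreover have "linear (frechet_derivative g (at y))" if "y \<in> S" for y
      using g that by (intro has_derivative_linear[OF differentiable_upto_has_derivative[where n = 0]]) auto
    then have "(\<lambda>r. if x + t *\<^sub>R b \<in> S then frechet_derivative g (at (x + t *\<^sub>R b)) (r *\<^sub>R b) else 0) =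
        (\<lambda>r. r *\<^sub>R ?g' (x + t *\<^sub>R b))" by (auto simp: fun_eq_iff linear_scale)
    ultimately show "((\<lambda>t. ?g (x + t *\<^sub>R b)) has_vector_derivative ?g' (x + t *\<^sub>R b)) (at t within {-1..1})"
      unfolding has_vector_derivative_def by (metis (no_types, lifting) has_derivative_at_withinI)
  next
    fix t :: real
    show "(\<lambda>x. ?g (x + t *\<^sub>R b)) integrable_on cbox (- a0) a0"
      by (intro integrable_continuous continuous_on_compose2[OF cg]) (auto intro!: continuous_intros)
  next
    show "continuous_on ({-1..1} \<times> cbox (- a0) a0) (\<lambda>(t, x). ?g' (x + t *\<^sub>R b))"
      unfolding split_beta by (intro continuous_on_compose2[OF cg']) (auto intro!: continuous_intros)
  qed auto
  have "((\<lambda>t. integral (cbox (- a0) a0) (\<lambda>x. ?g (x + t *\<^sub>R b))) has_vector_derivative 0) (at 0 within {-1..1})"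
    by (rule has_vector_derivative_transform[OF _ _ has_vector_derivative_const[of "integral UNIV ?g"]]) (use F in auto)
  then have "integral (cbox (- a0) a0) (\<lambda>x. ?g' (x + 0 *\<^sub>R b)) = 0"
    using d unfolding box_real(2)[symmetric]
    by (intro vector_derivative_unique_within_closed_interval[where a = "-1" and b = 1 and x = 0]) simp_all
  moreover have "?g' x = 0" if "x \<notin> cbox (- a0) a0" for x
  proof -
    have "x \<notin> K" using a0 that by (auto simp: subset_iff intro!: bexI[of _ "0::real"])
    then show ?thesis using extend_zero_derivative(2)[OF S K g g0] by auto
  qed
  then have "integral (cbox (- a0) a0) ?g' = integral UNIV ?g'"
    by (intro integral_subset_zero) auto
  ultimately show ?thesis
    by (simp add: Henstock_Kurzweil_Integration.integral_restrict_UNIV cong: if_cong)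
qed

text \<open>The compact support of h allows a continuous extension by zero to a box independent of
  s, where the Leibniz rule applies.\<close>

lemma has_derivative_integral_compact_support:
  fixes \<rho> :: "real \<times> 'f::euclidean_space \<Rightarrow> real"
  assumes S: "open S" and K: "compact K" "K \<subseteq> S" and T: "open T" "convex T"
    and h: "continuous_on S h" "\<And>x. x \<in> S - K \<Longrightarrow> h x = 0"
    and \<rho>: "differentiable_upto (T \<times> S) \<rho> 1" and s: "s \<in> T"
  shows "((\<lambda>s. integral S (\<lambda>x. h x * \<rho> (s, x))) has_real_derivative
    integral S (\<lambda>x. h x * frechet_derivative \<rho> (at (s, x)) (1, 0))) (at s)"
proof -
  let ?f = "\<lambda>s x. if x \<in> S then h x * \<rho> (s, x) else 0"
  let ?f' = "\<lambda>s x. if x \<in> S then h x * frechet_derivative \<rho> (at (s, x)) (1, 0) else 0"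
  obtain a b where ab: "K \<subseteq> cbox a b"
    using compact_imp_bounded[OF K(1)] bounded_subset_cbox_symmetric by metis
  have box: "integral (cbox a b) (\<lambda>x. if x \<in> S then h x * k x else 0) = integral S (\<lambda>x. h x * k x)" for k
  proof -
    have "integral (cbox a b) (\<lambda>x. if x \<in> S then h x * k x else 0) = integral UNIV (\<lambda>x. if x \<in> S then h x * k x else 0)"
      using ab h(2) by (intro integral_subset_zero) auto
    then show ?thesis by (simp add: Henstock_Kurzweil_Integration.integral_restrict_UNIV)
  qed
  have c: "continuous_on (T \<times> UNIV) (\<lambda>(s, x). if x \<in> S then h x * k (s, x) else 0)"
    if k: "continuous_on (T \<times> S) k" for k :: "real \<times> 'f \<Rightarrow> real"
  proof -
    have "continuous_on (T \<times> S) (\<lambda>z. h (snd z) * k z)"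
      by (intro continuous_on_mult k continuous_on_compose2[OF h(1)]) (auto intro!: continuous_intros)
    then have "continuous_on (T \<times> S) (\<lambda>(s, x). if x \<in> S then h x * k (s, x) else 0)"
      by (rule continuous_on_eq) auto
    moreover have "continuous_on (T \<times> - K) (\<lambda>(s, x). if x \<in> S then h x * k (s, x) else 0)"
      using continuous_on_const[of "T \<times> - K" 0] by (rule continuous_on_eq) (use h(2) in auto)
    ultimately have "continuous_on (T \<times> S \<union> T \<times> - K) (\<lambda>(s, x). if x \<in> S then h x * k (s, x) else 0)"
      using S T compact_imp_closed[OF K(1)] by (intro continuous_on_open_Un open_Times) (auto simp: open_Compl)
    moreover have "T \<times> S \<union> T \<times> - K = T \<times> UNIV" using K(2) by auto
    ultimately show ?thesis by simp
  qed
  have "((\<lambda>s. integral (cbox a b) (?f s)) has_vector_derivative integral (cbox a b) (?f' s)) (at s within T)"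
  proof (rule leibniz_rule_vector_derivative[OF _ _ _ s T(2)])
    fix s x assume "s \<in> T"
    show "((\<lambda>s. ?f s x) has_vector_derivative ?f' s x) (at s within T)"
    proof (cases "x \<in> S")
      case True
      have "(\<rho> has_derivative frechet_derivative \<rho> (at (s, x))) (at (s, x))"
        using True \<open>s \<in> T\<close> by (intro differentiable_upto_has_derivative[OF \<rho>[unfolded One_nat_def]]) auto
      note d = this
      have l: "linear (frechet_derivative \<rho> (at (s, x)))" using d by (rule has_derivative_linear)
      have "((\<lambda>s. (s, x)) has_derivative (\<lambda>r. (r, 0))) (at s)" by (auto intro!: derivative_eq_intros)
      from diff_chain_at[OF this d] have "((\<lambda>s. \<rho> (s, x)) has_derivative (\<lambda>r. frechet_derivative \<rho> (at (s, x)) (r, 0))) (at s)"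
        by (simp add: o_def)
      then have "((\<lambda>s. h x * \<rho> (s, x)) has_derivative (\<lambda>r. h x * frechet_derivative \<rho> (at (s, x)) (r, 0))) (at s)"
        by (rule has_derivative_mult_right)
      moreover have e: "frechet_derivative \<rho> (at (s, x)) (r, 0) = r * frechet_derivative \<rho> (at (s, x)) (1, 0)" for r
        using linear_scale[OF l, of r "(1, 0)"] by simp
      have "(\<lambda>r. h x * frechet_derivative \<rho> (at (s, x)) (r, 0)) = (\<lambda>r. r *\<^sub>R (h x * frechet_derivative \<rho> (at (s, x)) (1, 0)))"
      proof (intro ext)
        show "h x * frechet_derivative \<rho> (at (s, x)) (r, 0) = r *\<^sub>R (h x * frechet_derivative \<rho> (at (s, x)) (1, 0))" for r
          using e[of r] by simp
      qed
      ultimately have "((\<lambda>s. h x * \<rho> (s, x)) has_vector_derivative h x * frechet_derivative \<rho> (at (s, x)) (1, 0)) (at s)"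
        unfolding has_vector_derivative_def by simp
      with True show ?thesis by (simp add: has_vector_derivative_at_within)
    qed auto
  next
    fix s assume s: "s \<in> T"
    have "continuous_on (cbox a b) (\<lambda>x. (\<lambda>(s, x). if x \<in> S then h x * \<rho> (s, x) else 0) (s, x))"
      using s by (intro continuous_on_compose2[OF c[OF differentiable_upto_imp_continuous_on[OF \<rho>]]]) (auto intro!: continuous_intros)
    then show "?f s integrable_on cbox a b" by (intro integrable_continuous) simp
  next
    have "continuous_on (T \<times> UNIV) (\<lambda>(s, x). ?f' s x)"
      using \<rho> by (intro c) auto
    then show "continuous_on (T \<times> cbox a b) (\<lambda>(s, x). ?f' s x)"
      by (rule continuous_on_subset) auto
  qed
  then show ?thesis
    unfolding box using at_within_open[OF s T(1)] by (simp add: has_real_derivative_iff_has_vector_derivative)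
qed

lemma slice_derivative:
  fixes f :: "real \<times> 'f::euclidean_space \<Rightarrow> real"
  assumes f: "differentiable_upto (T \<times> S) f (Suc n)" and T: "open T" and S: "open S" and s: "s \<in> T"
  shows "differentiable_upto S (\<lambda>x. f (s, x)) (Suc n)"
    and "x \<in> S \<Longrightarrow> frechet_derivative (\<lambda>x. f (s, x)) (at x) u = frechet_derivative f (at (s, x)) (0, u)"
proof -
  have L: "bounded_linear (\<lambda>x::'f. (0::real, x))" by (intro bounded_linear_intros)
  have eq: "(\<lambda>x. f ((s, 0) + (0, x))) = (\<lambda>x. f (s, x))" by simp
  show "differentiable_upto S (\<lambda>x. f (s, x)) (Suc n)"
    using differentiable_upto_affine[OF S open_Times[OF T S] L _ f, of "(s, 0)"] s unfolding eq by (auto simp del: differentiable_upto.simps)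
  assume x: "x \<in> S"
  have "(f has_derivative frechet_derivative f (at ((s, 0) + (0, x)))) (at ((s, 0) + (0, x)))"
    using s x by (intro differentiable_upto_has_derivative[OF f]) auto
  from frechet_derivative_at[OF frechet_derivative_affine[OF this L]]
  show "frechet_derivative (\<lambda>x. f (s, x)) (at x) u = frechet_derivative f (at (s, x)) (0, u)"
    unfolding eq by (simp add: fun_eq_iff)
qed

text \<open>The pointwise law \<open>density_variation\<close> multiplied by a cut-off h.
  Integration by parts moves the divergence onto h; the last integral is the error, which disappears
  only after summation over a partition of unity.\<close>

lemma localized_volume_variation:
  fixes \<omega> :: "real \<times> 'f::euclidean_space \<Rightarrow> 'f \<Rightarrow> 'f \<Rightarrow> real" and \<beta> :: "real \<times> 'f \<Rightarrow> 'f \<Rightarrow> real"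
  assumes S: "open S" and T: "open T" "convex T" and s: "s \<in> T"
    and \<omega>: "\<And>u v. differentiable_upto (T \<times> S) (\<lambda>z. \<omega> z u v) 1"
    and \<beta>: "\<And>v. differentiable_upto (T \<times> S) (\<lambda>z. \<beta> z v) 1"
    and anti: "\<And>z u v. z \<in> T \<times> S \<Longrightarrow> \<omega> z u v = - \<omega> z v u"
    and det: "\<And>z. z \<in> T \<times> S \<Longrightarrow> det (form_matrix (\<omega> z)) \<noteq> 0"
    and closed: "\<And>z u v w. z \<in> T \<times> S \<Longrightarrow> frechet_derivative (\<lambda>z. \<omega> z v w) (at z) (0, u)
        - frechet_derivative (\<lambda>z. \<omega> z u w) (at z) (0, v) + frechet_derivative (\<lambda>z. \<omega> z u v) (at z) (0, w) = 0"
    and var: "\<And>z u v. z \<in> T \<times> S \<Longrightarrow> frechet_derivative (\<lambda>z. \<omega> z u v) (at z) (1, 0) = a (fst z) * \<omega> z u v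
        + frechet_derivative (\<lambda>z. \<beta> z v) (at z) (0, u) - frechet_derivative (\<lambda>z. \<beta> z u) (at z) (0, v)"
    and h: "differentiable_upto S h 1" and K: "compact K" "K \<subseteq> S" "\<And>x. x \<in> S - K \<Longrightarrow> h x = 0"
  shows "((\<lambda>s. integral S (\<lambda>x. h x * vol_density (\<omega> (s, x)))) has_real_derivative
    real DIM('f) / 2 * a s * integral S (\<lambda>x. h x * vol_density (\<omega> (s, x)))
    - integral S (\<lambda>x. frechet_derivative h (at x) (dual_field (\<omega> (s, x)) (\<beta> (s, x))) * vol_density (\<omega> (s, x)))) (at s)"
proof -
  let ?\<rho> = "\<lambda>z. vol_density (\<omega> z)"
  let ?Z = "\<lambda>k z. dual_field (\<omega> z) (\<beta> z) \<bullet> bvec k"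
  let ?p = "\<lambda>k z. ?\<rho> z * ?Z k z"
  have TS: "open (T \<times> S)" using T S by (simp add: open_Times)
  have \<rho>1: "differentiable_upto (T \<times> S) ?\<rho> 1" by (intro density_differentiable_upto TS \<omega> det)
  have Z1: "differentiable_upto (T \<times> S) (?Z k) 1" for k by (intro dual_field_differentiable_upto TS \<omega> \<beta> det)
  have p1: "differentiable_upto (T \<times> S) (?p k) 1" for k by (intro differentiable_upto_mult TS \<rho>1 Z1)
  note slice = slice_derivative[where n = 0, unfolded One_nat_def[symmetric], OF _ T(1) S s]
  have dh: "(h has_derivative frechet_derivative h (at x)) (at x)" if "x \<in> S" for x
    using h that by (intro differentiable_upto_has_derivative[where n = 0]) auto
  have dp: "((\<lambda>x. ?p k (s, x)) has_derivative (\<lambda>u. frechet_derivative (?p k) (at (s, x)) (0, u))) (at x)" if "x \<in> S" for x k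
  proof -
    have "frechet_derivative (\<lambda>x. ?p k (s, x)) (at x) = (\<lambda>u. frechet_derivative (?p k) (at (s, x)) (0, u))"
      by (intro ext slice(2)[OF p1 that])
    then show ?thesis
      using differentiable_upto_has_derivative[OF slice(1)[OF p1, of k, unfolded One_nat_def] that] by simp
  qed
  let ?q = "\<lambda>k x. h x * ?p k (s, x)"
  have q1: "differentiable_upto S (?q k) 1" for k
    by (intro differentiable_upto_mult S h slice(1)[OF p1])
  have dq: "frechet_derivative (?q k) (at x) u = h x * frechet_derivative (?p k) (at (s, x)) (0, u) + frechet_derivative h (at x) u * ?p k (s, x)"
    if "x \<in> S" for x k u
    using frechet_derivative_at[OF has_derivative_mult[OF dh[OF that] dp[OF that]]] by (simp add: fun_eq_iff)
  have int: "(\<lambda>x. h x * k x) integrable_on S" if "continuous_on S k" for k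
    using K that differentiable_upto_imp_continuous_on[OF h]
    by (intro set_lebesgue_integral_eq_integral(1) absolutely_integrable_compact_support[OF S K(1,2)] continuous_on_mult) auto
  have int': "(\<lambda>x. frechet_derivative h (at x) u * k x) integrable_on S" if "continuous_on S k" for k u
    using that h extend_zero_derivative(2)[OF S K(1,2) h K(3)]
    by (intro set_lebesgue_integral_eq_integral(1) absolutely_integrable_compact_support[OF S K(1,2)] continuous_on_mult) auto
  have cp: "continuous_on S (\<lambda>x. ?p k (s, x))" for k
    by (rule differentiable_upto_imp_continuous_on[OF slice(1)[OF p1]])
  have c\<rho>: "continuous_on S (\<lambda>x. ?\<rho> (s, x))"
    by (rule differentiable_upto_imp_continuous_on[OF slice(1)[OF \<rho>1]])
  have cdp: "continuous_on S (\<lambda>x. frechet_derivative (?p k) (at (s, x)) (0, u))" for k u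
  proof -
    have "continuous_on (T \<times> S) (\<lambda>z. frechet_derivative (?p k) (at z) (0, u))" using p1[of k] by auto
    then show ?thesis by (rule continuous_on_compose2) (auto intro!: continuous_intros s)
  qed
  \<comment> \<open>Integration by parts: the derivative of the compactly supported product
    \<open>?q k\<close> integrates to zero.\<close>
  have q0: "integral S (\<lambda>x. h x * frechet_derivative (?p k) (at (s, x)) (0, bvec k)) =
      - integral S (\<lambda>x. frechet_derivative h (at x) (bvec k) * ?p k (s, x))" for k
  proof -
    have "0 = integral S (\<lambda>x. frechet_derivative (?q k) (at x) (bvec k))"
      using K by (intro integral_derivative_compact_support[OF S K(1,2) q1, symmetric]) auto
    also have "\<dots> = integral S (\<lambda>x. h x * frechet_derivative (?p k) (at (s, x)) (0, bvec k) + frechet_derivative h (at x) (bvec k) * ?p k (s, x))"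
      by (intro integral_cong dq)
    also have "\<dots> = integral S (\<lambda>x. h x * frechet_derivative (?p k) (at (s, x)) (0, bvec k)) + integral S (\<lambda>x. frechet_derivative h (at x) (bvec k) * ?p k (s, x))"
      by (intro Henstock_Kurzweil_Integration.integral_add int int' cp cdp)
    finally show ?thesis by simp
  qed
  have "integral S (\<lambda>x. h x * frechet_derivative ?\<rho> (at (s, x)) (1, 0)) =
    integral S (\<lambda>x. real DIM('f) / 2 * a s * (h x * ?\<rho> (s, x)) + (\<Sum>k\<in>UNIV. h x * frechet_derivative (?p k) (at (s, x)) (0, bvec k)))"
  proof (intro integral_cong)
    fix x assume "x \<in> S"
    then have z: "(s, x) \<in> T \<times> S" using s by simp
    have "frechet_derivative ?\<rho> (at (s, x)) (1, 0) = real DIM('f) / 2 * a s * ?\<rho> (s, x) +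
        (\<Sum>k\<in>UNIV. frechet_derivative (?p k) (at (s, x)) (0, bvec k))"
      using density_variation[OF TS z \<omega>[unfolded One_nat_def] \<beta>[unfolded One_nat_def] anti det closed[OF z] var[OF z, unfolded fst_conv]] .
    then show "h x * frechet_derivative ?\<rho> (at (s, x)) (1, 0) =
      real DIM('f) / 2 * a s * (h x * ?\<rho> (s, x)) + (\<Sum>k\<in>UNIV. h x * frechet_derivative (?p k) (at (s, x)) (0, bvec k))"
      by (simp add: algebra_simps sum_distrib_left)
  qed
  also have "\<dots> = real DIM('f) / 2 * a s * integral S (\<lambda>x. h x * ?\<rho> (s, x))
     + (\<Sum>k\<in>UNIV. integral S (\<lambda>x. h x * frechet_derivative (?p k) (at (s, x)) (0, bvec k)))"
  proof -
    have i1: "(\<lambda>x. real DIM('f) / 2 * a s * (h x * ?\<rho> (s, x))) integrable_on S"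
      by (rule integrable_on_mult_right[OF int[OF c\<rho>]])
    have i2: "(\<lambda>x. \<Sum>k\<in>UNIV. h x * frechet_derivative (?p k) (at (s, x)) (0, bvec k)) integrable_on S"
      by (intro integrable_sum int cdp) auto
    show ?thesis
      unfolding Henstock_Kurzweil_Integration.integral_add[OF i1 i2]
      by (subst integral_sum) (auto intro: int cdp)
  qed
  also have "(\<Sum>k\<in>UNIV. integral S (\<lambda>x. h x * frechet_derivative (?p k) (at (s, x)) (0, bvec k))) =
     - integral S (\<lambda>x. \<Sum>k\<in>UNIV. frechet_derivative h (at x) (bvec k) * ?p k (s, x))"
    unfolding q0 using int'[OF cp] by (subst integral_sum) (auto simp: sum_negf)
  also have "integral S (\<lambda>x. \<Sum>k\<in>UNIV. frechet_derivative h (at x) (bvec k) * ?p k (s, x)) =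
     integral S (\<lambda>x. frechet_derivative h (at x) (dual_field (\<omega> (s, x)) (\<beta> (s, x))) * ?\<rho> (s, x))"
  proof (intro integral_cong)
    fix x assume x: "x \<in> S"
    have l: "linear (frechet_derivative h (at x))" using dh[OF x] by (rule has_derivative_linear)
    let ?z = "dual_field (\<omega> (s, x)) (\<beta> (s, x))"
    have "frechet_derivative h (at x) ?z = frechet_derivative h (at x) (\<Sum>k\<in>UNIV. (?z \<bullet> bvec k) *\<^sub>R bvec k)"
      by (simp only: bvec_expand)
    also have "\<dots> = (\<Sum>k\<in>UNIV. (?z \<bullet> bvec k) * frechet_derivative h (at x) (bvec k))"
      unfolding linear_sum[OF l] linear_scale[OF l] by simp
    finally show "(\<Sum>k\<in>UNIV. frechet_derivative h (at x) (bvec k) * ?p k (s, x)) = frechet_derivative h (at x) ?z * ?\<rho> (s, x)"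
      by (simp add: sum_distrib_right sum_distrib_left mult_ac)
  qed
  finally show ?thesis
    using has_derivative_integral_compact_support[OF S K(1,2) T differentiable_upto_imp_continuous_on[OF h] K(3) \<rho>1 s] by simp
qed


section \<open>Maps between manifolds and products\<close>

lemma plot_subset:
  assumes M: "smooth_manifold M" and q: "plot M S q" and T: "open T" "T \<subseteq> S"
  shows "plot M T q"
  using plot_affine[OF M q T(1) bounded_linear_ident, of 0] T(2) by simp

lemma plot_cong:
  assumes M: "smooth_manifold M" and q: "plot M S q" and eq: "\<And>x. x \<in> S \<Longrightarrow> r x = q x"
  shows "plot M S r"
  unfolding plot_def
proof (intro conjI ballI)
  show "open S" using q by (rule plot_open)
  show "continuous_map (top_of_set S) (mtop M) r"
    using q eq unfolding plot_def by (auto intro: continuous_map_eq)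
  fix m assume m: "m \<in> atlas M"
  have o: "open (S \<inter> q -` fst m)"
    by (intro plot_open_preimage[OF q] is_chart_openin smooth_manifold_chart[OF M m])
  have s: "S \<inter> r -` fst m = S \<inter> q -` fst m" using eq by auto
  show "smooth_on (S \<inter> r -` fst m) (snd m \<circ> r)"
    unfolding smooth_on_def s
  proof
    fix n
    show "differentiable_upto (S \<inter> q -` fst m) (snd m \<circ> r) n"
      using smooth_on_imp[OF plot_smooth[OF q m]] eq
      by (subst differentiable_upto_cong[OF o, where g = "snd m \<circ> q"]) auto
  qed
qed

text \<open>Only the transitions into the atlas matter, so this covers the slice charts of the
  fibres, which need not belong to the atlas.\<close>

lemma plot_chart_inv:
  assumes M: "smooth_manifold M" and c: "is_chart (mtop M) c"
    and t: "\<And>m. m \<in> atlas M \<Longrightarrow> smooth_on (overlap c m) (transition c m)"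
  shows "plot M (chart_img c) (chart_inv c)"
  unfolding plot_def
proof (intro conjI ballI)
  show "open (chart_img c)" "continuous_map (top_of_set (chart_img c)) (mtop M) (chart_inv c)"
    using is_chart_open_img[OF c] is_chart_inv_continuous[OF c] by auto
  fix m assume m: "m \<in> atlas M"
  have "overlap c m = chart_img c \<inter> chart_inv c -` fst m"
    unfolding overlap_def is_chart_image_eq[OF c] by auto
  then show "smooth_on (chart_img c \<inter> chart_inv c -` fst m) (snd m \<circ> chart_inv c)"
    using t[OF m] by (simp add: transition_def)
qed

lemma plot_atlas_chart_inv:
  "smooth_manifold M \<Longrightarrow> c \<in> atlas M \<Longrightarrow> plot M (chart_img c) (chart_inv c)"
  by (intro plot_chart_inv smooth_manifold_chart smooth_manifold_transition)

lemma plot_differentiable_upto: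
  fixes M :: "('a, 'e::euclidean_space) mfd" and h :: "'a \<Rightarrow> real"
  assumes M: "smooth_manifold M" and q: "plot M S q"
    and h: "\<And>m. m \<in> atlas M \<Longrightarrow> differentiable_upto (chart_img m) (h \<circ> chart_inv m) n"
  shows "differentiable_upto S (h \<circ> q) n"
proof (rule differentiable_upto_local)
  fix x assume x: "x \<in> S"
  obtain m where m: "m \<in> atlas M" "q x \<in> fst m"
    using smooth_manifold_cover[OF M plot_mem[OF q x]] by blast
  have ch: "is_chart (mtop M) m" by (rule smooth_manifold_chart[OF M m(1)])
  let ?U = "S \<inter> q -` fst m"
  have U: "open ?U" by (intro plot_open_preimage[OF q] is_chart_openin ch)
  have "differentiable_upto ?U (\<lambda>x. (h \<circ> chart_inv m) ((snd m \<circ> q) x)) n"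
    by (rule differentiable_upto_compose[OF U is_chart_open_img[OF ch] _ smooth_on_imp[OF plot_smooth[OF q m(1)]] h[OF m(1)]])
       (auto simp: chart_img_def)
  moreover have "(h \<circ> q) x = (h \<circ> chart_inv m) ((snd m \<circ> q) x)" if "x \<in> ?U" for x
    using that by (simp add: is_chart_inv_left[OF ch])
  ultimately have "differentiable_upto ?U (h \<circ> q) n"
    by (subst differentiable_upto_cong[OF U, where g = "\<lambda>x. (h \<circ> chart_inv m) ((snd m \<circ> q) x)"]) auto
  then show "\<exists>U. open U \<and> x \<in> U \<and> differentiable_upto U (h \<circ> q) n"
    using U x m(2) by blast
qed

lemma plot_compose_derivative:
  assumes M: "smooth_manifold M" and q': "plot M S' q'" and m: "m \<in> atlas M"
    and f: "(f has_derivative f') (at x)" "f x \<in> S'" "q' (f x) \<in> fst m"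
    and N: "open N" "x \<in> N" "\<And>y. y \<in> N \<Longrightarrow> q y = q' (f y)"
  shows "frechet_derivative (snd m \<circ> q) (at x) u = frechet_derivative (snd m \<circ> q') (at (f x)) (f' u)"
proof -
  from diff_chain_at[OF f(1) plot_has_derivative[OF q' m f(2,3)]]
  have d: "((snd m \<circ> q' \<circ> f) has_derivative (frechet_derivative (snd m \<circ> q') (at (f x)) \<circ> f')) (at x)"
    by (simp add: o_def)
  have "frechet_derivative (snd m \<circ> q) (at x) = frechet_derivative (snd m \<circ> q' \<circ> f) (at x)"
    using N by (intro frechet_derivative_cong_open[OF N(1,2)]) auto
  then show ?thesis using frechet_derivative_at[OF d] by (metis o_apply)
qed

text \<open>Functoriality of the pullback at one point: q and the composite of q' with f have to
  agree only near x, and f has to be differentiable only at x.\<close>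

lemma pull2_compose:
  assumes M: "smooth_manifold M" and \<Omega>: "two_form M \<Omega>" and q: "plot M S q" "x \<in> S" and q': "plot M S' q'"
    and f: "(f has_derivative f') (at x)" "f x \<in> S'"
    and N: "open N" "x \<in> N" "\<And>y. y \<in> N \<Longrightarrow> q y = q' (f y)"
  shows "pull2 M \<Omega> q x u v = pull2 M \<Omega> q' (f x) (f' u) (f' v)"
proof -
  obtain m where m: "m \<in> atlas M" "q' (f x) \<in> fst m"
    using smooth_manifold_cover[OF M plot_mem[OF q' f(2)]] by blast
  have m': "q x \<in> fst m" using m(2) N(2,3) by simp
  have "frechet_derivative (snd m \<circ> q) (at x) w = frechet_derivative (snd m \<circ> q') (at (f x)) (f' w)" for w
    by (rule plot_compose_derivative[OF M q' m(1) f m(2) N])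
  then show ?thesis
    unfolding pull2_chart[OF M \<Omega> q(1) m(1) q(2) m'] pull2_chart[OF M \<Omega> q' m(1) f(2) m(2)]
    using N(2,3) by simp
qed

lemma pull2_bilinear:
  fixes M :: "('a, 'e::euclidean_space) mfd"
  assumes "smooth_manifold M" "two_form M \<Omega>" "plot M S q" "x \<in> S"
  shows "bilinear (pull2 M \<Omega> q x)"
proof -
  have l: "linear (pull2 M \<Omega> q x u)" for u using pull2_linear[OF assms] .
  have "linear (\<lambda>u. pull2 M \<Omega> q x u v)" for v
    using linear_compose_neg[OF l[of v]] pull2_antisym[OF assms] by (metis (no_types, lifting) ext)
  with l show ?thesis by (simp add: bilinear_def)
qed

section \<open>Open parts, products and trivializations in coordinates\<close>

lemma points_open_part [simp]: "points (open_part M U) = points M \<inter> U"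
  by (simp add: open_part_def)

lemma mtop_open_part [simp]: "mtop (open_part M U) = subtopology (mtop M) U"
  by (simp add: open_part_def)

lemma atlas_open_part [simp]: "atlas (open_part M U) = (\<lambda>c. (fst c \<inter> U, snd c)) ` atlas M"
  by (simp add: open_part_def)

lemma mtop_product_mfd [simp]: "mtop (product_mfd M N) = prod_topology (mtop M) (mtop N)"
  by (simp add: product_mfd_def)

lemma atlas_product_mfd:
  "atlas (product_mfd M N) = (\<lambda>(c, d). (fst c \<times> fst d, map_prod (snd c) (snd d))) ` (atlas M \<times> atlas N)"
  by (simp add: product_mfd_def)

lemma chart_inv_restrict:
  assumes "is_chart X c" "x \<in> snd c ` (fst c \<inter> U)"
  shows "chart_inv (fst c \<inter> U, snd c) x = chart_inv c x"
proof -
  obtain p where p: "p \<in> fst c" "p \<in> U" "x = snd c p" using assms by auto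
  have "inj_on (snd c) (fst c \<inter> U)" using is_chart_inj[OF assms(1)] by (rule inj_on_subset) auto
  then show ?thesis using p is_chart_inv_left[OF assms(1) p(1)] by (simp add: chart_inv_def)
qed

text \<open>An inverse trivialization, read in a chart of the base and a chart of the typical fibre,
  becomes a single plot; lines in the base chart then give one-parameter families of fibre
  parametrizations.\<close>

lemma plot_product:
  assumes M: "smooth_manifold M" and B: "smooth_manifold B" and F: "smooth_manifold F"
    and U: "openin (mtop B) U" and V: "openin (mtop M) V"
    and g: "smooth_map (product_mfd (open_part B U) F) (open_part M V) g"
    and d: "d \<in> atlas B" and c: "c \<in> atlas F"
  shows "plot M ({y \<in> chart_img d. chart_inv d y \<in> U} \<times> chart_img c) (\<lambda>(y, x). g (chart_inv d y, chart_inv c x))"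
    (is "plot M (?S \<times> ?T) ?q")
  unfolding plot_def
proof (intro conjI ballI)
  have chd: "is_chart (mtop B) d" and chc: "is_chart (mtop F) c"
    using smooth_manifold_chart[OF B d] smooth_manifold_chart[OF F c] by auto
  show oST: "open (?S \<times> ?T)"
    by (intro open_Times is_chart_vimage_open[OF chd U] is_chart_open_img[OF chc])
  have cg: "continuous_map (prod_topology (subtopology (mtop B) U) (mtop F)) (subtopology (mtop M) V) g"
    using g by (simp add: smooth_map_def)
  have c1: "continuous_map (top_of_set ?S) (subtopology (mtop B) U) (chart_inv d)"
    using is_chart_inv_continuous[OF chd]
    by (auto simp: continuous_map_in_subtopology intro: continuous_map_from_subtopology_mono)
  have c2: "continuous_map (top_of_set ?T) (mtop F) (chart_inv c)" by (rule is_chart_inv_continuous[OF chc])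
  have "continuous_map (top_of_set (?S \<times> ?T)) (prod_topology (subtopology (mtop B) U) (mtop F)) (\<lambda>(y, x). (chart_inv d y, chart_inv c x))"
  proof -
    have "continuous_map (top_of_set (?S \<times> ?T)) (top_of_set ?S) fst" "continuous_map (top_of_set (?S \<times> ?T)) (top_of_set ?T) snd"
      by (auto intro!: continuous_intros)
    from continuous_map_pairedI[OF continuous_map_compose[OF this(1) c1] continuous_map_compose[OF this(2) c2]]
    show ?thesis by (simp add: case_prod_unfold)
  qed
  from continuous_map_compose[OF this cg]
  have cq': "continuous_map (top_of_set (?S \<times> ?T)) (subtopology (mtop M) V) ?q"
    by (simp add: o_def case_prod_unfold)
  then show cq: "continuous_map (top_of_set (?S \<times> ?T)) (mtop M) ?q"
    by (rule continuous_map_into_fulltopology)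
  fix m assume m: "m \<in> atlas M"
  let ?W = "(?S \<times> ?T) \<inter> ?q -` fst m"
  have W: "open ?W"
  proof -
    have "openin (top_of_set (?S \<times> ?T)) {z \<in> topspace (top_of_set (?S \<times> ?T)). ?q z \<in> fst m}"
      by (rule openin_continuous_map_preimage[OF cq is_chart_openin[OF smooth_manifold_chart[OF M m]]])
    then show ?thesis using oST by (simp add: openin_open_eq vimage_def Int_def)
  qed
  let ?d = "(fst d \<inter> U, snd d)" and ?m = "(fst m \<inter> V, snd m)"
  let ?e = "(fst ?d \<times> fst c, map_prod (snd d) (snd c))"
  have "?e \<in> atlas (product_mfd (open_part B U) F)"
    unfolding atlas_product_mfd using d c by (intro image_eqI[of _ _ "(?d, c)"]) auto
  moreover have "?m \<in> atlas (open_part M V)" using m by simp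
  ultimately have sm: "smooth_on (snd ?e ` (fst ?e \<inter> g -` fst ?m)) (snd ?m \<circ> g \<circ> chart_inv ?e)"
    using g unfolding smooth_map_def by blast
  have einv: "chart_inv ?e (snd d a, snd c b) = (a, b)" if "a \<in> fst d" "a \<in> U" "b \<in> fst c" for a b
  proof -
    have "inj_on (snd d) (fst d \<inter> U)" using is_chart_inj[OF chd] by (rule inj_on_subset) auto
    then have "inj_on (map_prod (snd d) (snd c)) ((fst d \<inter> U) \<times> fst c)"
      using is_chart_inj[OF chc] by (rule map_prod_inj_on)
    from inv_into_f_f[OF this, of "(a, b)"] that show ?thesis by (simp add: chart_inv_def)
  qed
  \<comment> \<open>The charts of \<open>open_part M V\<close> are restricted to V, so the values
    must be known to lie there before the smoothness of g can be used in \<open>m\<close>.\<close>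
  have gV: "?q z \<in> V" if "z \<in> ?S \<times> ?T" for z
  proof -
    have "?q \<in> ?S \<times> ?T \<rightarrow> V" using cq' by (simp add: continuous_map_in_subtopology)
    then show ?thesis using that by (rule Pi_mem)
  qed
  have img: "snd ?e ` (fst ?e \<inter> g -` fst ?m) = ?W"
  proof
    show "snd ?e ` (fst ?e \<inter> g -` fst ?m) \<subseteq> ?W"
      using is_chart_inv_left[OF chd] is_chart_inv_left[OF chc] by (auto simp: chart_img_def)
    show "?W \<subseteq> snd ?e ` (fst ?e \<inter> g -` fst ?m)"
    proof
      fix z assume z: "z \<in> ?W"
      obtain y x where yx: "z = (y, x)" by (cases z)
      have "(chart_inv d y, chart_inv c x) \<in> fst ?e \<inter> g -` fst ?m"
        using z gV[of z] yx is_chart_inv_in[OF chd] is_chart_inv_in[OF chc] by auto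
      moreover have "z = snd ?e (chart_inv d y, chart_inv c x)"
        using z yx is_chart_inv_right[OF chd] is_chart_inv_right[OF chc] by auto
      ultimately show "z \<in> snd ?e ` (fst ?e \<inter> g -` fst ?m)" by (rule rev_image_eqI)
    qed
  qed
  have eq: "(snd m \<circ> ?q) z = (snd ?m \<circ> g \<circ> chart_inv ?e) z" if "z \<in> ?W" for z
  proof -
    obtain y x where yx: "z = (y, x)" by (cases z)
    then have "chart_inv ?e z = (chart_inv d y, chart_inv c x)"
      using einv[of "chart_inv d y" "chart_inv c x"] that is_chart_inv_in[OF chd, of y] is_chart_inv_in[OF chc, of x]
        is_chart_inv_right[OF chd, of y] is_chart_inv_right[OF chc, of x] by auto
    then show ?thesis using yx by simp
  qed
  show "smooth_on ?W (snd m \<circ> ?q)"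
    unfolding smooth_on_def
  proof
    fix n show "differentiable_upto ?W (snd m \<circ> ?q) n"
      using smooth_on_imp[OF sm] unfolding img by (subst differentiable_upto_cong[OF W eq]) auto
  qed
qed

text \<open>Smoothness into a product is available only in product charts. A chart d of B around the
  first component is therefore chosen locally and then discarded by \<open>snd\<close>.\<close>

lemma plot_compose_snd:
  fixes M :: "('a, 'e::euclidean_space) mfd"
  assumes M: "smooth_manifold M" and B: "smooth_manifold B" and F: "smooth_manifold F"
    and U: "openin (mtop B) U" and V: "openin (mtop M) V"
    and \<Phi>: "smooth_map (open_part M V) (product_mfd (open_part B U) F) \<Phi>"
    and q: "plot M S q" "q ` S \<subseteq> V"
  shows "plot F S (\<lambda>x. snd (\<Phi> (q x)))"
  unfolding plot_def
proof (intro conjI ballI)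
  show S: "open S" using q(1) by (rule plot_open)
  have c\<Phi>: "continuous_map (subtopology (mtop M) V) (prod_topology (subtopology (mtop B) U) (mtop F)) \<Phi>"
    using \<Phi> by (simp add: smooth_map_def)
  have c1: "continuous_map (subtopology (mtop M) V) (mtop F) (\<lambda>p. snd (\<Phi> p))"
    using continuous_map_compose[OF c\<Phi> continuous_map_snd] by (simp add: o_def)
  have c2: "continuous_map (subtopology (mtop M) V) (subtopology (mtop B) U) (\<lambda>p. fst (\<Phi> p))"
    using continuous_map_compose[OF c\<Phi> continuous_map_fst] by (simp add: o_def)
  have cq: "continuous_map (top_of_set S) (subtopology (mtop M) V) q"
    using q by (auto simp: plot_def continuous_map_in_subtopology)
  show cr: "continuous_map (top_of_set S) (mtop F) (\<lambda>x. snd (\<Phi> (q x)))"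
    using continuous_map_compose[OF cq c1] by (simp add: o_def)
  fix c assume c: "c \<in> atlas F"
  have chc: "is_chart (mtop F) c" by (rule smooth_manifold_chart[OF F c])
  have sub: "V \<subseteq> points M" using V by (rule openin_subset)
  show "smooth_on (S \<inter> (\<lambda>x. snd (\<Phi> (q x))) -` fst c) (snd c \<circ> (\<lambda>x. snd (\<Phi> (q x))))"
  proof (rule smooth_on_openI)
    fix x assume x: "x \<in> S \<inter> (\<lambda>x. snd (\<Phi> (q x))) -` fst c"
    obtain m where m: "m \<in> atlas M" "q x \<in> fst m"
      using smooth_manifold_cover[OF M plot_mem[OF q(1)]] x by blast
    have qV: "q y \<in> V" if "y \<in> S" for y using q(2) that by auto
    have fU: "fst (\<Phi> p) \<in> points B \<inter> U" if "p \<in> V" for p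
      using c2 that sub by (auto simp: continuous_map_def)
    obtain d where d: "d \<in> atlas B" "fst (\<Phi> (q x)) \<in> fst d"
      using smooth_manifold_cover[OF B] fU[OF qV] x by blast
    have chm: "is_chart (mtop M) m" and chd: "is_chart (mtop B) d"
      using smooth_manifold_chart[OF M m(1)] smooth_manifold_chart[OF B d(1)] by auto
    let ?m = "(fst m \<inter> V, snd m)" and ?d = "(fst d \<inter> U, snd d)"
    let ?e = "(fst ?d \<times> fst c, map_prod (snd d) (snd c))"
    have "?e \<in> atlas (product_mfd (open_part B U) F)"
      unfolding atlas_product_mfd using d(1) c by (intro image_eqI[of _ _ "(?d, c)"]) auto
    moreover have "?m \<in> atlas (open_part M V)" using m by simp
    ultimately have sm: "smooth_on (snd ?m ` (fst ?m \<inter> \<Phi> -` fst ?e)) (snd ?e \<circ> \<Phi> \<circ> chart_inv ?m)"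
      using \<Phi> unfolding smooth_map_def by blast
    let ?A = "V \<inter> \<Phi> -` fst ?e"
    have A: "openin (mtop M) ?A"
    proof -
      have "openin (prod_topology (subtopology (mtop B) U) (mtop F)) (fst ?e)"
        using is_chart_openin[OF chd] is_chart_openin[OF chc] 
        by (auto simp: openin_prod_Times_iff openin_subtopology_Int2 Int_commute)
      from openin_continuous_map_preimage[OF c\<Phi> this] have "openin (subtopology (mtop M) V) ?A"
        using sub by (auto simp: vimage_def Int_def inf.absorb2 conj_commute cong: conj_cong elim!: back_subst[of "openin _"])
      then show ?thesis using V openin_trans_full by blast
    qed
    let ?N = "S \<inter> q -` (fst m \<inter> ?A)"
    have N: "open ?N" by (intro plot_open_preimage[OF q(1)] openin_Int is_chart_openin[OF chm] A)
    have eqset: "snd ?m ` (fst ?m \<inter> \<Phi> -` fst ?e) = snd m ` (fst m \<inter> ?A)" by auto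
    have W: "open (snd m ` (fst m \<inter> ?A))" by (rule is_chart_open_image[OF chm A])
    have "smooth_on ?N (\<lambda>y. snd ((snd ?e \<circ> \<Phi> \<circ> chart_inv ?m) ((snd m \<circ> q) y)))"
      unfolding smooth_on_def
    proof
      fix n
      have dq: "differentiable_upto ?N (snd m \<circ> q) n"
        using smooth_on_imp[OF plot_smooth[OF q(1) m(1)]] by (rule differentiable_upto_subset) auto
      have "differentiable_upto ?N (\<lambda>y. (snd ?e \<circ> \<Phi> \<circ> chart_inv ?m) ((snd m \<circ> q) y)) n"
        by (rule differentiable_upto_compose[OF N W _ dq smooth_on_imp[OF sm, unfolded eqset]]) auto
      then show "differentiable_upto ?N (\<lambda>y. snd ((snd ?e \<circ> \<Phi> \<circ> chart_inv ?m) ((snd m \<circ> q) y))) n"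
        by (rule differentiable_upto_linear_compose[OF bounded_linear_snd N])
    qed
    moreover have "(snd c \<circ> (\<lambda>x. snd (\<Phi> (q x)))) y = snd ((snd ?e \<circ> \<Phi> \<circ> chart_inv ?m) ((snd m \<circ> q) y))" if "y \<in> ?N" for y
    proof -
      have "chart_inv ?m (snd m (q y)) = q y"
        using that chart_inv_restrict[OF chm, of "snd m (q y)" V] is_chart_inv_left[OF chm] by auto
      then show ?thesis by simp
    qed
    moreover have "x \<in> ?N" using x m(2) d(2) qV[of x] fU[OF qV[of x]] by (auto simp: mem_Times_iff)
    ultimately show "\<exists>N h. open N \<and> x \<in> N \<and> smooth_on N h \<and> (\<forall>y\<in>N. (snd c \<circ> (\<lambda>x. snd (\<Phi> (q x)))) y = h y)"
      using N by blast
  qed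
qed

lemma plot_smooth_map:
  assumes M: "smooth_manifold M" and f: "smooth_map M N f" and m: "m \<in> atlas M"
  shows "plot N (chart_img m) (f \<circ> chart_inv m)"
  unfolding plot_def
proof (intro conjI ballI)
  have ch: "is_chart (mtop M) m" by (rule smooth_manifold_chart[OF M m])
  show "open (chart_img m)" by (rule is_chart_open_img[OF ch])
  show "continuous_map (top_of_set (chart_img m)) (mtop N) (f \<circ> chart_inv m)"
    using f by (intro continuous_map_compose[OF is_chart_inv_continuous[OF ch]]) (simp add: smooth_map_def)
  fix d assume d: "d \<in> atlas N"
  have "snd m ` (fst m \<inter> f -` fst d) = chart_img m \<inter> (f \<circ> chart_inv m) -` fst d"
    unfolding is_chart_image_eq[OF ch] by auto
  then show "smooth_on (chart_img m \<inter> (f \<circ> chart_inv m) -` fst d) (snd d \<circ> (f \<circ> chart_inv m))"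
    using f m d unfolding smooth_map_def by (metis o_assoc)
qed


section \<open>Partitions of unity\<close>

lemma has_real_derivative_max_square:
  "((\<lambda>t::real. (max 0 t)\<^sup>2) has_real_derivative 2 * max 0 t) (at t)"
proof (cases t "0::real" rule: linorder_cases)
  case less
  have "((\<lambda>t::real. 0) has_real_derivative 2 * max 0 t) (at t)" using less by simp
  then show ?thesis
    by (rule has_field_derivative_transform_within_open[of _ _ _ "{..<0}"]) (use less in auto)
next
  case greater
  have "((\<lambda>t::real. t\<^sup>2) has_real_derivative 2 * max 0 t) (at t)"
    using greater by (auto intro!: derivative_eq_intros)
  then show ?thesis
    by (rule has_field_derivative_transform_within_open[of _ _ _ "{0<..}"]) (use greater in auto)
next
  case equal
  have "((\<lambda>t::real. (max 0 t)\<^sup>2) has_derivative (\<lambda>u. 0)) (at 0)"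
    unfolding has_derivative_at_alt
  proof (intro conjI allI impI bounded_linear_zero)
    fix e :: real assume e: "e > 0"
    have "norm ((max 0 y)\<^sup>2 - (max 0 0)\<^sup>2 - 0) \<le> e * norm (y - 0)" if "norm (y - 0) < e" for y :: real
    proof -
      have "(max 0 y)\<^sup>2 \<le> \<bar>y\<bar> * \<bar>y\<bar>" by (simp add: power2_eq_square max_def)
      also have "\<dots> \<le> e * \<bar>y\<bar>" using that by (intro mult_right_mono) auto
      finally show ?thesis by simp
    qed
    then show "\<exists>d>0. \<forall>y::real. norm (y - 0) < d \<longrightarrow> norm ((max 0 y)\<^sup>2 - (max 0 0)\<^sup>2 - 0) \<le> e * norm (y - 0)"
      using e by blast
  qed
  then show ?thesis unfolding equal has_field_derivative_def by (rule has_derivative_eq_rhs) auto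
qed

lemma differentiable_upto_max_square: "differentiable_upto UNIV (\<lambda>t::real. (max 0 t)\<^sup>2) 1"
  unfolding One_nat_def
proof (rule differentiable_upto_SucI[where f' = "\<lambda>t u. 2 * max 0 t * u"])
  show "((\<lambda>t::real. (max 0 t)\<^sup>2) has_derivative (\<lambda>u. 2 * max 0 t * u)) (at t)" for t
    using has_real_derivative_max_square[of t] by (simp add: has_field_derivative_def)
qed (auto intro!: continuous_intros)

text \<open>For positive r it is positive exactly on the open ball, and it is C1, which is enough
  because partition functions are differentiated only once.\<close>

definition bump :: "'f::euclidean_space \<Rightarrow> real \<Rightarrow> 'f \<Rightarrow> real" where
  "bump a r x = (max 0 (r\<^sup>2 - (x - a) \<bullet> (x - a)))\<^sup>2"

lemma differentiable_upto_bump: "differentiable_upto UNIV (bump a r) 1"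
proof -
  have d: "differentiable_upto UNIV (\<lambda>x. x - a) 1"
    by (intro differentiable_upto_diff differentiable_upto_const differentiable_upto_bounded_linear bounded_linear_ident) auto
  have "differentiable_upto UNIV (\<lambda>x. r\<^sup>2 - (x - a) \<bullet> (x - a)) 1"
    by (intro differentiable_upto_diff differentiable_upto_const differentiable_upto_bilinear[OF bounded_bilinear_inner] d) auto
  from differentiable_upto_compose[OF open_UNIV open_UNIV _ this differentiable_upto_max_square]
  show ?thesis unfolding bump_def[abs_def] by simp
qed

lemma bump_nonneg: "bump a r x \<ge> 0"
  by (simp add: bump_def)

lemma bump_pos_iff: "r > 0 \<Longrightarrow> bump a r x > 0 \<longleftrightarrow> x \<in> ball a r"
proof -
  assume r: "r > 0"
  have "(x - a) \<bullet> (x - a) = (dist a x)\<^sup>2" by (metis dist_commute dist_norm power2_norm_eq_inner)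
  then have "bump a r x > 0 \<longleftrightarrow> (dist a x)\<^sup>2 < r\<^sup>2" by (auto simp: bump_def max_def)
  also have "\<dots> \<longleftrightarrow> dist a x < r" using r power_strict_mono[of "dist a x" r 2] power2_less_imp_less[of "dist a x" r] by auto
  finally show ?thesis by simp
qed

text \<open>Each point gets a bump in a chart around it. By compactness finitely many positivity
  sets cover F, and division by the sum of these bumps normalizes. The index set I consists of the
  centres.\<close>

lemma compact_partition_of_unity:
  fixes F :: "('c, 'f::euclidean_space) mfd"
  assumes F: "smooth_manifold F" and cpt: "compact_space (mtop F)"
  obtains I :: "'c set" and c \<phi> where "finite I" "\<And>i. i \<in> I \<Longrightarrow> c i \<in> atlas F"
    "\<And>i y. \<phi> i y \<ge> (0::real)" "\<And>i y. i \<in> I \<Longrightarrow> y \<notin> fst (c i) \<Longrightarrow> \<phi> i y = 0"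
    "\<And>i. i \<in> I \<Longrightarrow> \<exists>K. compact K \<and> K \<subseteq> chart_img (c i) \<and> (\<forall>x\<in>chart_img (c i) - K. \<phi> i (chart_inv (c i) x) = 0)"
    "\<And>i d. i \<in> I \<Longrightarrow> d \<in> atlas F \<Longrightarrow> differentiable_upto (chart_img d) (\<phi> i \<circ> chart_inv d) 1"
    "\<And>y. y \<in> points F \<Longrightarrow> (\<Sum>i\<in>I. \<phi> i y) = 1"
proof -
  have "\<exists>c r. c \<in> atlas F \<and> \<xi> \<in> fst c \<and> r > 0 \<and> cball (snd c \<xi>) r \<subseteq> chart_img c" if \<xi>: "\<xi> \<in> points F" for \<xi>
  proof -
    obtain c where c: "c \<in> atlas F" "\<xi> \<in> fst c" using smooth_manifold_cover[OF F \<xi>] .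
    have "open (chart_img c)" "snd c \<xi> \<in> chart_img c"
      using is_chart_open_img[OF smooth_manifold_chart[OF F c(1)]] c by (auto simp: chart_img_def)
    then show ?thesis using c by (metis open_contains_cball)
  qed
  then obtain c r where cr: "\<And>\<xi>. \<xi> \<in> points F \<Longrightarrow> c \<xi> \<in> atlas F" "\<And>\<xi>. \<xi> \<in> points F \<Longrightarrow> \<xi> \<in> fst (c \<xi>)"
    "\<And>\<xi>. \<xi> \<in> points F \<Longrightarrow> r \<xi> > 0" "\<And>\<xi>. \<xi> \<in> points F \<Longrightarrow> cball (snd (c \<xi>) \<xi>) (r \<xi>) \<subseteq> chart_img (c \<xi>)"
    by metis
  define \<psi> where "\<psi> = (\<lambda>\<xi> y. if y \<in> fst (c \<xi>) then bump (snd (c \<xi>) \<xi>) (r \<xi>) (snd (c \<xi>) y) else 0)"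
  have ch: "is_chart (mtop F) (c \<xi>)" if "\<xi> \<in> points F" for \<xi>
    by (rule smooth_manifold_chart[OF F cr(1)[OF that]])
  have nn: "\<psi> \<xi> y \<ge> 0" for \<xi> y by (simp add: \<psi>_def bump_nonneg)
  have outside: "\<psi> \<xi> (chart_inv (c \<xi>) x) = 0" if "\<xi> \<in> points F" "x \<in> chart_img (c \<xi>) - cball (snd (c \<xi>) \<xi>) (r \<xi>)" for \<xi> x
  proof -
    have "\<not> bump (snd (c \<xi>) \<xi>) (r \<xi>) x > 0" using that cr(3)[OF that(1)] by (simp add: bump_pos_iff)
    then show ?thesis
      using that is_chart_inv_in[OF ch] is_chart_inv_right[OF ch] bump_nonneg[of "snd (c \<xi>) \<xi>" "r \<xi>" x] by (auto simp: \<psi>_def)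
  qed
  have \<psi>1: "differentiable_upto (chart_img d) (\<psi> \<xi> \<circ> chart_inv d) 1" if \<xi>: "\<xi> \<in> points F" and d: "d \<in> atlas F" for \<xi> d
  proof (rule differentiable_upto_local)
    fix x assume x: "x \<in> chart_img d"
    have chd: "is_chart (mtop F) d" by (rule smooth_manifold_chart[OF F d])
    let ?a = "snd (c \<xi>) \<xi>" and ?K = "chart_inv (c \<xi>) ` cball (snd (c \<xi>) \<xi>) (r \<xi>)"
    show "\<exists>U. open U \<and> x \<in> U \<and> differentiable_upto U (\<psi> \<xi> \<circ> chart_inv d) 1"
    proof (cases "chart_inv d x \<in> fst (c \<xi>)")
      case True
      let ?U = "overlap d (c \<xi>)"
      have U: "open ?U" unfolding overlap_def by (rule is_chart_open_image[OF chd is_chart_openin[OF ch[OF \<xi>]]])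
      have "x \<in> ?U" using overlap_mem[OF is_chart_inv_in[OF chd x] True] is_chart_inv_right[OF chd x] by simp
      moreover have "differentiable_upto ?U (\<lambda>x. bump ?a (r \<xi>) (transition d (c \<xi>) x)) 1"
        by (rule differentiable_upto_compose[OF U open_UNIV _ smooth_on_imp[OF smooth_manifold_transition[OF F d cr(1)[OF \<xi>]]] differentiable_upto_bump]) simp
      then have "differentiable_upto ?U (\<psi> \<xi> \<circ> chart_inv d) 1"
      proof (subst differentiable_upto_cong[OF U])
        fix y assume "y \<in> ?U"
        then obtain p where "p \<in> fst d" "p \<in> fst (c \<xi>)" "y = snd d p" by (auto simp: overlap_def)
        then show "(\<psi> \<xi> \<circ> chart_inv d) y = bump ?a (r \<xi>) (transition d (c \<xi>) y)"
          using is_chart_inv_left[OF chd] by (simp add: \<psi>_def transition_def)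
      qed
      ultimately show ?thesis using U by blast
    next
      \<comment> \<open>The image \<open>?K\<close> of the closed ball is compact, hence closed in
        the Hausdorff space F. A point outside the chart domain has a neighbourhood that avoids
        \<open>?K\<close>, and there the function is 0.\<close>
      case False
      have sub: "cball ?a (r \<xi>) \<subseteq> chart_img (c \<xi>)" by (rule cr(4)[OF \<xi>])
      have "compactin (mtop F) ?K"
        using sub by (intro image_compactin[OF _ is_chart_inv_continuous[OF ch[OF \<xi>]]]) (simp add: compactin_subtopology)
      then have "closedin (mtop F) ?K"
        using F by (intro compactin_imp_closedin) (auto simp: smooth_manifold_def)
      then have oK: "openin (mtop F) (points F - ?K)" by auto
      let ?U = "{y \<in> chart_img d. chart_inv d y \<in> points F - ?K}"
      have U: "open ?U" by (rule is_chart_vimage_open[OF chd oK])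
      have "chart_inv d x \<notin> ?K" using False sub is_chart_inv_in[OF ch[OF \<xi>]] by auto
      then have "x \<in> ?U" using x is_chart_inv_in[OF chd x] is_chart_subset[OF chd] by auto
      moreover have "differentiable_upto ?U (\<psi> \<xi> \<circ> chart_inv d) 1"
      proof (subst differentiable_upto_cong[OF U, where g = "\<lambda>y. 0"])
        fix y assume y: "y \<in> ?U"
        show "(\<psi> \<xi> \<circ> chart_inv d) y = 0"
        proof (cases "chart_inv d y \<in> fst (c \<xi>)")
          case True
          let ?z = "snd (c \<xi>) (chart_inv d y)"
          have "?z \<notin> cball ?a (r \<xi>)" using y is_chart_inv_left[OF ch[OF \<xi>] True] by force
          then have "\<psi> \<xi> (chart_inv (c \<xi>) ?z) = 0" using True by (intro outside[OF \<xi>]) (auto simp: chart_img_def)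
          then show ?thesis using is_chart_inv_left[OF ch[OF \<xi>] True] by simp
        qed (simp add: \<psi>_def)
      qed (rule differentiable_upto_const)
      ultimately show ?thesis using U by blast
    qed
  qed
  let ?W = "\<lambda>\<xi>. {y \<in> points F. \<psi> \<xi> y > 0}"
  have W: "openin (mtop F) (?W \<xi>)" if \<xi>: "\<xi> \<in> points F" for \<xi>
  proof -
    have sub: "fst (c \<xi>) \<subseteq> points F" by (rule is_chart_subset[OF ch[OF \<xi>]])
    have "openin (subtopology (mtop F) (fst (c \<xi>))) {y \<in> topspace (subtopology (mtop F) (fst (c \<xi>))). snd (c \<xi>) y \<in> ball (snd (c \<xi>) \<xi>) (r \<xi>)}"
      by (rule openin_continuous_map_preimage[OF is_chart_continuous[OF ch[OF \<xi>]]]) simp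
    moreover have "{y \<in> topspace (subtopology (mtop F) (fst (c \<xi>))). snd (c \<xi>) y \<in> ball (snd (c \<xi>) \<xi>) (r \<xi>)} = ?W \<xi>"
      using sub bump_pos_iff[OF cr(3)[OF \<xi>]] by (auto simp: \<psi>_def split: if_splits)
    ultimately show ?thesis using openin_trans_full is_chart_openin[OF ch[OF \<xi>]] by metis
  qed
  have pos: "\<psi> \<xi> \<xi> > 0" if \<xi>: "\<xi> \<in> points F" for \<xi>
    using bump_pos_iff[OF cr(3)[OF \<xi>], of "snd (c \<xi>) \<xi>" "snd (c \<xi>) \<xi>"] cr(2,3)[OF \<xi>] by (simp add: \<psi>_def)
  have "\<exists>\<F>. finite \<F> \<and> \<F> \<subseteq> ?W ` points F \<and> points F \<subseteq> \<Union>\<F>"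
  proof -
    have "(\<forall>U\<in>?W ` points F. openin (mtop F) U) \<and> points F \<subseteq> \<Union>(?W ` points F)"
      using W pos by auto
    moreover have "(\<forall>U\<in>\<U>. openin (mtop F) U) \<and> points F \<subseteq> \<Union>\<U> \<Longrightarrow> \<exists>\<F>. finite \<F> \<and> \<F> \<subseteq> \<U> \<and> points F \<subseteq> \<Union>\<F>" for \<U>
      using cpt unfolding compact_space_def compactin_def by blast
    from this[OF calculation] show ?thesis .
  qed
  then obtain I where I: "finite I" "I \<subseteq> points F" "points F \<subseteq> \<Union>(?W ` I)"
  proof -
    obtain \<F> where \<F>: "finite \<F>" "\<F> \<subseteq> ?W ` points F" "points F \<subseteq> \<Union>\<F>"
      using \<open>\<exists>\<F>. finite \<F> \<and> \<F> \<subseteq> ?W ` points F \<and> points F \<subseteq> \<Union>\<F>\<close> by blast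
    from finite_subset_image[OF this(1,2)] obtain I where "I \<subseteq> points F" "finite I" "\<F> = ?W ` I" by blast
    with \<F>(3) show thesis by (intro that) auto
  qed
  define s where "s = (\<lambda>y. \<Sum>j\<in>I. \<psi> j y)"
  have spos: "s y > 0" if y: "y \<in> points F" for y
  proof -
    obtain j where "j \<in> I" "\<psi> j y > 0" using I(3) y by auto
    then show ?thesis unfolding s_def using I(1) nn by (intro sum_pos2[of I j]) auto
  qed
  have s1: "differentiable_upto (chart_img d) (s \<circ> chart_inv d) 1" if "d \<in> atlas F" for d
    unfolding s_def o_def
    using I(2) \<psi>1[OF _ that] is_chart_open_img[OF smooth_manifold_chart[OF F that]]
    by (intro differentiable_upto_sum) (auto simp: o_def)
  have si: "differentiable_upto (chart_img d) (\<lambda>x. inverse ((s \<circ> chart_inv d) x)) 1" if d: "d \<in> atlas F" for d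
  proof -
    have chd: "is_chart (mtop F) d" by (rule smooth_manifold_chart[OF F d])
    have "s (chart_inv d x) \<noteq> 0" if "x \<in> chart_img d" for x
      using spos[of "chart_inv d x"] is_chart_inv_in[OF chd that] is_chart_subset[OF chd] by force
    then show ?thesis
      by (intro differentiable_upto_compose[OF is_chart_open_img[OF chd] _ _ s1[OF d] differentiable_upto_inverse])
        (auto simp: open_Collect_neq)
  qed
  show thesis
  proof (rule that[of I c "\<lambda>i y. \<psi> i y * inverse (s y)"])
    fix i assume i: "i \<in> I"
    then have iF: "i \<in> points F" using I(2) by blast
    show "c i \<in> atlas F" by (rule cr(1)[OF iF])
    show "\<psi> i y * inverse (s y) = 0" if "y \<notin> fst (c i)" for y using that by (simp add: \<psi>_def)
    show "\<exists>K. compact K \<and> K \<subseteq> chart_img (c i) \<and> (\<forall>x\<in>chart_img (c i) - K. \<psi> i (chart_inv (c i) x) * inverse (s (chart_inv (c i) x)) = 0)"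
      using outside[OF iF] cr(4)[OF iF] by (intro exI[of _ "cball (snd (c i) i) (r i)"]) auto
    show "differentiable_upto (chart_img d) ((\<lambda>y. \<psi> i y * inverse (s y)) \<circ> chart_inv d) 1" if d: "d \<in> atlas F" for d
      using differentiable_upto_mult[OF is_chart_open_img[OF smooth_manifold_chart[OF F d]] \<psi>1[OF iF d] si[OF d]]
      by (simp add: o_def)
  next
    show "\<psi> i y * inverse (s y) \<ge> 0" for i y
      using nn by (simp add: s_def sum_nonneg)
    show "(\<Sum>i\<in>I. \<psi> i y * inverse (s y)) = 1" if "y \<in> points F" for y
      using spos[OF that] unfolding sum_distrib_right[symmetric] by (simp add: s_def)
  qed (rule I(1))
qed


section \<open>Fibres of an LCS fibration\<close>

text \<open>To be instantiated after the first conformal change, when the Lee form is the pullback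
  of \<open>\<alpha>\<close> itself and not merely cohomologous to it.\<close>

locale lcs_fibration =
  fixes M :: "('a, 'e::{complex_model, euclidean_space}) mfd" and B :: "('b, 'n::complex_model) mfd"
    and F :: "('c, 'f::euclidean_space) mfd" and \<pi> :: "'a \<Rightarrow> 'b" and \<Omega> :: "('a, 'e) form2" and \<alpha> :: "('b, 'n) form1"
  assumes M: "smooth_manifold M" and B: "smooth_manifold B" and F: "smooth_manifold F"
    and compact_M: "compact_space (mtop M)"
    and fibration: "locally_trivial_fibration M B F \<pi>"
    and fibres: "\<And>b. b \<in> points B \<Longrightarrow> \<exists>k. complex_submanifold M {x \<in> points M. \<pi> x = b} k"
    and \<Omega>: "two_form M \<Omega>" and positive: "positive11 M (part11 \<Omega>)"
    and \<alpha>: "one_form B \<alpha>" and lee: "lee_form M \<Omega> (pullback1 B \<pi> \<alpha>)"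
begin

definition fibre :: "'b \<Rightarrow> 'a set" where "fibre b = {x \<in> points M. \<pi> x = b}"

definition part :: "'b set \<Rightarrow> 'a set" where "part V = {x \<in> points M. \<pi> x \<in> V}"

text \<open>The inverse \<open>g\<close> is carried along explicitly, since it is \<open>g\<close>
  that parametrizes the fibres, while \<open>\<Phi>\<close> supplies their coordinates in F.\<close>

definition triv :: "'b set \<Rightarrow> ('a \<Rightarrow> 'b \<times> 'c) \<Rightarrow> ('b \<times> 'c \<Rightarrow> 'a) \<Rightarrow> bool" where
  "triv U \<Phi> g \<longleftrightarrow> openin (mtop B) U \<and>
     smooth_map (open_part M (part U)) (product_mfd (open_part B U) F) \<Phi> \<and>
     smooth_map (product_mfd (open_part B U) F) (open_part M (part U)) g \<and>
     (\<forall>x\<in>part U. g (\<Phi> x) = x \<and> fst (\<Phi> x) = \<pi> x) \<and> (\<forall>b\<in>U. \<forall>y\<in>points F. \<Phi> (g (b, y)) = (b, y))"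

lemma \<pi>_smooth: "smooth_map M B \<pi>"
  using fibration by (simp add: locally_trivial_fibration_def)

lemma \<pi>_continuous: "continuous_map (mtop M) (mtop B) \<pi>"
  using \<pi>_smooth by (simp add: smooth_map_def)

lemma \<pi>_points: "x \<in> points M \<Longrightarrow> \<pi> x \<in> points B"
  using \<pi>_continuous by (auto simp: continuous_map_def)

lemma part_openin: "openin (mtop B) U \<Longrightarrow> openin (mtop M) (part U)"
  unfolding part_def by (rule openin_continuous_map_preimage[OF \<pi>_continuous])

lemma triv_exists:
  assumes "b \<in> points B" obtains U \<Phi> g where "triv U \<Phi> g" "b \<in> U"
proof -
  obtain U \<Phi> where U: "openin (mtop B) U" "b \<in> U"
    "diffeomorphism (open_part M (part U)) (product_mfd (open_part B U) F) \<Phi>"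
    "\<And>x. x \<in> points M \<Longrightarrow> \<pi> x \<in> U \<Longrightarrow> fst (\<Phi> x) = \<pi> x"
    using fibration assms unfolding locally_trivial_fibration_def part_def by blast
  obtain g where g: "smooth_map (product_mfd (open_part B U) F) (open_part M (part U)) g"
    "\<And>x. x \<in> points (open_part M (part U)) \<Longrightarrow> g (\<Phi> x) = x"
    "\<And>y. y \<in> points (product_mfd (open_part B U) F) \<Longrightarrow> \<Phi> (g y) = y"
    and \<Phi>: "smooth_map (open_part M (part U)) (product_mfd (open_part B U) F) \<Phi>"
    using U(3) unfolding diffeomorphism_def by blast
  have "triv U \<Phi> g"
    unfolding triv_def using U(1,4) g \<Phi> openin_subset[OF U(1)] by (auto simp: part_def)
  then show thesis using that U(2) by blast
qed

lemma triv_openin: "triv U \<Phi> g \<Longrightarrow> openin (mtop B) U"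
  by (simp add: triv_def)

lemma triv_g:
  assumes "triv U \<Phi> g" "b \<in> U" "y \<in> points F"
  shows "g (b, y) \<in> part U" "\<Phi> (g (b, y)) = (b, y)" "\<pi> (g (b, y)) = b" "g (b, y) \<in> fibre b"
proof -
  have U: "U \<subseteq> points B" using triv_openin[OF assms(1)] by (rule openin_subset)
  have "continuous_map (prod_topology (subtopology (mtop B) U) (mtop F)) (subtopology (mtop M) (part U)) g"
    using assms(1) by (simp add: triv_def smooth_map_def)
  moreover have "(b, y) \<in> topspace (prod_topology (subtopology (mtop B) U) (mtop F))"
    using assms U by auto
  ultimately show 1: "g (b, y) \<in> part U"
    by (metis IntD2 continuous_map_image_subset_topspace image_subset_iff topspace_subtopology)
  show 2: "\<Phi> (g (b, y)) = (b, y)" using assms by (simp add: triv_def)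
  show 3: "\<pi> (g (b, y)) = b" using assms(1) 1 2 by (metis fst_conv triv_def)
  show "g (b, y) \<in> fibre b" using 1 3 by (simp add: fibre_def part_def)
qed

lemma triv_\<Phi>:
  assumes "triv U \<Phi> g" "x \<in> part U"
  shows "snd (\<Phi> x) \<in> points F" "g (\<pi> x, snd (\<Phi> x)) = x"
proof -
  have "continuous_map (subtopology (mtop M) (part U)) (prod_topology (subtopology (mtop B) U) (mtop F)) \<Phi>"
    using assms(1) by (simp add: triv_def smooth_map_def)
  moreover have "x \<in> topspace (subtopology (mtop M) (part U))" using assms(2) by (simp add: part_def)
  ultimately have "\<Phi> x \<in> topspace (prod_topology (subtopology (mtop B) U) (mtop F))"
    using continuous_map_image_subset_topspace by blast
  then show "snd (\<Phi> x) \<in> points F" by auto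
  have "(\<pi> x, snd (\<Phi> x)) = \<Phi> x" using assms unfolding triv_def by (metis prod.collapse)
  then show "g (\<pi> x, snd (\<Phi> x)) = x" using assms by (simp add: triv_def)
qed

lemma fibre_part: "b \<in> U \<Longrightarrow> fibre b \<subseteq> part U"
  by (auto simp: fibre_def part_def)

lemma chart_points: "c \<in> atlas F \<Longrightarrow> y \<in> fst c \<Longrightarrow> y \<in> points F"
  using is_chart_subset[OF smooth_manifold_chart[OF F]] by blast

text \<open>For fixed \<open>g\<close> and \<open>c\<close> the domain is the same for every b, so
  the fibres over an open set of the base are parametrized simultaneously.\<close>

definition param :: "('b \<times> 'c \<Rightarrow> 'a) \<Rightarrow> ('c, 'f) chart \<Rightarrow> 'b \<Rightarrow> 'f \<Rightarrow> 'a" where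
  "param g c b = (\<lambda>x. g (b, chart_inv c x))"

lemma param_fibre:
  assumes "triv U \<Phi> g" "b \<in> U" "c \<in> atlas F" "x \<in> chart_img c"
  shows "param g c b x \<in> fibre b" "snd (\<Phi> (param g c b x)) = chart_inv c x" "\<Phi> (param g c b x) = (b, chart_inv c x)"
  using triv_g[OF assms(1,2) chart_points[OF assms(3) is_chart_inv_in[OF smooth_manifold_chart[OF F assms(3)] assms(4)]]]
  by (auto simp: param_def)

text \<open>The family of fibre parametrizations over a segment of the base chart, with the position
  on the segment as an additional real coordinate.\<close>

lemma plot_line:
  assumes tr: "triv U \<Phi> g" and d: "d \<in> atlas B" and c: "c \<in> atlas F" and T: "open T"
    and line: "\<And>s. s \<in> T \<Longrightarrow> y0 + s *\<^sub>R w \<in> chart_img d \<and> chart_inv d (y0 + s *\<^sub>R w) \<in> U"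
  shows "plot M (T \<times> chart_img c) (\<lambda>z. param g c (chart_inv d (y0 + fst z *\<^sub>R w)) (snd z))"
proof -
  have p: "plot M ({y \<in> chart_img d. chart_inv d y \<in> U} \<times> chart_img c) (\<lambda>(y, x). g (chart_inv d y, chart_inv c x))"
    using tr by (intro plot_product[OF M B F _ part_openin _ d c]) (auto simp: triv_def)
  have L: "bounded_linear (\<lambda>z::real \<times> 'f. (fst z *\<^sub>R w, snd z))"
    by (intro bounded_linear_Pair bounded_linear_snd bounded_linear_compose[OF bounded_linear_scaleR_left bounded_linear_fst])
  have o: "open (T \<times> chart_img c)"
    using T is_chart_open_img[OF smooth_manifold_chart[OF F c]] by (rule open_Times)
  have "plot M (T \<times> chart_img c) (\<lambda>z. (\<lambda>(y, x). g (chart_inv d y, chart_inv c x)) ((y0, 0) + (fst z *\<^sub>R w, snd z)))"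
    using line by (intro plot_affine[OF M p o L]) auto
  then show ?thesis by (simp add: param_def)
qed

lemma plot_param:
  assumes tr: "triv U \<Phi> g" and b: "b \<in> U" and c: "c \<in> atlas F"
  shows "plot M (chart_img c) (param g c b)"
proof -
  have "b \<in> points B" using b openin_subset[OF triv_openin[OF tr]] by blast
  then obtain d where d: "d \<in> atlas B" "b \<in> fst d" using smooth_manifold_cover[OF B] by blast
  have chd: "is_chart (mtop B) d" by (rule smooth_manifold_chart[OF B d(1)])
  have db: "snd d b \<in> chart_img d" "chart_inv d (snd d b) = b"
    using d is_chart_inv_left[OF chd] by (auto simp: chart_img_def)
  \<comment> \<open>The line with velocity 0 stays over b; its slice at parameter 0 is the
    parametrization of the single fibre.\<close>
  have p: "plot M (UNIV \<times> chart_img c) (\<lambda>z. param g c (chart_inv d (snd d b + fst z *\<^sub>R 0)) (snd z))"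
    using db b by (intro plot_line[OF tr d(1) c open_UNIV]) auto
  have L: "bounded_linear (\<lambda>x::'f. (0::real, x))" by (intro bounded_linear_intros)
  have "plot M (chart_img c) (\<lambda>x. param g c (chart_inv d (snd d b + fst ((0, 0) + (0::real, x)) *\<^sub>R 0)) (snd ((0, 0) + (0::real, x))))"
    by (intro plot_affine[OF M p is_chart_open_img[OF smooth_manifold_chart[OF F c]] L]) auto
  then show ?thesis using db by (simp add: eta_contract_eq)
qed

lemma plot_fibre_coordinate:
  assumes tr: "triv U \<Phi> g" and q: "plot M S q" "q ` S \<subseteq> part U"
  shows "plot F S (\<lambda>x. snd (\<Phi> (q x)))"
  using tr q by (intro plot_compose_snd[OF M B F triv_openin[OF tr] part_openin[OF triv_openin[OF tr]]]) (auto simp: triv_def)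

text \<open>Every functional that is orthogonal to V is constant along f, so the derivative lies in
  the double orthogonal complement, which is V.\<close>

lemma subspace_closed_derivative:
  fixes f :: "'s::real_normed_vector \<Rightarrow> 'e"
  assumes V: "subspace V" and f: "(f has_derivative f') (at x)" and N: "open N" "x \<in> N" "\<And>y. y \<in> N \<Longrightarrow> f y \<in> V"
  shows "f' u \<in> V"
proof -
  have "z \<bullet> f' u = 0" if z: "\<And>v. v \<in> V \<Longrightarrow> z \<bullet> v = 0" for z
  proof -
    have 1: "((\<lambda>y. z \<bullet> f y) has_derivative (\<lambda>u. z \<bullet> f' u)) (at x)"
      by (rule has_derivative_inner_right[OF f])
    have "((\<lambda>y. z \<bullet> f y) has_derivative (\<lambda>u. 0)) (at x)"
      by (rule has_derivative_transform_within_open[OF has_derivative_const N(1,2), of 0]) (use N(3) z in auto)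
    from has_derivative_unique[OF 1 this] show ?thesis by (simp add: fun_eq_iff)
  qed
  then have "f' u \<in> orthogonal_comp (orthogonal_comp V)"
    by (auto simp: orthogonal_comp_def orthogonal_def inner_commute)
  then show ?thesis using V by (simp add: orthogonal_comp_self)
qed

text \<open>In a slice chart of \<open>M\<close> the fibre is a complex subspace \<open>V\<close>, and \<open>V\<close> is the image of the
  differential since lines in \<open>V\<close> lift to curves in the typical fibre.\<close>

lemma fibre_tangent_complex:
  assumes tr: "triv U \<Phi> g" and b: "b \<in> U" and c: "c \<in> atlas F" and x: "x \<in> chart_img c"
    and m: "m \<in> atlas M" "param g c b x \<in> fst m"
  defines "D \<equiv> frechet_derivative (snd m \<circ> param g c b) (at x)"
  shows "\<exists>w. D w = i_mult (D u)" and "u \<noteq> 0 \<Longrightarrow> D u \<noteq> 0"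
proof -
  let ?q = "param g c b"
  have chc: "is_chart (mtop F) c" and chm: "is_chart (mtop M) m"
    using smooth_manifold_chart[OF F c] smooth_manifold_chart[OF M m(1)] by auto
  have bB: "b \<in> points B" using b openin_subset[OF triv_openin[OF tr]] by blast
  have q: "plot M (chart_img c) ?q" by (rule plot_param[OF tr b c])
  have Dq: "((snd m \<circ> ?q) has_derivative D) (at x)" unfolding D_def by (rule plot_has_derivative[OF q m(1) x m(2)])
  obtain k where "complex_submanifold M (fibre b) k" using fibres[OF bB] unfolding fibre_def by blast
  then obtain c0 V where c0: "holomorphic_chart M c0" "?q x \<in> fst c0" and V: "subspace V" "i_mult ` V \<subseteq> V"
      and slice: "snd c0 ` (fst c0 \<inter> fibre b) = chart_img c0 \<inter> V"
    unfolding complex_submanifold_def using param_fibre(1)[OF tr b c x] by blast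
  have ch0: "is_chart (mtop M) c0" using c0(1) by (simp add: holomorphic_chart_def)
  have hol: "holomorphic_map_on (overlap c0 m) (transition c0 m)" "holomorphic_map_on (overlap m c0) (transition m c0)"
    using c0(1) m(1) by (auto simp: holomorphic_chart_def)
  let ?p = "?q x"
  \<comment> \<open>T passes from the given chart \<open>m\<close> to the slice chart
    \<open>c0\<close>. It is complex linear and T' is a left inverse, so complex invariance of the
    image of D can be checked in the slice chart.\<close>
  define T where "T = frechet_derivative (transition m c0) (at (snd m ?p))"
  define T' where "T' = frechet_derivative (transition c0 m) (at (snd c0 ?p))"
  have dT: "(transition m c0 has_derivative T) (at (snd m ?p))"
    unfolding T_def using hol(2) overlap_mem[OF m(2) c0(2)] by (intro smooth_on_has_derivative) (auto simp: holomorphic_map_on_def)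
  have dT': "(transition c0 m has_derivative T') (at (snd c0 ?p))"
    unfolding T'_def using hol(1) overlap_mem[OF c0(2) m(2)] by (intro smooth_on_has_derivative) (auto simp: holomorphic_map_on_def)
  have Ti: "T (i_mult v) = i_mult (T v)" for v
    unfolding T_def using hol(2) overlap_mem[OF m(2) c0(2)] by (auto simp: holomorphic_map_on_def)
  have T'T: "T' (T v) = v" for v
  proof -
    have tp: "transition m c0 (snd m ?p) = snd c0 ?p" by (rule transition_apply[OF chm m(2)])
    have o: "open (overlap m c0)" unfolding overlap_def by (rule is_chart_open_image[OF chm is_chart_openin[OF ch0]])
    have "((transition c0 m \<circ> transition m c0) has_derivative (T' \<circ> T)) (at (snd m ?p))"
      by (rule diff_chain_at[OF dT]) (simp add: tp dT')
    then have "((\<lambda>y. y) has_derivative (T' \<circ> T)) (at (snd m ?p))"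
    proof (rule has_derivative_transform_within_open[OF _ o overlap_mem[OF m(2) c0(2)]])
      fix y assume "y \<in> overlap m c0"
      then obtain p where "p \<in> fst m" "p \<in> fst c0" "y = snd m p" by (auto simp: overlap_def)
      then show "(transition c0 m \<circ> transition m c0) y = y"
        by (simp add: transition_apply[OF chm] transition_apply[OF ch0])
    qed
    from has_derivative_unique[OF this has_derivative_ident] show ?thesis by (simp add: fun_eq_iff)
  qed
  have N: "open (chart_img c \<inter> ?q -` (fst c0 \<inter> fst m))"
    by (intro plot_open_preimage[OF q] openin_Int is_chart_openin[OF ch0] is_chart_openin[OF chm])
  have xN: "x \<in> chart_img c \<inter> ?q -` (fst c0 \<inter> fst m)" using x m(2) c0(2) by auto
  have d0: "((snd c0 \<circ> ?q) has_derivative (T \<circ> D)) (at x)"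
  proof -
    have "((transition m c0 \<circ> (snd m \<circ> ?q)) has_derivative (T \<circ> D)) (at x)"
      by (rule diff_chain_at[OF Dq]) (simp add: dT)
    then show ?thesis
      by (rule has_derivative_transform_within_open[OF _ N xN]) (auto simp: transition_apply[OF chm])
  qed
  have inV: "T (D w) \<in> V" for w
  proof -
    have "(T \<circ> D) w \<in> V"
    proof (rule subspace_closed_derivative[OF V(1) d0 N xN])
      fix y assume y: "y \<in> chart_img c \<inter> ?q -` (fst c0 \<inter> fst m)"
      then have "?q y \<in> fst c0 \<inter> fibre b" using param_fibre(1)[OF tr b c] by auto
      then show "(snd c0 \<circ> ?q) y \<in> V" using slice by auto
    qed
    then show ?thesis by simp
  qed
  \<comment> \<open>The line through the image point in direction v stays in V, so
    \<open>chart_inv c0\<close> maps it into the fibre. Read in \<open>c\<close>, its fibre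
    coordinate is the curve \<open>?\<xi>\<close>, and the chain rule gives its velocity as a
    preimage of v.\<close>
  have onto: "\<exists>w. T (D w) = v" if v: "v \<in> V" for v
  proof -
    have p0: "plot M (chart_img c0) (chart_inv c0)"
      using c0(1) by (intro plot_chart_inv[OF M ch0]) (auto simp: holomorphic_chart_def holomorphic_map_on_def)
    let ?y = "\<lambda>s::real. snd c0 ?p + s *\<^sub>R v"
    let ?r = "\<lambda>s. chart_inv c0 (?y s)"
    have pV: "snd c0 ?p \<in> V" using slice c0(2) param_fibre(1)[OF tr b c x] by blast
    define I where "I = {s. ?y s \<in> chart_img c0}"
    have I: "open I"
      using open_vimage[OF is_chart_open_img[OF ch0], of ?y] unfolding I_def vimage_def by (simp add: continuous_intros)
    have I0: "0 \<in> I" using c0(2) by (simp add: I_def chart_img_def)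
    have rf: "?r s \<in> fibre b" if "s \<in> I" for s
    proof -
      have "?y s \<in> chart_img c0 \<inter> V"
        using that pV v V(1) by (simp add: I_def subspace_add subspace_scale)
      then obtain p where "p \<in> fst c0" "p \<in> fibre b" "?y s = snd c0 p" using slice by blast
      then show ?thesis using is_chart_inv_left[OF ch0] by simp
    qed
    have r: "plot M I ?r"
      by (intro plot_affine[OF M p0 I bounded_linear_scaleR_left]) (auto simp: I_def)
    have rU: "?r ` I \<subseteq> part U" using rf fibre_part[OF b] by blast
    have pF: "plot F I (\<lambda>s. snd (\<Phi> (?r s)))" by (rule plot_fibre_coordinate[OF tr r rU])
    have r0: "?r 0 = ?p" using is_chart_inv_left[OF ch0 c0(2)] by simp
    have f0: "snd (\<Phi> (?r 0)) = chart_inv c x" unfolding r0 by (rule param_fibre(2)[OF tr b c x])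
    then have f0c: "snd (\<Phi> (?r 0)) \<in> fst c" using is_chart_inv_in[OF chc x] by simp
    let ?\<xi> = "snd c \<circ> (\<lambda>s. snd (\<Phi> (?r s)))"
    have d\<xi>: "(?\<xi> has_derivative frechet_derivative ?\<xi> (at 0)) (at 0)"
      by (rule plot_has_derivative[OF pF c I0 f0c])
    have \<xi>0: "?\<xi> 0 = x" using f0 is_chart_inv_right[OF chc x] by simp
    have comp: "((snd c0 \<circ> ?q \<circ> ?\<xi>) has_derivative (T \<circ> D \<circ> frechet_derivative ?\<xi> (at 0))) (at 0)"
      by (rule diff_chain_at[OF d\<xi>]) (simp only: \<xi>0 d0)
    have oN: "open (I \<inter> (\<lambda>s. snd (\<Phi> (?r s))) -` fst c)"
      by (rule plot_open_preimage[OF pF is_chart_openin[OF chc]])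
    have "(?y has_derivative (T \<circ> D \<circ> frechet_derivative ?\<xi> (at 0))) (at 0)"
    proof (rule has_derivative_transform_within_open[OF comp oN])
      show "0 \<in> I \<inter> (\<lambda>s. snd (\<Phi> (?r s))) -` fst c" using I0 f0c by simp
      fix s assume s: "s \<in> I \<inter> (\<lambda>s. snd (\<Phi> (?r s))) -` fst c"
      then have "?q (?\<xi> s) = ?r s"
        using is_chart_inv_left[OF chc] triv_\<Phi>(2)[OF tr, of "?r s"] rU rf[of s] by (auto simp: param_def fibre_def)
      then show "(snd c0 \<circ> ?q \<circ> ?\<xi>) s = ?y s"
        using s is_chart_inv_right[OF ch0] by (simp add: I_def)
    qed
    moreover have "(?y has_derivative (\<lambda>s. s *\<^sub>R v)) (at 0)" by (auto intro!: derivative_eq_intros)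
    ultimately have "(T \<circ> D \<circ> frechet_derivative ?\<xi> (at 0)) 1 = 1 *\<^sub>R v"
      by (metis has_derivative_unique)
    then show ?thesis by auto
  qed
  have "i_mult (T (D u)) \<in> V" using inV V(2) by auto
  then obtain w where "T (D w) = i_mult (T (D u))" using onto by blast
  then have "T' (T (D w)) = T' (T (i_mult (D u)))" by (simp add: Ti)
  then show "\<exists>w. D w = i_mult (D u)" unfolding T'T by blast
  \<comment> \<open>Followed by the fibre coordinate of the trivialization, the parametrization is
    the identity, so its differential has a left inverse.\<close>
  show "D u \<noteq> 0" if "u \<noteq> 0"
  proof
    assume D0: "D u = 0"
    have pm: "plot M (chart_img m \<inter> chart_inv m -` part U) (chart_inv m)"
      by (intro plot_subset[OF M plot_atlas_chart_inv[OF M m(1)]] plot_open_preimage[OF plot_atlas_chart_inv[OF M m(1)]]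
         part_openin[OF triv_openin[OF tr]]) auto
    have pF: "plot F (chart_img m \<inter> chart_inv m -` part U) (\<lambda>y. snd (\<Phi> (chart_inv m y)))"
      by (rule plot_fibre_coordinate[OF tr pm]) auto
    have mp: "snd m ?p \<in> chart_img m \<inter> chart_inv m -` part U"
      using m(2) is_chart_inv_left[OF chm m(2)] param_fibre(1)[OF tr b c x] fibre_part[OF b] by (auto simp: chart_img_def)
    have fc: "snd (\<Phi> (chart_inv m (snd m ?p))) \<in> fst c"
      using is_chart_inv_left[OF chm m(2)] param_fibre(2)[OF tr b c x] is_chart_inv_in[OF chc x] by simp
    let ?h = "snd c \<circ> (\<lambda>y. snd (\<Phi> (chart_inv m y)))"
    have "(?h has_derivative frechet_derivative ?h (at (snd m ?p))) (at ((snd m \<circ> ?q) x))"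
      using plot_has_derivative[OF pF c mp fc] by simp
    from diff_chain_at[OF Dq this]
    have "((?h \<circ> (snd m \<circ> ?q)) has_derivative (frechet_derivative ?h (at (snd m ?p)) \<circ> D)) (at x)" .
    then have "((\<lambda>y. y) has_derivative (frechet_derivative ?h (at (snd m ?p)) \<circ> D)) (at x)"
    proof (rule has_derivative_transform_within_open[OF _ N xN])
      fix y assume y: "y \<in> chart_img c \<inter> ?q -` (fst c0 \<inter> fst m)"
      then show "(?h \<circ> (snd m \<circ> ?q)) y = y"
        using is_chart_inv_left[OF chm] param_fibre(2)[OF tr b c] is_chart_inv_right[OF chc] by auto
    qed
    from has_derivative_unique[OF this has_derivative_ident]
    have "frechet_derivative ?h (at (snd m ?p)) (D u) = u" by (simp add: fun_eq_iff)
    moreover have "frechet_derivative ?h (at (snd m ?p)) 0 = 0"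
      using plot_linear[OF pF c mp fc] by (rule linear_0)
    ultimately show False using D0 that by simp
  qed
qed

text \<open>The tangent space of the fibre is complex, so J Du is Dw for some w, and taming gives
  \<Omega>(Du, Dw) > 0.\<close>

lemma fibre_nondegenerate:
  assumes tr: "triv U \<Phi> g" and b: "b \<in> U" and c: "c \<in> atlas F" and x: "x \<in> chart_img c"
  shows "det (form_matrix (pull2 M \<Omega> (param g c b) x)) \<noteq> 0"
proof (rule nondegenerate_det)
  let ?q = "param g c b"
  have q: "plot M (chart_img c) ?q" by (rule plot_param[OF tr b c])
  show "bilinear (pull2 M \<Omega> ?q x)" by (rule pull2_bilinear[OF M \<Omega> q x])
  fix u :: 'f assume u: "u \<noteq> 0"
  obtain m where m: "m \<in> atlas M" "?q x \<in> fst m"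
    using smooth_manifold_cover[OF M plot_mem[OF q x]] by blast
  let ?D = "frechet_derivative (snd m \<circ> ?q) (at x)"
  obtain w where w: "?D w = i_mult (?D u)" using fibre_tangent_complex(1)[OF tr b c x m] by blast
  have Du: "?D u \<noteq> 0" by (rule fibre_tangent_complex(2)[OF tr b c x m u])
  have y: "snd m (?q x) \<in> chart_img m" using m by (simp add: chart_img_def)
  let ?\<Omega> = "\<Omega> m (snd m (?q x))"
  have "part11 \<Omega> m (snd m (?q x)) (?D u) (i_mult (?D u)) > 0"
    using positive m(1) y Du unfolding positive11_def by blast
  \<comment> \<open>Consequently \<Omega> and its (1,1)-part take the same value on the pair v,
    Jv.\<close>
  moreover have "?\<Omega> (i_mult v) (i_mult (i_mult v)) = ?\<Omega> v (i_mult v)" for v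
  proof -
    have "linear (?\<Omega> (i_mult v))" and "?\<Omega> v (i_mult v) = - ?\<Omega> (i_mult v) v"
      using two_form_coordinates[OF M \<Omega> q m(1)] y by blast+
    then show ?thesis by (simp add: i_mult_i_mult linear_neg)
  qed
  ultimately have "?\<Omega> (?D u) (?D w) > 0" by (simp add: part11_def w)
  then show "\<exists>v. pull2 M \<Omega> ?q x u v \<noteq> 0"
    using pull2_chart[OF M \<Omega> q m(1) x m(2), of u w] by (intro exI[of _ w]) simp
qed

end


section \<open>Volume of the fibres\<close>

context lcs_fibration
begin

definition params :: "'b \<Rightarrow> ('f set \<times> ('f \<Rightarrow> 'a)) set" where
  "params b = {(chart_img c, param g c b) | c g. c \<in> atlas F \<and> (\<exists>U \<Phi>. triv U \<Phi> g \<and> b \<in> U)}"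

definition dens :: "('f \<Rightarrow> 'a) \<Rightarrow> 'f \<Rightarrow> real" where
  "dens q x = vol_density (pull2 M \<Omega> q x)"

text \<open>Stated for subfamilies because \<open>vol\<close> uses all of \<open>params b\<close>,
  whereas \<open>vol_variation\<close> works with those of a single trivialization.\<close>

lemma param_density_params:
  assumes P: "P \<subseteq> params b"
  shows "param_density P (fibre b) dens"
proof
  fix S q assume "(S, q) \<in> P"
  then obtain c U \<Phi> g where c: "c \<in> atlas F" "triv U \<Phi> g" "b \<in> U" and Sq: "S = chart_img c" "q = param g c b"
    using P unfolding params_def by blast
  have chc: "is_chart (mtop F) c" by (rule smooth_manifold_chart[OF F c(1)])
  have q: "plot M S q" unfolding Sq by (rule plot_param[OF c(2,3,1)])
  show S: "open S" using q by (rule plot_open)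
  show "inj_on q S"
  proof (rule inj_onI)
    fix x y assume "x \<in> S" "y \<in> S" "q x = q y"
    then have "chart_inv c x = chart_inv c y"
      using param_fibre(2)[OF c(2,3,1)] unfolding Sq by metis
    then show "x = y" using \<open>x \<in> S\<close> \<open>y \<in> S\<close> is_chart_inv_right[OF chc] unfolding Sq by metis
  qed
  show "q ` S \<subseteq> fibre b" using param_fibre(1)[OF c(2,3,1)] by (auto simp: Sq)
  have "differentiable_upto S (\<lambda>x. vol_density (pull2 M \<Omega> q x)) 0"
    using fibre_nondegenerate[OF c(2,3,1)]
    by (intro density_differentiable_upto S smooth_on_imp pull2_smooth[OF M \<Omega> q]) (auto simp: Sq)
  then show "continuous_on S (dens q)" by (simp add: dens_def[abs_def])
  fix S' q' assume "(S', q') \<in> P"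
  then obtain c' U' \<Phi>' g' where c': "c' \<in> atlas F" "triv U' \<Phi>' g'" "b \<in> U'" and Sq': "S' = chart_img c'" "q' = param g' c' b"
    using P unfolding params_def by blast
  have chc': "is_chart (mtop F) c'" by (rule smooth_manifold_chart[OF F c'(1)])
  have q': "plot M S' q'" unfolding Sq' by (rule plot_param[OF c'(2,3,1)])
  let ?r = "\<lambda>x. snd (\<Phi>' (q x))"
  have qf: "q x \<in> fibre b" if "x \<in> S" for x using param_fibre(1)[OF c(2,3,1)] that by (simp add: Sq)
  have r: "plot F S ?r"
    using qf fibre_part[OF c'(3)] by (intro plot_fibre_coordinate[OF c'(2) q]) blast
  let ?R = "S \<inter> ?r -` fst c'"
  \<comment> \<open>The transition from q to q': the fibre coordinate of the second trivialization,
    read in its chart c'.\<close>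
  let ?\<tau> = "snd c' \<circ> ?r"
  have \<tau>: "?\<tau> x \<in> S'" "q' (?\<tau> x) = q x" if "x \<in> ?R" for x
  proof -
    show "?\<tau> x \<in> S'" using that by (auto simp: Sq' chart_img_def)
    have "q x \<in> part U'" "\<pi> (q x) = b" using qf[of x] that fibre_part[OF c'(3)] by (auto simp: fibre_def)
    then have "g' (b, ?r x) = q x" using triv_\<Phi>(2)[OF c'(2)] by metis
    then show "q' (?\<tau> x) = q x"
      using that is_chart_inv_left[OF chc'] by (simp add: Sq' param_def)
  qed
  have R: "S \<inter> q -` (q' ` S') = ?R"
  proof
    show "?R \<subseteq> S \<inter> q -` (q' ` S')" using \<tau> by (metis (no_types, lifting) IntD1 IntI image_eqI subsetI vimageI)
    show "S \<inter> q -` (q' ` S') \<subseteq> ?R"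
    proof
      fix x assume x: "x \<in> S \<inter> q -` (q' ` S')"
      then obtain y where "y \<in> chart_img c'" "q x = param g' c' b y" by (auto simp: Sq')
      then have "?r x = chart_inv c' y" "chart_inv c' y \<in> fst c'"
        using param_fibre(2)[OF c'(2,3,1)] is_chart_inv_in[OF chc'] by auto
      then show "x \<in> ?R" using x by auto
    qed
  qed
  have oR: "open ?R" by (rule plot_open_preimage[OF r is_chart_openin[OF chc']])
  show "open (S \<inter> q -` (q' ` S')) \<and> (\<exists>\<tau> \<tau>'. \<forall>x\<in>S \<inter> q -` (q' ` S'). \<tau> x \<in> S' \<and> q' (\<tau> x) = q x \<and>
      (\<tau> has_derivative \<tau>' x) (at x) \<and> dens q x = \<bar>det (lin_matrix (\<tau>' x))\<bar> * dens q' (\<tau> x))"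
    unfolding R
  proof (intro conjI oR exI ballI)
    fix x assume x: "x \<in> ?R"
    show "?\<tau> x \<in> S'" "q' (?\<tau> x) = q x" using \<tau>[OF x] by auto
    show d: "(?\<tau> has_derivative frechet_derivative ?\<tau> (at x)) (at x)"
      using x by (intro plot_has_derivative[OF r c'(1)]) auto
    have "pull2 M \<Omega> q x = (\<lambda>u v. pull2 M \<Omega> q' (?\<tau> x) (frechet_derivative ?\<tau> (at x) u) (frechet_derivative ?\<tau> (at x) v))"
      using x by (intro ext pull2_compose[OF M \<Omega> q _ q' d \<tau>(1)[OF x] oR x \<tau>(2)[symmetric]]) (rule IntD1)
    then show "dens q x = \<bar>det (lin_matrix (frechet_derivative ?\<tau> (at x)))\<bar> * dens q' (?\<tau> x)"
      unfolding dens_def using density_pull[OF pull2_bilinear[OF M \<Omega> q' \<tau>(1)[OF x]], of "frechet_derivative ?\<tau> (at x)"] by (simp only:)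
  qed
qed

text \<open>Lives on the typical fibre. After transport by a trivialization its coordinate
  expressions are the same over every b, so that only the density varies with b.\<close>

definition F_partition :: "'c set \<Rightarrow> ('c \<Rightarrow> ('c, 'f) chart) \<Rightarrow> ('c \<Rightarrow> 'c \<Rightarrow> real) \<Rightarrow> bool" where
  "F_partition I c \<phi> \<longleftrightarrow> finite I \<and> (\<forall>i\<in>I. c i \<in> atlas F \<and> (\<forall>y. \<phi> i y \<ge> 0) \<and> (\<forall>y. y \<notin> fst (c i) \<longrightarrow> \<phi> i y = 0) \<and>
     (\<exists>K. compact K \<and> K \<subseteq> chart_img (c i) \<and> (\<forall>x\<in>chart_img (c i) - K. \<phi> i (chart_inv (c i) x) = 0)) \<and>
     (\<forall>d\<in>atlas F. differentiable_upto (chart_img d) (\<phi> i \<circ> chart_inv d) 1)) \<and>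
     (\<forall>y\<in>points F. (\<Sum>i\<in>I. \<phi> i y) = 1)"

text \<open>The fibre is closed in the compact M, and F is its image under the fibre coordinate of a
  trivialization.\<close>

lemma compact_F:
  assumes b: "b \<in> points B" shows "compact_space (mtop F)"
proof -
  obtain U \<Phi> g where tr: "triv U \<Phi> g" "b \<in> U" using triv_exists[OF b] .
  have "closedin (mtop B) {b}"
    using B b by (intro closedin_Hausdorff_sing_eq[THEN iffD2]) (auto simp: smooth_manifold_def)
  from closedin_continuous_map_preimage[OF \<pi>_continuous this]
  have "closedin (mtop M) (fibre b)" by (simp add: fibre_def)
  then have "compactin (mtop M) (fibre b)" by (rule closedin_compact_space[OF compact_M])
  then have "compactin (subtopology (mtop M) (part U)) (fibre b)"
    using fibre_part[OF tr(2)] by (simp add: compactin_subtopology)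
  moreover have "continuous_map (subtopology (mtop M) (part U)) (mtop F) (\<lambda>p. snd (\<Phi> p))"
  proof -
    have "continuous_map (subtopology (mtop M) (part U)) (prod_topology (subtopology (mtop B) U) (mtop F)) \<Phi>"
      using tr(1) by (simp add: triv_def smooth_map_def)
    from continuous_map_compose[OF this continuous_map_snd] show ?thesis by (simp add: o_def)
  qed
  ultimately have "compactin (mtop F) ((\<lambda>p. snd (\<Phi> p)) ` fibre b)" by (rule image_compactin)
  moreover have "(\<lambda>p. snd (\<Phi> p)) ` fibre b = points F"
  proof
    show "(\<lambda>p. snd (\<Phi> p)) ` fibre b \<subseteq> points F" using triv_\<Phi>(1)[OF tr(1)] fibre_part[OF tr(2)] by blast
    show "points F \<subseteq> (\<lambda>p. snd (\<Phi> p)) ` fibre b"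
    proof
      fix y assume "y \<in> points F"
      from triv_g[OF tr this] show "y \<in> (\<lambda>p. snd (\<Phi> p)) ` fibre b" by (intro image_eqI[of _ _ "g (b, y)"]) auto
    qed
  qed
  ultimately show ?thesis by (simp add: compact_space_def)
qed

lemma F_partition_exists:
  assumes "b \<in> points B" obtains I c \<phi> where "F_partition I c \<phi>"
proof -
  obtain I :: "'c set" and c \<phi> where A: "finite I" "\<And>i. i \<in> I \<Longrightarrow> c i \<in> atlas F"
    "\<And>i y. \<phi> i y \<ge> (0::real)" "\<And>i y. i \<in> I \<Longrightarrow> y \<notin> fst (c i) \<Longrightarrow> \<phi> i y = 0"
    "\<And>i. i \<in> I \<Longrightarrow> \<exists>K. compact K \<and> K \<subseteq> chart_img (c i) \<and> (\<forall>x\<in>chart_img (c i) - K. \<phi> i (chart_inv (c i) x) = 0)"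
    "\<And>i d. i \<in> I \<Longrightarrow> d \<in> atlas F \<Longrightarrow> differentiable_upto (chart_img d) (\<phi> i \<circ> chart_inv d) 1"
    "\<And>y. y \<in> points F \<Longrightarrow> (\<Sum>i\<in>I. \<phi> i y) = 1"
    by (rule compact_partition_of_unity[OF F compact_F[OF assms]]) (rule that)
  have "F_partition I c \<phi>"
    unfolding F_partition_def
  proof (intro conjI ballI)
    show "finite I" by (rule A(1))
    show "(\<Sum>i\<in>I. \<phi> i y) = 1" if "y \<in> points F" for y by (rule A(7)[OF that])
    fix i assume i: "i \<in> I"
    show "c i \<in> atlas F" by (rule A(2)[OF i])
    show "\<forall>y. \<phi> i y \<ge> 0" by (intro allI A(3))
    show "\<forall>y. y \<notin> fst (c i) \<longrightarrow> \<phi> i y = 0" by (intro allI impI A(4)[OF i])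
    show "\<exists>K. compact K \<and> K \<subseteq> chart_img (c i) \<and> (\<forall>x\<in>chart_img (c i) - K. \<phi> i (chart_inv (c i) x) = 0)"
      by (rule A(5)[OF i])
    show "differentiable_upto (chart_img d) (\<phi> i \<circ> chart_inv d) 1" if "d \<in> atlas F" for d by (rule A(6)[OF i that])
  qed
  then show thesis by (rule that)
qed

text \<open>P may contain parametrizations of other trivializations. In these too the transported
  functions are C1, since the fibre coordinate turns such a parametrization into a plot of
  F.\<close>

lemma partition_on_fibre:
  assumes tr: "triv U \<Phi> g" and b: "b \<in> U" and pou: "F_partition I c \<phi>"
    and P: "P \<subseteq> params b" "\<And>c. c \<in> atlas F \<Longrightarrow> (chart_img c, param g c b) \<in> P"
  shows "param_density.partition_of_unity P (fibre b) I (\<lambda>i. chart_img (c i)) (\<lambda>i. param g (c i) b) (\<lambda>i p. \<phi> i (snd (\<Phi> p)))"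
    and "i \<in> I \<Longrightarrow> param_density.C1_fun P (\<lambda>p. \<phi> i (snd (\<Phi> p)))"
proof -
  interpret param_density P "fibre b" dens by (rule param_density_params[OF P(1)])
  have i: "c i \<in> atlas F" "\<And>y. \<phi> i y \<ge> 0" "\<And>y. y \<notin> fst (c i) \<Longrightarrow> \<phi> i y = 0"
     "\<exists>K. compact K \<and> K \<subseteq> chart_img (c i) \<and> (\<forall>x\<in>chart_img (c i) - K. \<phi> i (chart_inv (c i) x) = 0)"
     "\<And>d. d \<in> atlas F \<Longrightarrow> differentiable_upto (chart_img d) (\<phi> i \<circ> chart_inv d) 1" if "i \<in> I" for i
    using pou that unfolding F_partition_def by blast+
  have C1: "differentiable_upto S ((\<lambda>p. \<phi> i (snd (\<Phi> p))) \<circ> q) 1" if i0: "i \<in> I" and Sq: "(S, q) \<in> P" for i S q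
  proof -
    obtain c' U' \<Phi>' g' where c': "c' \<in> atlas F" "triv U' \<Phi>' g'" "b \<in> U'" "S = chart_img c'" "q = param g' c' b"
      using P(1) Sq unfolding params_def by blast
    have q: "plot M S q" using plot_param[OF c'(2,3,1)] c' by simp
    have "plot F S (\<lambda>x. snd (\<Phi> (q x)))"
      using P_into[OF Sq] fibre_part[OF b] by (intro plot_fibre_coordinate[OF tr q]) blast
    from plot_differentiable_upto[OF F this i(5)[OF i0]] show ?thesis by (simp add: o_def)
  qed
  then show "i \<in> I \<Longrightarrow> C1_fun (\<lambda>p. \<phi> i (snd (\<Phi> p)))" by (auto simp: C1_fun_def)
  show "partition_of_unity I (\<lambda>i. chart_img (c i)) (\<lambda>i. param g (c i) b) (\<lambda>i p. \<phi> i (snd (\<Phi> p)))"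
    unfolding partition_of_unity_def
  proof (intro conjI ballI)
    show "finite I" using pou by (simp add: F_partition_def)
    show "(\<Sum>i\<in>I. \<phi> i (snd (\<Phi> p))) = 1" if "p \<in> fibre b" for p
      using pou triv_\<Phi>(1)[OF tr] fibre_part[OF b] that unfolding F_partition_def by blast
    fix i assume I: "i \<in> I"
    note ch = smooth_manifold_chart[OF F i(1)[OF I]]
    show "(chart_img (c i), param g (c i) b) \<in> P" by (rule P(2)[OF i(1)[OF I]])
    show "cont_fun (\<lambda>p. \<phi> i (snd (\<Phi> p)))"
      unfolding cont_fun_def
    proof clarify
      fix S q assume "(S, q) \<in> P"
      from differentiable_upto_imp_continuous_on[OF C1[OF I this]]
      show "continuous_on S ((\<lambda>p. \<phi> i (snd (\<Phi> p))) \<circ> q)" .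
    qed
    show "\<phi> i (snd (\<Phi> p)) \<ge> 0" for p by (rule i(2)[OF I])
    show "supported_in (chart_img (c i)) (param g (c i) b) (\<lambda>p. \<phi> i (snd (\<Phi> p)))"
      unfolding supported_in_def
    proof (intro conjI ballI impI)
      fix p assume p: "p \<in> fibre b" "p \<notin> param g (c i) b ` chart_img (c i)"
      have "snd (\<Phi> p) \<notin> fst (c i)"
      proof
        assume y: "snd (\<Phi> p) \<in> fst (c i)"
        have "p \<in> part U" "\<pi> p = b" using p(1) fibre_part[OF b] by (auto simp: fibre_def)
        then have "p = param g (c i) b (snd (c i) (snd (\<Phi> p)))"
          using triv_\<Phi>(2)[OF tr] is_chart_inv_left[OF ch y] by (auto simp: param_def)
        moreover have "snd (c i) (snd (\<Phi> p)) \<in> chart_img (c i)" using y by (simp add: chart_img_def)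
        ultimately show False using p(2) by blast
      qed
      then show "\<phi> i (snd (\<Phi> p)) = 0" by (rule i(3)[OF I])
    next
      show "\<exists>K. compact K \<and> K \<subseteq> chart_img (c i) \<and> (\<forall>x\<in>chart_img (c i) - K. \<phi> i (snd (\<Phi> (param g (c i) b x))) = 0)"
        using i(4)[OF I] param_fibre(2)[OF tr b i(1)[OF I]] by (metis DiffD1)
    qed
  qed
qed

text \<open>The choice is irrelevant by \<open>total_unique\<close>.\<close>

definition vol :: "'b \<Rightarrow> real" where
  "vol b = (SOME v. \<exists>(I::'c set) S q \<phi>. param_density.partition_of_unity (params b) (fibre b) I S q \<phi> \<and> v = param_density.total dens I S q \<phi>)"

lemma params_mem: "triv U \<Phi> g \<Longrightarrow> b \<in> U \<Longrightarrow> c \<in> atlas F \<Longrightarrow> (chart_img c, param g c b) \<in> params b"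
  unfolding params_def by blast

text \<open>The form in which the volume can be differentiated: with a fixed trivialization, neither
  the weights nor the domains depend on b.\<close>

lemma vol_eq:
  assumes tr: "triv U \<Phi> g" and b: "b \<in> U" and pou: "F_partition I c \<phi>"
  shows "vol b = (\<Sum>i\<in>I. integral (chart_img (c i)) (\<lambda>x. \<phi> i (chart_inv (c i) x) * dens (param g (c i) b) x))"
proof -
  interpret param_density "params b" "fibre b" dens by (rule param_density_params) simp
  have p: "partition_of_unity I (\<lambda>i. chart_img (c i)) (\<lambda>i. param g (c i) b) (\<lambda>i p. \<phi> i (snd (\<Phi> p)))"
    by (rule partition_on_fibre(1)[OF tr b pou subset_refl]) (rule params_mem[OF tr b])
  have "\<exists>(I::'c set) S q \<phi>. partition_of_unity I S q \<phi> \<and> vol b = total I S q \<phi>"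
    unfolding vol_def by (rule someI_ex) (use p in blast)
  then obtain J :: "'c set" and S q \<xi> where J: "partition_of_unity J S q \<xi>" "vol b = total J S q \<xi>" by blast
  have "vol b = total I (\<lambda>i. chart_img (c i)) (\<lambda>i. param g (c i) b) (\<lambda>i p. \<phi> i (snd (\<Phi> p)))"
    unfolding J(2) by (rule total_unique[OF J(1) p])
  also have "\<dots> = (\<Sum>i\<in>I. integral (chart_img (c i)) (\<lambda>x. \<phi> i (chart_inv (c i) x) * dens (param g (c i) b) x))"
    unfolding total_def
    using param_fibre(2)[OF tr b] pou by (intro sum.cong integral_cong refl) (auto simp: F_partition_def)
  finally show ?thesis .
qed

lemma dens_pos:
  assumes "triv U \<Phi> g" "b \<in> U" "c \<in> atlas F" "x \<in> chart_img c"
  shows "dens (param g c b) x > 0"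
  using fibre_nondegenerate[OF assms] by (simp add: dens_def vol_density_def)

text \<open>Some partition function is positive at a given point of F, so one of the continuous
  nonnegative integrands is positive somewhere.\<close>

lemma vol_pos:
  assumes b: "b \<in> points B" and ne: "points F \<noteq> {}"
  shows "vol b > 0"
proof -
  obtain U \<Phi> g where tr: "triv U \<Phi> g" and bU: "b \<in> U" using triv_exists[OF b] .
  obtain I c \<phi> where pou: "F_partition I c \<phi>" using F_partition_exists[OF b] .
  interpret param_density "params b" "fibre b" dens by (rule param_density_params) simp
  have p: "partition_of_unity I (\<lambda>i. chart_img (c i)) (\<lambda>i. param g (c i) b) (\<lambda>i p. \<phi> i (snd (\<Phi> p)))"
    by (rule partition_on_fibre(1)[OF tr bU pou subset_refl]) (rule params_mem[OF tr bU])
  have i: "c i \<in> atlas F" "\<And>y. \<phi> i y \<ge> 0" "\<And>y. y \<notin> fst (c i) \<Longrightarrow> \<phi> i y = 0" if "i \<in> I" for i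
    using pou that unfolding F_partition_def by blast+
  let ?f = "\<lambda>i x. \<phi> i (chart_inv (c i) x) * dens (param g (c i) b) x"
  have abs: "?f i absolutely_integrable_on chart_img (c i)" if "i \<in> I" for i
  proof (rule absolutely_integrable_eq)
    show "(\<lambda>x. \<phi> i (snd (\<Phi> (param g (c i) b x))) * dens (param g (c i) b) x) absolutely_integrable_on chart_img (c i)"
      using p that unfolding partition_of_unity_def by (intro supported_integrable) auto
    show "?f i x = \<phi> i (snd (\<Phi> (param g (c i) b x))) * dens (param g (c i) b) x" if "x \<in> chart_img (c i)" for x
      using param_fibre(2)[OF tr bU i(1)[OF \<open>i \<in> I\<close>] that] by simp
  qed
  have nonneg: "?f i x \<ge> 0" if "i \<in> I" "x \<in> chart_img (c i)" for i x
    using i(2)[OF that(1)] dens_pos[OF tr bU i(1)[OF that(1)] that(2)] by (intro mult_nonneg_nonneg) auto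
  obtain y where y: "y \<in> points F" using ne by blast
  have "(\<Sum>i\<in>I. \<phi> i y) \<noteq> 0" using pou y by (simp add: F_partition_def)
  then obtain j where j: "j \<in> I" "\<phi> j y \<noteq> 0" by (meson sum.not_neutral_contains_not_neutral)
  then have yc: "y \<in> fst (c j)" using i(3) by blast
  have ch: "is_chart (mtop F) (c j)" by (rule smooth_manifold_chart[OF F i(1)[OF j(1)]])
  let ?S = "chart_img (c j)" and ?x = "snd (c j) y"
  have x: "?x \<in> ?S" using yc by (simp add: chart_img_def)
  have fx: "?f j ?x > 0"
    using j i(2)[OF j(1), of y] is_chart_inv_left[OF ch yc] dens_pos[OF tr bU i(1)[OF j(1)] x] by simp
  have cont: "continuous_on ?S (?f j)"
  proof (rule continuous_on_eq)
    show "continuous_on ?S (\<lambda>x. \<phi> j (snd (\<Phi> (param g (c j) b x))) * dens (param g (c j) b) x)"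
      using p j(1) P_density[OF params_mem[OF tr bU i(1)[OF j(1)]]] params_mem[OF tr bU i(1)[OF j(1)]]
      unfolding partition_of_unity_def cont_fun_def by (intro continuous_on_mult) (auto simp: o_def)
    show "\<phi> j (snd (\<Phi> (param g (c j) b x))) * dens (param g (c j) b) x = ?f j x" if "x \<in> ?S" for x
      using param_fibre(2)[OF tr bU i(1)[OF j(1)] that] by simp
  qed
  have "integral ?S (?f j) \<noteq> 0"
  proof
    assume 0: "integral ?S (?f j) = 0"
    \<comment> \<open>On a box around the point, inside the chart image, a nonnegative continuous
      function with integral zero would have to vanish.\<close>
    obtain l u where lu: "?x \<in> box l u" "cbox l u \<subseteq> ?S"
      using is_chart_open_img[OF ch] x by (meson open_contains_cbox)
    have int: "?f j integrable_on ?S" using abs[OF j(1)] by (rule set_lebesgue_integral_eq_integral(1))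
    have intc: "?f j integrable_on cbox l u"
      using cont lu(2) by (intro integrable_continuous) (rule continuous_on_subset)
    have "integral (cbox l u) (?f j) \<le> integral ?S (?f j)"
      using nonneg[OF j(1)] by (intro integral_subset_le lu(2) int intc) auto
    moreover have "integral (cbox l u) (?f j) \<ge> 0"
      using nonneg[OF j(1)] lu(2) by (intro integral_nonneg intc) auto
    ultimately have "(?f j has_integral 0) (cbox l u)" using 0 intc by (metis antisym integrable_integral)
    moreover have "continuous_on (cbox l u) (?f j)" using cont lu(2) by (rule continuous_on_subset)
    moreover have "?f j x \<ge> 0" if "x \<in> box l u" for x
      using nonneg[OF j(1)] lu(2) box_subset_cbox that by blast
    moreover have "?x \<in> cbox l u" "box l u \<noteq> {}" using lu(1) box_subset_cbox by blast+
    ultimately have "?f j ?x = 0"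
      by (intro has_integral_0_cbox_imp_0[of l u "?f j"])
    then show False using fx by linarith
  qed
  moreover have "integral (chart_img (c i)) (?f i) \<ge> 0" if "i \<in> I" for i
    using nonneg[OF that] abs[OF that] by (intro integral_nonneg set_lebesgue_integral_eq_integral(1)) auto
  ultimately show ?thesis
    unfolding vol_eq[OF tr bU pou] using pou j(1) by (intro sum_pos2[of I j]) (auto simp: F_partition_def order.order_iff_strict)
qed

end


section \<open>Variation of the fibre volume\<close>

context lcs_fibration
begin

text \<open>Over a line, the composite of \<open>p\<close> with \<open>\<pi>\<close> is the line
  itself in the chart d; hence the Lee form pulls back to \<alpha>(w) ds, where s is the first
  coordinate.\<close>

lemma lee_along_line:
  assumes tr: "triv U \<Phi> g" and d: "d \<in> atlas B" and c: "c \<in> atlas F" and T: "open T"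
    and line: "\<And>s. s \<in> T \<Longrightarrow> y0 + s *\<^sub>R w \<in> chart_img d \<and> chart_inv d (y0 + s *\<^sub>R w) \<in> U"
  defines "p \<equiv> \<lambda>z. param g c (chart_inv d (y0 + fst z *\<^sub>R w)) (snd z)"
  assumes z: "z \<in> T \<times> chart_img c" and m: "m \<in> atlas M" "p z \<in> fst m"
  shows "pullback1 B \<pi> \<alpha> m (snd m (p z)) (frechet_derivative (snd m \<circ> p) (at z) X) =
    fst X * \<alpha> d (y0 + fst z *\<^sub>R w) w"
proof -
  have chm: "is_chart (mtop M) m" and chd: "is_chart (mtop B) d"
    using smooth_manifold_chart[OF M m(1)] smooth_manifold_chart[OF B d] by auto
  have pl: "plot M (T \<times> chart_img c) p" unfolding p_def by (rule plot_line[OF tr d c T line])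
  have \<pi>p: "\<pi> (p y) = chart_inv d (y0 + fst y *\<^sub>R w)" if "y \<in> T \<times> chart_img c" for y
  proof -
    have "p y \<in> fibre (chart_inv d (y0 + fst y *\<^sub>R w))"
      unfolding p_def using that line[of "fst y"] by (intro param_fibre(1)[OF tr _ c]) auto
    then show ?thesis by (simp add: fibre_def)
  qed
  have dy: "y0 + fst z *\<^sub>R w \<in> chart_img d" using line[of "fst z"] z by auto
  let ?y = "snd m (p z)"
  have y: "?y \<in> chart_img m" using m(2) by (simp add: chart_img_def)
  have qm: "plot B (chart_img m) (\<pi> \<circ> chart_inv m)" by (rule plot_smooth_map[OF M \<pi>_smooth m(1)])
  have \<pi>y: "(\<pi> \<circ> chart_inv m) ?y = chart_inv d (y0 + fst z *\<^sub>R w)"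
    using is_chart_inv_left[OF chm m(2)] \<pi>p[OF z] by simp
  have fd: "(\<pi> \<circ> chart_inv m) ?y \<in> fst d" unfolding \<pi>y by (rule is_chart_inv_in[OF chd dy])
  let ?h = "snd d \<circ> (\<pi> \<circ> chart_inv m)"
  have "(?h has_derivative frechet_derivative ?h (at ?y)) (at ((snd m \<circ> p) z))"
    using plot_has_derivative[OF qm d y fd] by (simp add: o_def)
  from diff_chain_at[OF plot_has_derivative[OF pl m(1) z m(2)] this]
  have comp: "((?h \<circ> (snd m \<circ> p)) has_derivative (frechet_derivative ?h (at ?y) \<circ> frechet_derivative (snd m \<circ> p) (at z))) (at z)" .
  have "((\<lambda>z. y0 + fst z *\<^sub>R w) has_derivative (frechet_derivative ?h (at ?y) \<circ> frechet_derivative (snd m \<circ> p) (at z))) (at z)"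
  proof (rule has_derivative_transform_within_open[OF comp])
    show "open ((T \<times> chart_img c) \<inter> p -` fst m)" by (rule plot_open_preimage[OF pl is_chart_openin[OF chm]])
    show "z \<in> (T \<times> chart_img c) \<inter> p -` fst m" using z m(2) by simp
    fix y assume y: "y \<in> (T \<times> chart_img c) \<inter> p -` fst m"
    then have "y0 + fst y *\<^sub>R w \<in> chart_img d" using line[of "fst y"] by auto
    then show "(?h \<circ> (snd m \<circ> p)) y = y0 + fst y *\<^sub>R w"
      using y is_chart_inv_left[OF chm] \<pi>p[of y] is_chart_inv_right[OF chd] by simp
  qed
  moreover have "((\<lambda>z::real \<times> 'f. y0 + fst z *\<^sub>R w) has_derivative (\<lambda>X. fst X *\<^sub>R w)) (at z)"
    by (auto intro!: derivative_eq_intros)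
  ultimately have "frechet_derivative ?h (at ?y) \<circ> frechet_derivative (snd m \<circ> p) (at z) = (\<lambda>X. fst X *\<^sub>R w)"
    by (rule has_derivative_unique)
  from fun_cong[OF this, of X] have D: "frechet_derivative ?h (at ?y) (frechet_derivative (snd m \<circ> p) (at z) X) = fst X *\<^sub>R w"
    by simp
  have "linear (\<alpha> d (y0 + fst z *\<^sub>R w))" using \<alpha> d dy unfolding one_form_def by blast
  then show ?thesis
    unfolding pullback1_eq_pull1 pull1_chart[OF B \<alpha> qm d y fd] D unfolding \<pi>y is_chart_inv_right[OF chd dy]
    by (simp add: linear_scale)
qed

text \<open>The Lee equation d\<Omega> = \<alpha>(w) ds \<and> \<Omega> on the family. On three
  vertical vectors it says that the slice forms are closed; with (1, 0) and two vertical vectors it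
  gives their variation.\<close>

lemma pull2_line_ext:
  assumes tr: "triv U \<Phi> g" and d: "d \<in> atlas B" and c: "c \<in> atlas F" and T: "open T"
    and line: "\<And>s. s \<in> T \<Longrightarrow> y0 + s *\<^sub>R w \<in> chart_img d \<and> chart_inv d (y0 + s *\<^sub>R w) \<in> U"
  defines "p \<equiv> \<lambda>z. param g c (chart_inv d (y0 + fst z *\<^sub>R w)) (snd z)"
  assumes z: "z \<in> T \<times> chart_img c"
  shows "frechet_derivative (\<lambda>z. pull2 M \<Omega> p z Y Z) (at z) X - frechet_derivative (\<lambda>z. pull2 M \<Omega> p z X Z) (at z) Y
      + frechet_derivative (\<lambda>z. pull2 M \<Omega> p z X Y) (at z) Z =
    \<alpha> d (y0 + fst z *\<^sub>R w) w * (fst X * pull2 M \<Omega> p z Y Z - fst Y * pull2 M \<Omega> p z X Z + fst Z * pull2 M \<Omega> p z X Y)"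
proof -
  have pl: "plot M (T \<times> chart_img c) p" unfolding p_def by (rule plot_line[OF tr d c T line])
  obtain m where m: "m \<in> atlas M" "p z \<in> fst m"
    using smooth_manifold_cover[OF M plot_mem[OF pl z]] by blast
  let ?D = "frechet_derivative (snd m \<circ> p) (at z)" and ?y = "snd m (p z)"
  have "?y \<in> chart_img m" using m(2) by (simp add: chart_img_def)
  then have "ext_d2 \<Omega> m ?y (?D X) (?D Y) (?D Z) = wedge12 (pullback1 B \<pi> \<alpha>) \<Omega> m ?y (?D X) (?D Y) (?D Z)"
    using lee m(1) unfolding lee_form_def by blast
  moreover have "pullback1 B \<pi> \<alpha> m ?y (?D X) = fst X * \<alpha> d (y0 + fst z *\<^sub>R w) w" for X
    using lee_along_line[OF tr d c T line, of z m X] z m unfolding p_def by blast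
  ultimately show ?thesis
    unfolding pull2_ext_d2[OF M \<Omega> pl z m] wedge12_def pull2_chart[OF M \<Omega> pl m(1) z m(2)]
    by (simp add: algebra_simps)
qed

text \<open>Each summand of \<open>vol_eq\<close> obeys \<open>localized_volume_variation\<close>.
  The error terms are derivatives of the partition functions along one field on the fibre, so they
  add up to zero by \<open>sum_integral_field_deriv\<close>.\<close>

lemma vol_variation:
  assumes tr: "triv U \<Phi> g" and d: "d \<in> atlas B" and y0: "y0 \<in> chart_img d" "chart_inv d y0 \<in> U"
  shows "((\<lambda>s. vol (chart_inv d (y0 + s *\<^sub>R w))) has_real_derivative
    real DIM('f) / 2 * \<alpha> d y0 w * vol (chart_inv d y0)) (at 0)"
proof -
  have chd: "is_chart (mtop B) d" by (rule smooth_manifold_chart[OF B d])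
  define b where "b = (\<lambda>s. chart_inv d (y0 + s *\<^sub>R w))"
  have "open ((\<lambda>s. y0 + s *\<^sub>R w) -` {y \<in> chart_img d. chart_inv d y \<in> U})"
    by (intro open_vimage is_chart_vimage_open[OF chd triv_openin[OF tr]] continuous_intros)
  then obtain e where e: "e > 0" "ball 0 e \<subseteq> (\<lambda>s. y0 + s *\<^sub>R w) -` {y \<in> chart_img d. chart_inv d y \<in> U}"
    using y0 by (metis (no_types, lifting) add.right_neutral mem_Collect_eq open_contains_ball scaleR_zero_left vimageI)
  \<comment> \<open>A ball, because differentiation under the integral is carried out on an open
    convex set of parameters.\<close>
  define T where "T = ball (0::real) e"
  have T: "open T" "convex T" "0 \<in> T" using e(1) by (auto simp: T_def)
  have line: "y0 + s *\<^sub>R w \<in> chart_img d \<and> chart_inv d (y0 + s *\<^sub>R w) \<in> U" if "s \<in> T" for s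
    using e(2) that by (auto simp: T_def)
  have bU: "b s \<in> U" if "s \<in> T" for s using line[OF that] by (simp add: b_def)
  have b0: "b 0 = chart_inv d y0" by (simp add: b_def)
  have bB: "b 0 \<in> points B" using bU[OF T(3)] openin_subset[OF triv_openin[OF tr]] by blast
  define p where "p = (\<lambda>c z. param g c (b (fst z)) (snd z))"
  have p_def': "p c = (\<lambda>z. param g c (chart_inv d (y0 + fst z *\<^sub>R w)) (snd z))" for c
    by (simp add: p_def b_def)
  \<comment> \<open>The restriction of the form to the slices; \<open>\<beta>\<close> is the
    contraction with the direction of the line, restricted in the same way.\<close>
  define \<omega> where "\<omega> = (\<lambda>c z u v. pull2 M \<Omega> (p c) z (0::real, u) (0, v))"
  define \<beta> where "\<beta> = (\<lambda>c z v. pull2 M \<Omega> (p c) z (1::real, 0) (0, v))"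
  have pl: "plot M (T \<times> chart_img c) (p c)" if "c \<in> atlas F" for c
    unfolding p_def' by (rule plot_line[OF tr d that T(1) line])
  have slice: "pull2 M \<Omega> (param g c (b s)) x u v = \<omega> c (s, x) u v" if c: "c \<in> atlas F" and s: "s \<in> T" and x: "x \<in> chart_img c" for c s x u v
  proof -
    have "((\<lambda>x::'f. (s, x)) has_derivative (\<lambda>u. (0, u))) (at x)" by (auto intro!: derivative_eq_intros)
    from pull2_compose[OF M \<Omega> plot_param[OF tr bU[OF s] c] x pl[OF c] this, of UNIV u v] s x
    show ?thesis by (simp add: p_def \<omega>_def)
  qed
  have slice': "pull2 M \<Omega> (param g c (b s)) x = \<omega> c (s, x)" if "c \<in> atlas F" "s \<in> T" "x \<in> chart_img c" for c s x
    using slice[OF that] by (intro ext)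
  have det: "det (form_matrix (\<omega> c z)) \<noteq> 0" if c: "c \<in> atlas F" and z: "z \<in> T \<times> chart_img c" for c z
    using fibre_nondegenerate[OF tr bU c, of "fst z" "snd z"] slice'[OF c, of "fst z" "snd z"] z by auto
  have sm: "differentiable_upto (T \<times> chart_img c) (\<lambda>z. pull2 M \<Omega> (p c) z u v) 1" if "c \<in> atlas F" for c u v
    by (rule smooth_on_imp[OF pull2_smooth[OF M \<Omega> pl[OF that]]])
  have bil: "bilinear (pull2 M \<Omega> (p c) z)" if "c \<in> atlas F" "z \<in> T \<times> chart_img c" for c z
    by (rule pull2_bilinear[OF M \<Omega> pl[OF that(1)] that(2)])
  have ext: "frechet_derivative (\<lambda>z. pull2 M \<Omega> (p c) z Y Z) (at z) X - frechet_derivative (\<lambda>z. pull2 M \<Omega> (p c) z X Z) (at z) Y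
      + frechet_derivative (\<lambda>z. pull2 M \<Omega> (p c) z X Y) (at z) Z =
    \<alpha> d (y0 + fst z *\<^sub>R w) w * (fst X * pull2 M \<Omega> (p c) z Y Z - fst Y * pull2 M \<Omega> (p c) z X Z + fst Z * pull2 M \<Omega> (p c) z X Y)"
    if "c \<in> atlas F" "z \<in> T \<times> chart_img c" for c z X Y Z
    unfolding p_def' by (rule pull2_line_ext[OF tr d that(1) T(1) line that(2)])
  have \<omega>bil: "bilinear (\<omega> c z)" if "c \<in> atlas F" "z \<in> T \<times> chart_img c" for c z
  proof -
    have L: "linear (\<lambda>v::'f. (0::real, v))" by (rule linearI) auto
    have "linear (\<lambda>v. pull2 M \<Omega> (p c) z X (0, v))" "linear (\<lambda>u. pull2 M \<Omega> (p c) z (0, u) X)" for X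
      using linear_compose[OF L, of "pull2 M \<Omega> (p c) z X"] linear_compose[OF L, of "\<lambda>u. pull2 M \<Omega> (p c) z u X"]
        bil[OF that] unfolding bilinear_def by (simp_all add: o_def)
    then show ?thesis by (simp add: bilinear_def \<omega>_def)
  qed
  have \<beta>lin: "linear (\<beta> c z)" if "c \<in> atlas F" "z \<in> T \<times> chart_img c" for c z
  proof -
    have L: "linear (\<lambda>v::'f. (0::real, v))" by (rule linearI) auto
    have "linear (\<lambda>v. pull2 M \<Omega> (p c) z (1, 0) (0, v))"
      using linear_compose[OF L, of "pull2 M \<Omega> (p c) z (1, 0)"] bil[OF that] unfolding bilinear_def by (simp add: o_def)
    then show ?thesis by (simp add: \<beta>_def[abs_def])
  qed
  \<comment> \<open>One partition of the typical fibre serves all fibres over the line.\<close>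
  obtain I c \<phi> where pou: "F_partition I c \<phi>" using F_partition_exists[OF bB] .
  have i: "finite I" "c i \<in> atlas F" "\<exists>K. compact K \<and> K \<subseteq> chart_img (c i) \<and> (\<forall>x\<in>chart_img (c i) - K. \<phi> i (chart_inv (c i) x) = 0)"
     "differentiable_upto (chart_img (c i)) (\<phi> i \<circ> chart_inv (c i)) 1" if "i \<in> I" for i
    using pou that unfolding F_partition_def by blast+
  let ?S = "\<lambda>i. chart_img (c i)" and ?h = "\<lambda>i. \<phi> i \<circ> chart_inv (c i)"
  let ?J = "\<lambda>i s. integral (?S i) (\<lambda>x. ?h i x * vol_density (\<omega> (c i) (s, x)))"
  let ?E = "\<lambda>i. integral (?S i) (\<lambda>x. frechet_derivative (?h i) (at x) (dual_field (\<omega> (c i) (0, x)) (\<beta> (c i) (0, x))) * vol_density (\<omega> (c i) (0, x)))"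
  have vol: "vol (b s) = (\<Sum>i\<in>I. ?J i s)" if "s \<in> T" for s
    unfolding vol_eq[OF tr bU[OF that] pou] dens_def
    using slice'[OF i(2) that] by (intro sum.cong integral_cong refl) auto
  have dJ: "(?J i has_real_derivative real DIM('f) / 2 * \<alpha> d y0 w * ?J i 0 - ?E i) (at 0)" if I: "i \<in> I" for i
  proof -
    note ci = i(2)[OF I]
    obtain K where K: "compact K" "K \<subseteq> ?S i" "\<And>x. x \<in> ?S i - K \<Longrightarrow> ?h i x = 0" using i(3)[OF I] by auto
    have "(?J i has_real_derivative real DIM('f) / 2 * \<alpha> d (y0 + 0 *\<^sub>R w) w * ?J i 0 - ?E i) (at 0)"
    proof (rule localized_volume_variation[where T = T and a = "\<lambda>s. \<alpha> d (y0 + s *\<^sub>R w) w" and K = K and h = "?h i"])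
      show "open T" "convex T" "0 \<in> T" using T by auto
      show "compact K" "K \<subseteq> ?S i" by (rule K)+
      show "?h i x = 0" if "x \<in> ?S i - K" for x using that by (rule K(3))
      show "differentiable_upto (?S i) (?h i) 1" by (rule i(4)[OF I])
      show "open (?S i)" by (rule is_chart_open_img[OF smooth_manifold_chart[OF F ci]])
      show "differentiable_upto (T \<times> ?S i) (\<lambda>z. \<omega> (c i) z u v) 1" for u v unfolding \<omega>_def by (rule sm[OF ci])
      show "differentiable_upto (T \<times> ?S i) (\<lambda>z. \<beta> (c i) z v) 1" for v unfolding \<beta>_def by (rule sm[OF ci])
      fix z assume z: "z \<in> T \<times> ?S i"
      show "\<omega> (c i) z u v = - \<omega> (c i) z v u" for u v
        unfolding \<omega>_def by (rule pull2_antisym[OF M \<Omega> pl[OF ci] z])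
      show "det (form_matrix (\<omega> (c i) z)) \<noteq> 0" by (rule det[OF ci z])
      show "frechet_derivative (\<lambda>z. \<omega> (c i) z v w) (at z) (0, u) - frechet_derivative (\<lambda>z. \<omega> (c i) z u w) (at z) (0, v)
          + frechet_derivative (\<lambda>z. \<omega> (c i) z u v) (at z) (0, w) = 0" for u v w
        using ext[OF ci z, of "(0, v)" "(0, w)" "(0, u)"] by (simp add: \<omega>_def)
      show "frechet_derivative (\<lambda>z. \<omega> (c i) z u v) (at z) (1, 0) = \<alpha> d (y0 + fst z *\<^sub>R w) w * \<omega> (c i) z u v
          + frechet_derivative (\<lambda>z. \<beta> (c i) z v) (at z) (0, u) - frechet_derivative (\<lambda>z. \<beta> (c i) z u) (at z) (0, v)" for u v
        using ext[OF ci z, of "(0, u)" "(0, v)" "(1, 0)"] by (simp add: \<omega>_def \<beta>_def algebra_simps)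
    qed
    then show ?thesis by simp
  qed
  \<comment> \<open>The field has to be a function of the parametrization \<open>q\<close> alone, not of the chart behind it.\<close>
  define \<zeta> where "\<zeta> = (\<lambda>(q :: 'f \<Rightarrow> 'a) x. let r = (\<lambda>z. g (b (fst z), snd (\<Phi> (q (snd z))))) in
     dual_field (\<lambda>u v. pull2 M \<Omega> r (0, x) (0, u) (0, v)) (\<lambda>v. pull2 M \<Omega> r (0, x) (1, 0) (0, v)))"
  have \<zeta>: "\<zeta> (param g c (b 0)) x = dual_field (\<omega> c (0, x)) (\<beta> c (0, x))" if c: "c \<in> atlas F" and x: "x \<in> chart_img c" for c x
  proof -
    let ?r = "\<lambda>z. g (b (fst z), snd (\<Phi> (param g c (b 0) (snd z))))"
    have r: "?r z = p c z" if "z \<in> T \<times> chart_img c" for z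
      using param_fibre(2)[OF tr bU[OF T(3)] c] that by (auto simp: p_def param_def)
    have x0: "(0, x) \<in> T \<times> chart_img c" using T(3) x by simp
    have "pull2 M \<Omega> ?r (0, x) u v = pull2 M \<Omega> (p c) (0, x) u v" for u v
      by (rule pull2_compose[OF M \<Omega> plot_cong[OF M pl[OF c] r] x0 pl[OF c] has_derivative_ident x0 plot_open[OF pl[OF c]] x0 r])
    then show ?thesis by (simp add: \<zeta>_def \<omega>_def \<beta>_def Let_def)
  qed
  \<comment> \<open>Only the parametrizations that come from \<open>g\<close>: the transitions
    between them are those of F and do not depend on the position on the line.\<close>
  let ?P = "{(chart_img c, param g c (b 0)) | c. c \<in> atlas F}"
  have P: "?P \<subseteq> params (b 0)" using params_mem[OF tr bU[OF T(3)]] by blast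
  interpret param_density ?P "fibre (b 0)" dens by (rule param_density_params[OF P])
  have \<zeta>comp: "compatible_field \<zeta>"
    unfolding compatible_field_def
  proof (clarify, intro conjI allI ballI)
    fix c k assume c: "c \<in> atlas F"
    have "differentiable_upto (T \<times> chart_img c) (\<lambda>z. dual_field (\<omega> c z) (\<beta> c z) \<bullet> bvec k) 1"
      unfolding \<omega>_def \<beta>_def
      using det[OF c] by (intro dual_field_differentiable_upto plot_open[OF pl[OF c]] sm[OF c]) (auto simp: \<omega>_def)
    then have "continuous_on (T \<times> chart_img c) (\<lambda>z. dual_field (\<omega> c z) (\<beta> c z) \<bullet> bvec k)"
      by (rule differentiable_upto_imp_continuous_on)
    then have "continuous_on (chart_img c) (\<lambda>x. dual_field (\<omega> c (0, x)) (\<beta> c (0, x)) \<bullet> bvec k)"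
      by (rule continuous_on_compose2) (use T(3) in \<open>auto intro!: continuous_intros\<close>)
    then show "continuous_on (chart_img c) (\<lambda>x. \<zeta> (param g c (b 0)) x \<bullet> bvec k)"
      by (rule continuous_on_eq) (simp add: \<zeta>[OF c])
  next
    fix c z assume c: "c \<in> atlas F" and "z \<in> ?P"
    then obtain c' where c': "c' \<in> atlas F" and z: "z = (chart_img c', param g c' (b 0))" by blast
    have chc: "is_chart (mtop F) c" and chc': "is_chart (mtop F) c'"
      using smooth_manifold_chart[OF F] c c' by auto
    show "case z of (S', q') \<Rightarrow> \<forall>x\<in>chart_img c. \<forall>y\<in>S'. param g c (b 0) x = q' y \<longrightarrow>
       (\<exists>\<tau> \<tau>' U. open U \<and> x \<in> U \<and> U \<subseteq> chart_img c \<and> (\<forall>x\<in>U. \<tau> x \<in> S' \<and> q' (\<tau> x) = param g c (b 0) x) \<and>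
         (\<tau> has_derivative \<tau>') (at x) \<and> \<tau>' (\<zeta> (param g c (b 0)) x) = \<zeta> q' y)"
      unfolding z prod.case
    proof (intro ballI impI)
      fix x y assume x: "x \<in> chart_img c" and y: "y \<in> chart_img c'" and xy: "param g c (b 0) x = param g c' (b 0) y"
      have inv: "chart_inv c x = chart_inv c' y"
        using xy param_fibre(2)[OF tr bU[OF T(3)] c x] param_fibre(2)[OF tr bU[OF T(3)] c' y] by simp
      let ?\<tau> = "transition c c'" and ?\<sigma> = "transition c' c"
      let ?D = "frechet_derivative ?\<tau> (at x)" and ?D' = "frechet_derivative ?\<sigma> (at y)"
      have U: "open (overlap c c')" "open (overlap c' c)"
        unfolding overlap_def using is_chart_open_image[OF chc is_chart_openin[OF chc']] is_chart_open_image[OF chc' is_chart_openin[OF chc]] by auto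
      have xU: "x \<in> overlap c c'" and yU: "y \<in> overlap c' c"
        using overlap_mem[of "chart_inv c x" c c'] overlap_mem[of "chart_inv c' y" c' c] is_chart_inv_in[OF chc x] is_chart_inv_in[OF chc' y]
          is_chart_inv_right[OF chc x] is_chart_inv_right[OF chc' y] inv by auto
      have \<tau>x: "?\<tau> x = y" using inv is_chart_inv_right[OF chc' y] by (simp add: transition_def)
      have \<sigma>y: "?\<sigma> y = x" using inv is_chart_inv_right[OF chc x] by (simp add: transition_def)
      have \<tau>U: "?\<tau> x' \<in> chart_img c'" "chart_inv c' (?\<tau> x') = chart_inv c x'" if x': "x' \<in> overlap c c'" for x'
      proof -
        obtain a where "a \<in> fst c" "a \<in> fst c'" "x' = snd c a" using x' by (auto simp: overlap_def)
        then show "?\<tau> x' \<in> chart_img c'" "chart_inv c' (?\<tau> x') = chart_inv c x'"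
          using is_chart_inv_left[OF chc] is_chart_inv_left[OF chc'] by (auto simp: transition_def chart_img_def)
      qed
      have d\<tau>: "(?\<tau> has_derivative ?D) (at x)"
        by (rule smooth_on_has_derivative[OF smooth_manifold_transition[OF F c c'] xU])
      have d\<sigma>: "(?\<sigma> has_derivative ?D') (at y)"
        by (rule smooth_on_has_derivative[OF smooth_manifold_transition[OF F c' c] yU])
      \<comment> \<open>Shows that \<open>?D\<close> is surjective, so that every test vector of the
        duality equation at y is of the form \<open>?D (?D' v)\<close>.\<close>
      have onto: "?D (?D' v) = v" for v
      proof -
        have "((?\<tau> \<circ> ?\<sigma>) has_derivative (?D \<circ> ?D')) (at y)" by (rule diff_chain_at[OF d\<sigma>]) (simp only: \<sigma>y d\<tau>)
        then have "((\<lambda>y. y) has_derivative (?D \<circ> ?D')) (at y)"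
        proof (rule has_derivative_transform_within_open[OF _ U(2) yU])
          fix y' assume "y' \<in> overlap c' c"
          then obtain a where "a \<in> fst c" "a \<in> fst c'" "y' = snd c' a" by (auto simp: overlap_def)
          then show "(?\<tau> \<circ> ?\<sigma>) y' = y'" by (simp add: transition_apply[OF chc] transition_apply[OF chc'])
        qed
        from has_derivative_unique[OF this has_derivative_ident] show ?thesis by (simp add: fun_eq_iff)
      qed
      let ?f = "\<lambda>z. (fst z, ?\<tau> (snd z))" and ?f' = "\<lambda>X. (fst X, ?D (snd X))"
      have df: "(?f has_derivative ?f') (at (0::real, x))"
      proof -
        have "((\<lambda>z::real \<times> 'f. ?\<tau> (snd z)) has_derivative (\<lambda>X. ?D (snd X))) (at (0, x))"
          using diff_chain_at[OF bounded_linear_imp_has_derivative[OF bounded_linear_snd], of ?\<tau> ?D "(0, x)"] d\<tau> by (simp add: o_def)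
        then show ?thesis by (intro has_derivative_Pair bounded_linear_imp_has_derivative[OF bounded_linear_fst])
      qed
      have x0: "(0, x) \<in> T \<times> chart_img c" and y0': "(0, y) \<in> T \<times> chart_img c'" using T(3) x y by auto
      have pull: "pull2 M \<Omega> (p c) (0, x) X Y = pull2 M \<Omega> (p c') (0, y) (?f' X) (?f' Y)" for X Y
      proof -
        have "pull2 M \<Omega> (p c) (0, x) X Y = pull2 M \<Omega> (p c') (?f (0, x)) (?f' X) (?f' Y)"
        proof (rule pull2_compose[OF M \<Omega> pl[OF c] x0 pl[OF c'] df])
          show "?f (0, x) \<in> T \<times> chart_img c'" using y0' \<tau>x by simp
          show "open (T \<times> overlap c c')" using T(1) U(1) by (rule open_Times)
          show "(0, x) \<in> T \<times> overlap c c'" using T(3) xU by simp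
          show "p c z = p c' (?f z)" if "z \<in> T \<times> overlap c c'" for z
            using \<tau>U(2)[of "snd z"] that by (auto simp: p_def param_def)
        qed
        then show ?thesis by (simp add: \<tau>x)
      qed
      let ?Z = "dual_field (\<omega> c (0, x)) (\<beta> c (0, x))" and ?Z' = "dual_field (\<omega> c' (0, y)) (\<beta> c' (0, y))"
      have D0: "?D 0 = 0" using d\<tau> by (metis has_derivative_linear linear_0)
      \<comment> \<open>The transition identifies both \<open>\<omega>\<close> and
        \<open>\<beta>\<close> at x with those at y, so both vectors solve the same equation;
        nondegeneracy then makes them equal.\<close>
      have "\<omega> c' (0, y) (?D ?Z) v = \<omega> c' (0, y) ?Z' v" for v
      proof -
        have "\<omega> c' (0, y) (?D ?Z) (?D (?D' v)) = \<omega> c (0, x) ?Z (?D' v)" by (simp add: \<omega>_def pull)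
        also have "\<dots> = \<beta> c (0, x) (?D' v)" by (rule dual_field[OF det[OF c x0] \<omega>bil[OF c x0] \<beta>lin[OF c x0]])
        also have "\<dots> = \<beta> c' (0, y) (?D (?D' v))" by (simp add: \<beta>_def pull D0)
        also have "\<dots> = \<omega> c' (0, y) ?Z' (?D (?D' v))"
          by (rule dual_field[OF det[OF c' y0'] \<omega>bil[OF c' y0'] \<beta>lin[OF c' y0'], symmetric])
        finally show ?thesis by (simp add: onto)
      qed
      then have Z: "?D ?Z = ?Z'" by (rule dual_field_unique[OF det[OF c' y0'] \<omega>bil[OF c' y0']])
      show "\<exists>\<tau> \<tau>' U. open U \<and> x \<in> U \<and> U \<subseteq> chart_img c \<and> (\<forall>x\<in>U. \<tau> x \<in> chart_img c' \<and> param g c' (b 0) (\<tau> x) = param g c (b 0) x) \<and>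
         (\<tau> has_derivative \<tau>') (at x) \<and> \<tau>' (\<zeta> (param g c (b 0)) x) = \<zeta> (param g c' (b 0)) y"
      proof (rule exI[of _ ?\<tau>], rule exI[of _ ?D], rule exI[of _ "overlap c c'"], intro conjI ballI)
        show "open (overlap c c')" "x \<in> overlap c c'" "(?\<tau> has_derivative ?D) (at x)" by (fact U(1) xU d\<tau>)+
        show "overlap c c' \<subseteq> chart_img c" by (rule overlap_subset)
        show "?\<tau> x' \<in> chart_img c'" "param g c' (b 0) (?\<tau> x') = param g c (b 0) x'" if "x' \<in> overlap c c'" for x'
          using \<tau>U[OF that] by (auto simp: param_def)
        show "?D (\<zeta> (param g c (b 0)) x) = \<zeta> (param g c' (b 0)) y" unfolding \<zeta>[OF c x] \<zeta>[OF c' y] by (rule Z)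
      qed
    qed
  qed
  have E0: "(\<Sum>i\<in>I. ?E i) = 0"
  proof -
    have "partition_of_unity I ?S (\<lambda>i. param g (c i) (b 0)) (\<lambda>i p. \<phi> i (snd (\<Phi> p)))"
      by (rule partition_on_fibre(1)[OF tr bU[OF T(3)] pou P]) blast
    moreover have "C1_fun (\<lambda>p. \<phi> i (snd (\<Phi> p)))" if "i \<in> I" for i
      by (rule partition_on_fibre(2)[OF tr bU[OF T(3)] pou P _ that]) blast
    ultimately have "(\<Sum>i\<in>I. integral (?S i) (\<lambda>x. frechet_derivative ((\<lambda>p. \<phi> i (snd (\<Phi> p))) \<circ> param g (c i) (b 0)) (at x)
       (\<zeta> (param g (c i) (b 0)) x) * dens (param g (c i) (b 0)) x)) = 0"
      using \<zeta>comp by (rule sum_integral_field_deriv)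
    moreover have "frechet_derivative ((\<lambda>p. \<phi> i (snd (\<Phi> p))) \<circ> param g (c i) (b 0)) (at x)
       (\<zeta> (param g (c i) (b 0)) x) * dens (param g (c i) (b 0)) x =
       frechet_derivative (?h i) (at x) (dual_field (\<omega> (c i) (0, x)) (\<beta> (c i) (0, x))) * vol_density (\<omega> (c i) (0, x))"
      if "i \<in> I" "x \<in> ?S i" for i x
    proof -
      have "frechet_derivative ((\<lambda>p. \<phi> i (snd (\<Phi> p))) \<circ> param g (c i) (b 0)) (at x) = frechet_derivative (?h i) (at x)"
        using param_fibre(2)[OF tr bU[OF T(3)] i(2)[OF that(1)]]
        by (intro frechet_derivative_cong_open[OF is_chart_open_img[OF smooth_manifold_chart[OF F i(2)[OF that(1)]]] that(2)]) auto
      then show ?thesis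
        using \<zeta>[OF i(2)[OF that(1)] that(2)] slice'[OF i(2)[OF that(1)] T(3) that(2)] by (simp add: dens_def)
    qed
    ultimately show ?thesis by (simp cong: sum.cong integral_cong)
  qed
  have "((\<lambda>s. \<Sum>i\<in>I. ?J i s) has_real_derivative (\<Sum>i\<in>I. real DIM('f) / 2 * \<alpha> d y0 w * ?J i 0 - ?E i)) (at 0)"
    by (intro DERIV_sum dJ)
  also have "(\<Sum>i\<in>I. real DIM('f) / 2 * \<alpha> d y0 w * ?J i 0 - ?E i) = real DIM('f) / 2 * \<alpha> d y0 w * vol (b 0)"
    unfolding sum_subtractf E0 vol[OF T(3)] by (simp add: sum_distrib_left)
  finally have "((\<lambda>s. vol (b s)) has_real_derivative real DIM('f) / 2 * \<alpha> d y0 w * vol (b 0)) (at 0)"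
    by (rule has_field_derivative_transform_within_open[OF _ T(1) T(3)]) (simp add: vol)
  then show ?thesis unfolding b0 by (simp add: b_def)
qed

end


section \<open>From the cohomology class of the Lee form to its primitive\<close>

lemma ext_d0_zero: "ext_d0 (\<lambda>p. 0) c x v = 0"
  by (simp add: ext_d0_def o_def)

lemma cohomologous_refl: "closed_one_form M \<theta> \<Longrightarrow> cohomologous M \<theta> \<theta>"
  unfolding cohomologous_def smooth_function_def
  by (auto intro!: exI[of _ "\<lambda>p. 0"] simp: ext_d0_zero o_def smooth_on_def differentiable_upto_const)

text \<open>The class of \<open>\<theta>\<close> is the image of a class A and contains
  \<open>\<theta>\<close> by reflexivity, so unfolding \<open>H1_map\<close> yields a suitable
  representative in A.\<close>

lemma H1_iso_surjective:
  assumes iso: "H1_iso M B \<pi>" and \<theta>: "closed_one_form M \<theta>"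
  obtains \<alpha> where "closed_one_form B \<alpha>" "cohomologous M \<theta> (pullback1 B \<pi> \<alpha>)"
proof -
  let ?R = "{(\<alpha>, \<beta>). cohomologous M \<alpha> \<beta>}"
  have "?R `` {\<theta>} \<in> H1 M" unfolding H1_def using \<theta> by (intro quotientI) simp
  moreover have "H1_map M B \<pi> ` H1 B = H1 M" using iso unfolding H1_iso_def bij_betw_def by (rule conjunct2)
  ultimately have "?R `` {\<theta>} \<in> H1_map M B \<pi> ` H1 B" by (simp only:)
  then obtain A where A: "H1_map M B \<pi> A = ?R `` {\<theta>}" "A \<in> H1 B" by (elim imageE) (rule that, rule sym)
  have "\<theta> \<in> ?R `` {\<theta>}" using cohomologous_refl[OF \<theta>] by simp
  then obtain \<alpha> where \<alpha>: "\<alpha> \<in> A" "cohomologous M \<theta> (pullback1 B \<pi> \<alpha>)"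
    unfolding A(1)[symmetric] H1_map_def by blast
  have "closed_one_form B \<alpha>"
  proof -
    obtain x where "A = {(\<alpha>, \<beta>). cohomologous B \<alpha> \<beta>} `` {x}" using A(2) unfolding H1_def by (rule quotientE)
    then have "cohomologous B x \<alpha>" using \<alpha>(1) by simp
    then show ?thesis by (simp add: cohomologous_def)
  qed
  then show thesis using \<alpha>(2) that by blast
qed

context lcs_fibration
begin

lemma points_F_nonempty: "points M \<noteq> {} \<Longrightarrow> points F \<noteq> {}"
proof -
  assume "points M \<noteq> {}"
  then obtain x where x: "x \<in> points M" by blast
  obtain U \<Phi> g where tr: "triv U \<Phi> g" "\<pi> x \<in> U" using triv_exists[OF \<pi>_points[OF x]] .
  have "x \<in> part U" using x tr(2) by (simp add: part_def)
  from triv_\<Phi>(1)[OF tr(1) this] show ?thesis by blast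
qed

text \<open>The constant is the inverse of the factor n/2 in \<open>vol_variation\<close>, so that
  the differential becomes \<open>\<alpha>\<close> exactly; the dimension of a Euclidean space is
  never 0.\<close>

definition log_vol :: "'b \<Rightarrow> real" where
  "log_vol b = 2 / real DIM('f) * ln (vol b)"

text \<open>\<open>vol_variation\<close> yields derivatives along lines. Since they are linear in
  the direction and continuous in the point, \<open>directional_imp_has_derivative\<close> combines
  them into a total derivative.\<close>

lemma log_vol_has_derivative:
  assumes ne: "points M \<noteq> {}" and d: "d \<in> atlas B" and y: "y \<in> chart_img d"
  shows "((\<lambda>y. log_vol (chart_inv d y)) has_derivative \<alpha> d y) (at y)"
proof (rule directional_imp_has_derivative[OF _ _ _ _ y])
  have chd: "is_chart (mtop B) d" by (rule smooth_manifold_chart[OF B d])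
  show "open (chart_img d)" by (rule is_chart_open_img[OF chd])
  show "linear (\<alpha> d y)" if "y \<in> chart_img d" for y using \<alpha> d that unfolding one_form_def by blast
  show "continuous_on (chart_img d) (\<lambda>y. \<alpha> d y w)" for w
    using \<alpha> d unfolding one_form_def by (intro differentiable_upto_imp_continuous_on smooth_on_imp) blast
  fix y w assume y: "y \<in> chart_img d"
  have yB: "chart_inv d y \<in> points B" using is_chart_inv_in[OF chd y] is_chart_subset[OF chd] by blast
  obtain U \<Phi> g where tr: "triv U \<Phi> g" "chart_inv d y \<in> U" using triv_exists[OF yB] .
  have pos: "vol (chart_inv d (y + 0 *\<^sub>R w)) > 0" using vol_pos[OF yB points_F_nonempty[OF ne]] by simp
  have "((\<lambda>s. ln (vol (chart_inv d (y + s *\<^sub>R w)))) has_real_derivative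
      1 / vol (chart_inv d (y + 0 *\<^sub>R w)) * (real DIM('f) / 2 * \<alpha> d y w * vol (chart_inv d y))) (at 0)"
    by (rule DERIV_chain2[where f = ln and g = "\<lambda>s. vol (chart_inv d (y + s *\<^sub>R w))",
        OF DERIV_ln_divide[OF pos] vol_variation[OF tr(1) d y tr(2)]])
  from DERIV_cmult[OF this, of "2 / real DIM('f)"]
  show "((\<lambda>s. log_vol (chart_inv d (y + s *\<^sub>R w))) has_real_derivative \<alpha> d y w) (at 0)"
    unfolding log_vol_def using pos by simp
qed

text \<open>Chain rule; the chart chosen inside \<open>pullback1\<close> is replaced by the chart at
  hand through \<open>pull1_chart\<close>.\<close>

lemma log_vol_pullback_has_derivative:
  assumes m: "m \<in> atlas M" and x: "x \<in> chart_img m"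
  shows "((log_vol \<circ> \<pi> \<circ> chart_inv m) has_derivative pullback1 B \<pi> \<alpha> m x) (at x)"
proof -
  have chm: "is_chart (mtop M) m" by (rule smooth_manifold_chart[OF M m])
  have q: "plot B (chart_img m) (\<pi> \<circ> chart_inv m)" by (rule plot_smooth_map[OF M \<pi>_smooth m])
  obtain d where d: "d \<in> atlas B" "(\<pi> \<circ> chart_inv m) x \<in> fst d"
    using smooth_manifold_cover[OF B plot_mem[OF q x]] by blast
  have chd: "is_chart (mtop B) d" by (rule smooth_manifold_chart[OF B d(1)])
  have ne: "points M \<noteq> {}" using is_chart_inv_in[OF chm x] is_chart_subset[OF chm] by blast
  let ?q = "\<pi> \<circ> chart_inv m"
  have y: "snd d (?q x) \<in> chart_img d" using d(2) by (simp add: chart_img_def)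
  have "((\<lambda>y. log_vol (chart_inv d y)) has_derivative \<alpha> d (snd d (?q x))) (at ((snd d \<circ> ?q) x))"
    using log_vol_has_derivative[OF ne d(1) y] by (simp add: o_def)
  from diff_chain_at[OF plot_has_derivative[OF q d(1) x d(2)] this]
  have "(((\<lambda>y. log_vol (chart_inv d y)) \<circ> (snd d \<circ> ?q)) has_derivative
      (\<alpha> d (snd d (?q x)) \<circ> frechet_derivative (snd d \<circ> ?q) (at x))) (at x)" .
  moreover have "(\<alpha> d (snd d (?q x)) \<circ> frechet_derivative (snd d \<circ> ?q) (at x)) = pullback1 B \<pi> \<alpha> m x"
  proof (intro ext)
    show "(\<alpha> d (snd d (?q x)) \<circ> frechet_derivative (snd d \<circ> ?q) (at x)) v = pullback1 B \<pi> \<alpha> m x v" for v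
      unfolding pullback1_eq_pull1 pull1_chart[OF B \<alpha> q d(1) x d(2)] by simp
  qed
  ultimately have "(((\<lambda>y. log_vol (chart_inv d y)) \<circ> (snd d \<circ> ?q)) has_derivative pullback1 B \<pi> \<alpha> m x) (at x)" by simp
  then show ?thesis
  proof (rule has_derivative_transform_within_open)
    show "open (chart_img m \<inter> ?q -` fst d)" by (rule plot_open_preimage[OF q is_chart_openin[OF chd]])
    show "x \<in> chart_img m \<inter> ?q -` fst d" using x d(2) by simp
    show "((\<lambda>y. log_vol (chart_inv d y)) \<circ> (snd d \<circ> ?q)) y = (log_vol \<circ> \<pi> \<circ> chart_inv m) y"
      if "y \<in> chart_img m \<inter> ?q -` fst d" for y
      using that is_chart_inv_left[OF chd] by simp
  qed
qed

text \<open>A function whose derivative is a smooth one-form is smooth; this makes up for the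
  partition functions being known only as C1.\<close>

lemma log_vol_pullback:
  assumes cl: "one_form M (pullback1 B \<pi> \<alpha>)"
  shows "smooth_function M (log_vol \<circ> \<pi>)"
    and "m \<in> atlas M \<Longrightarrow> x \<in> chart_img m \<Longrightarrow> ext_d0 (log_vol \<circ> \<pi>) m x v = pullback1 B \<pi> \<alpha> m x v"
proof -
  show "smooth_function M (log_vol \<circ> \<pi>)"
    unfolding smooth_function_def smooth_on_def
  proof (intro ballI allI)
    fix m n assume m: "m \<in> atlas M"
    have o: "open (chart_img m)" by (rule is_chart_open_img[OF smooth_manifold_chart[OF M m]])
    have "differentiable_upto (chart_img m) (log_vol \<circ> \<pi> \<circ> chart_inv m) (Suc n)"
    proof (rule differentiable_upto_SucI[OF o log_vol_pullback_has_derivative[OF m]])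
      show "differentiable_upto (chart_img m) (\<lambda>x. pullback1 B \<pi> \<alpha> m x v) n" for v
        using cl m unfolding one_form_def by (intro smooth_on_imp) blast
    qed
    then show "differentiable_upto (chart_img m) (log_vol \<circ> \<pi> \<circ> chart_inv m) n"
      by (rule differentiable_upto_Suc_imp)
  qed
  show "ext_d0 (log_vol \<circ> \<pi>) m x v = pullback1 B \<pi> \<alpha> m x v" if "m \<in> atlas M" "x \<in> chart_img m"
    unfolding ext_d0_def using frechet_derivative_at[OF log_vol_pullback_has_derivative[OF that]] by simp
qed

end

lemma lee_form_cong:
  assumes "lee_form M \<Omega> \<theta>" "\<And>c x v. c \<in> atlas M \<Longrightarrow> x \<in> chart_img c \<Longrightarrow> \<theta>' c x v = \<theta> c x v"
  shows "lee_form M \<Omega> \<theta>'"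
  using assms unfolding lee_form_def wedge12_def by simp

theorem proposition4p4:
  fixes M :: "('a, complex^'m) mfd"
    and B :: "('b, 'n::complex_model) mfd"
    and F :: "('c, 'f::euclidean_space) mfd"
    and \<pi> :: "'a \<Rightarrow> 'b"
    and \<Omega> :: "('a, complex^'m) form2"
  assumes "complex_manifold M" and "connected_space (mtop M)" and "compact_space (mtop M)"
    and "complex_manifold B" and "connected_space (mtop B)" and "path_connected_space (mtop B)"
    and "smooth_manifold F" and "locally_trivial_fibration M B F \<pi>"
    and "\<forall>b\<in>points B. \<exists>k>0. complex_submanifold M {x \<in> points M. \<pi> x = b} k"
    and "lcs_taming M \<Omega>"
    and "H1_iso M B \<pi>"
  shows "globally_conformal_HS M \<Omega>"
proof -
  have M: "smooth_manifold M" and B: "smooth_manifold B"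
    using assms(1,4) by (auto simp: complex_manifold_def)
  obtain \<theta> where \<Omega>: "two_form M \<Omega>" "positive11 M (part11 \<Omega>)" and \<theta>: "closed_one_form M \<theta>" and lee: "lee_form M \<Omega> \<theta>"
    using assms(10) unfolding lcs_taming_def lee_form_def by blast
  obtain \<alpha> where \<alpha>: "closed_one_form B \<alpha>" and co: "cohomologous M \<theta> (pullback1 B \<pi> \<alpha>)"
    using H1_iso_surjective[OF assms(11) \<theta>] .
  have one: "one_form M (pullback1 B \<pi> \<alpha>)" using co by (simp add: cohomologous_def closed_one_form_def)
  obtain f where f: "smooth_function M f"
    "\<And>c x v. c \<in> atlas M \<Longrightarrow> x \<in> chart_img c \<Longrightarrow> \<theta> c x v - pullback1 B \<pi> \<alpha> c x v = ext_d0 f c x v"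
    using co unfolding cohomologous_def by blast
  \<comment> \<open>Its Lee form is \<theta> - df, which is the pullback of \<open>\<alpha>\<close>
    by the choice of f.\<close>
  define \<Omega>1 where "\<Omega>1 = fun_mult2 (\<lambda>p. exp (- f p)) \<Omega>"
  have \<Omega>1: "two_form M \<Omega>1" "positive11 M (part11 \<Omega>1)"
    unfolding \<Omega>1_def using conformal_two_form[OF M \<Omega>(1) f(1)] conformal_positive[OF M \<Omega>(1) f(1) \<Omega>(2)] by auto
  have lee1: "lee_form M \<Omega>1 (pullback1 B \<pi> \<alpha>)"
  proof (rule lee_form_cong)
    show "lee_form M \<Omega>1 (\<lambda>c x v. \<theta> c x v - ext_d0 f c x v)"
      unfolding \<Omega>1_def by (rule conformal_lee_form[OF M \<Omega>(1) f(1) lee])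
    show "pullback1 B \<pi> \<alpha> c x v = \<theta> c x v - ext_d0 f c x v" if "c \<in> atlas M" "x \<in> chart_img c" for c x v
      using f(2)[OF that, of v] by linarith
  qed
  interpret lcs_fibration M B F \<pi> \<Omega>1 \<alpha>
    using assms(3,7,8,9) M B \<Omega>1 \<alpha> lee1 by unfold_locales (auto simp: closed_one_form_def)
  define k where "k = log_vol \<circ> \<pi>"
  have k: "smooth_function M k" "\<And>c x v. c \<in> atlas M \<Longrightarrow> x \<in> chart_img c \<Longrightarrow> ext_d0 k c x v = pullback1 B \<pi> \<alpha> c x v"
    unfolding k_def using log_vol_pullback[OF one] by auto
  \<comment> \<open>The second factor removes the remaining Lee form, since dk is the pullback of
    \<open>\<alpha>\<close>.\<close>
  define \<Omega>2 where "\<Omega>2 = fun_mult2 (\<lambda>p. exp (- k p)) \<Omega>1"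
  have "lee_form M \<Omega>2 (\<lambda>c x v. 0)"
  proof (rule lee_form_cong)
    show "lee_form M \<Omega>2 (\<lambda>c x v. pullback1 B \<pi> \<alpha> c x v - ext_d0 k c x v)"
      unfolding \<Omega>2_def by (rule conformal_lee_form[OF M \<Omega>1(1) k(1) lee1])
  qed (simp add: k(2))
  then have "hermitian_symplectic M \<Omega>2"
    unfolding hermitian_symplectic_def lee_form_def wedge12_def \<Omega>2_def
    using conformal_two_form[OF M \<Omega>1(1) k(1)] conformal_positive[OF M \<Omega>1(1) k(1) \<Omega>1(2)] by simp
  moreover have "\<Omega>2 = fun_mult2 (\<lambda>p. exp (- (f p + k p))) \<Omega>"
    by (intro ext) (simp add: \<Omega>2_def \<Omega>1_def fun_mult2_def exp_add[symmetric] mult.assoc[symmetric] add.commute)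
  moreover have "smooth_function M (\<lambda>p. f p + k p)"
    using f(1) k(1) is_chart_open_img[OF smooth_manifold_chart[OF M]]
    unfolding smooth_function_def smooth_on_def o_def by (auto intro: differentiable_upto_add)
  ultimately show ?thesis unfolding globally_conformal_HS_def by (intro exI[of _ "\<lambda>p. f p + k p"]) simp
qed

end
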